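(* Fix $k_3\ge0$. The limits $E^{\mathrm{BC}}_\lambda(\infty;k_3;\cdot)=\lim E^{\mathrm{BC}}_\lambda(\kappa;\cdot)$, $\lambda\in\mathbb Z^n$ (as $k_1+k_2\to\infty$, $k_1/k_2\to\infty$; see context), are given as follows, for $x\in\mathbb R^n$. (i) If $\eta\in\mathbb N_0^n$, then $E^{\mathrm{BC}}_{-\eta}(\infty;k_3;x)=4^{|\eta|}E^{\mathrm{Jack}}_\eta(k_3;\cosh^2(\tfrac x2))$. (ii) Let $\lambda\in\mathbb Z^n\setminus(-\mathbb N_0^n)$ and let $1\le i_1<\dots<i_\ell\le n$ be the indices with $\lambda_{i_j}>0$. Put $$\lambda^*=(s_0\cdots s_{i_\ell-1})\cdots(s_0\cdots s_{i_1-1})\lambda=(1-\lambda_{i_\ell},\dots,1-\lambda_{i_1},\lambda')\in-\mathbb N_0^n,$$ where $\lambda'\in-\mathbb N_0^{n-\ell}$ is $\lambda$ with the entries $\lambda_{i_j}$ deleted. Then \begin{align*}E^{\mathrm{BC}}_\lambda(\infty;k_3;x)&=(e^{x_{i_1}}+1)\cdots(e^{x_{i_\ell}}+1)\,E^{\mathrm{BC}}_{\lambda^*}(\infty;k_3;x_{i_\ell},\dots,x_{i_1},x')\\&=4^{|\lambda|-\ell}(e^{x_{i_1}}+1)\cdots(e^{x_{i_\ell}}+1)\,E^{\mathrm{Jack}}_{-\lambda^*}\big(k_3;\cosh^2(\tfrac{x_{i_\ell}}2,\dots,\tfrac{x_{i_1}}2,\tfrac{x'}2)\big),\end{align*} where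 $x'\in\mathbb R^{n-\ell}$ is $x$ with the entries $x_{i_j}$ deleted. Moreover, $E^{\mathrm{BC}}_\lambda(\infty;k_3;\cdot)$ is invariant under $x_j\mapsto-x_j$ for every $j\notin\{i_1,\dots,i_\ell\}$. (iii) In the situation of (ii), $$\frac1{2^n}\sum_{\tau\in\mathbb Z_2^n}E^{\mathrm{BC}}_\lambda(\infty;k_3;\tau x)=4^{|\lambda|-\frac\ell2}\prod_{j=1}^\ell\cosh^2(\tfrac{x_{i_j}}2)\cdot E^{\mathrm{Jack}}_{-\lambda^*}\big(k_3;\cosh^2(\tfrac{\sigma_\lambda x}2)\big),$$ with $\sigma_\lambda=(s_1\cdots s_{i_\ell-1})\cdots(s_1\cdots s_{i_1-1})$, i.e. $\sigma_\lambda x=(x_{i_\ell},\dots,x_{i_1},x')$. This formula also holds for $\lambda\in-\mathbb N_0^n$ with $\ell=0$, $\lambda^*=\lambda$, $\sigma_\lambda=1$. (iv) For $\lambda\in\mathbb Z^n$ and $1\le i_1<\dots<i_\ell\le n$ the indices with $\lambda_{i_j}>0$, $$\frac1{2^n}\sum_{\tau\in\mathbb Z_2^n}E^{\mathrm{BC}}_\lambda(\infty;k_3;\tau x)=4^{|\lambda|-\frac\ell2}E^{\mathrm{Jack}}_{-\lambda^{**}}\big(k_3;\sigma_\lambda^*\cosh^2(\tfrac x2)\big),$$ where $\lambda^{**}=(\lambda',-\lambda_{i_\ell},\dots,-\lambda_{i_1})$ and $\sigma^*_\lambda y=(y',y_{i_\ell},\dots,y_{i_1})$, with $\lambda'$ and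 $y'$ obtained by deleting the entries with indices $i_1,\dots,i_\ell$.
   Context: Functions such as $\cosh^2(\cdot/2)$ are applied componentwise to vectors. $|\lambda|=\sum_i|\lambda_i|$ for $\lambda\in\mathbb Z^n$. $\mathbb Z_2^n$ acts on $\mathbb R^n$ by sign changes of coordinates. $\langle\cdot,\cdot\rangle$ is the standard inner product. **Reflections.** On $\mathbb R^n$: $s_0x=(1-x_1,x_2,\dots,x_n)$; for $1\le i<n$, $s_i$ interchanges $x_i$ and $x_{i+1}$; $s_n$ changes the sign of $x_n$. Products are compositions of maps; $s_0\cdots s_{i-1}$ means $s_0s_1\cdots s_{i-1}$ and $s_1\cdots s_{i-1}$ is the identity if $i=1$. **Non-symmetric Heckman-Opdam polynomials of type BC.** $\mathrm{BC}_n^+=\{e_i,2e_i:1\le i\le n\}\cup\{e_i\pm e_j:i<j\}$, with multiplicity $\kappa=(k_1,k_2,k_3)\ge0$: $k_1$ on $\pm e_i$, $k_2$ on $\pm2e_i$, $k_3$ on $\pm(e_i\pm e_j)$. Cherednik operators: $$D_\xi(\kappa)=\partial_\xi-\langle\rho(\kappa),\xi\rangle+\sum_{\alpha\in\mathrm{BC}_n^+}\kappa_\alpha\langle\alpha,\xi\rangle\frac{1-s_\alpha}{1-e^{-\alpha}},\quad\rho(\kappa)=\tfrac12\sum_{\alpha\in\mathrm{BC}_n^+}\kappa_\alpha\alpha,$$ with $e^{\mu}(z)=e^{\langle\mu,z\rangle}$ and $(s_\alpha f)(x)=f(s_\alpha x)$, $s_\alpha$ the reflection in $\alpha^\perp$.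 For $\mu,\lambda\in\mathbb Z^n$: $\mu\le\lambda$ iff $\sum_{i=1}^p\mu_i\le\sum_{i=1}^p\lambda_i$ for all $p=1,\dots,n$; $\mu_+$ is the unique element of the orbit of $\mu$ under permutations and sign changes with $\mu_{+,1}\ge\dots\ge\mu_{+,n}\ge0$; $\mu\trianglelefteq\lambda$ iff either $\mu_+\ne\lambda_+$ and $\mu_+\le\lambda_+$, or $\mu_+=\lambda_+$ and $\lambda\le\mu$; $\mu\triangleleft\lambda$ means $\mu\trianglelefteq\lambda$, $\mu\ne\lambda$. $E^{\mathrm{BC}}_\lambda(\kappa;\cdot)$, $\lambda\in\mathbb Z^n$, is the unique element of $\mathrm{span}_{\mathbb C}\{e^\mu:\mu\in\mathbb Z^n\}$ of the form $e^\lambda+\sum_{\mu\triangleleft\lambda}c_{\mu\lambda}(\kappa)e^\mu$ that is a joint eigenfunction of all $D_\xi(\kappa)$, $\xi\in\mathbb R^n$. For fixed $k_3$, $E^{\mathrm{BC}}_\lambda(\infty;k_3;\cdot)$ denotes the limit of $E^{\mathrm{BC}}_\lambda(\kappa;\cdot)$ as $k_1+k_2\to\infty$, $k_1/k_2\to\infty$ (including $k_2=0$ with $k_1/k_2=\infty$); this limit exists locally uniformly on $\mathbb C^n$. **Non-symmetric Jack polynomials** $E^{\mathrm{Jack}}_\eta(k;\cdot)$, $\eta\in\mathbb N_0^n$ (index $1/k$) are the polynomials determined by $E_0^{\mathrm{Jack}}(k;\cdot)\equiv1$ and: - $E^{\mathrm{Jack}}_{\Phi\eta}(k;y)=y_nE^{\mathrm{Jack}}_\eta(k;y_n,y_1,\dots,y_{n-1})$,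 where $\Phi\eta=(\eta_2,\dots,\eta_n,\eta_1+1)$; - if $1\le i\le n-1$ and $\eta_i<\eta_{i+1}$, then $E^{\mathrm{Jack}}_{s_i\eta}(k;y)=E^{\mathrm{Jack}}_\eta(k;s_iy)+\frac{k}{\overline\eta_{i+1}-\overline\eta_i}E^{\mathrm{Jack}}_\eta(k;y)$, where $\overline\eta_i=\eta_i-k\,\#\{j<i:\eta_j\ge\eta_i\}-k\,\#\{j>i:\eta_j>\eta_i\}$. *)

theory Defs
  imports "HOL-Analysis.Analysis"
begin

text \<open>
  Vectors of dimension \<open>n\<close> are lists of length \<open>n\<close>. The mathematical coordinate \<open>x\<^sub>i\<close>
  (\<open>1 \<le> i \<le> n\<close>) is \<open>x ! (i - 1)\<close>; the functions below that take coordinate indices as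
  arguments or return them use the mathematical numbering \<open>1, \<dots>, n\<close>.
\<close>

definition dot :: "'a::comm_ring_1 list \<Rightarrow> 'a list \<Rightarrow> 'a" where
  "dot x y = (\<Sum>i<length x. x ! i * y ! i)"

definition norm1 :: "int list \<Rightarrow> int" where
  "norm1 v = (\<Sum>a\<leftarrow>v. \<bar>a\<bar>)"

definition cvec :: "real list \<Rightarrow> complex list" where
  "cvec x = map complex_of_real x"

definition cosh2_half :: "real list \<Rightarrow> complex list" where
  "cosh2_half x = map (\<lambda>t. complex_of_real ((cosh (t / 2))\<^sup>2)) x"

definition sign_vectors :: "nat \<Rightarrow> real list set" where
  "sign_vectors n = {\<tau>. length \<tau> = n \<and> set \<tau> \<subseteq> {1, -1}}"

definition sign_act :: "real list \<Rightarrow> real list \<Rightarrow> real list" where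
  "sign_act \<tau> x = map2 (*) \<tau> x"


section \<open>Reflections\<close>

definition swap_adj :: "nat \<Rightarrow> 'a list \<Rightarrow> 'a list" where
  "swap_adj i x = x[i - 1 := x ! i, i := x ! (i - 1)]"

definition aff_refl :: "nat \<Rightarrow> 'a::ring_1 list \<Rightarrow> 'a list" where
  "aff_refl i x =
     (if i = 0 then x[0 := 1 - x ! 0]
      else if i < length x then swap_adj i x
      else x[i - 1 := - x ! (i - 1)])"


section \<open>Non-symmetric Heckman-Opdam polynomials of type BC\<close>

definition unit_vec :: "nat \<Rightarrow> nat \<Rightarrow> int list" where
  "unit_vec n i = map (\<lambda>j. if Suc j = i then 1 else 0) [0..<n]"

definition short_roots :: "nat \<Rightarrow> int list set" where
  "short_roots n = unit_vec n ` {1..n}"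

definition long_roots :: "nat \<Rightarrow> int list set" where
  "long_roots n = (\<lambda>i. map ((*) 2) (unit_vec n i)) ` {1..n}"

definition middle_roots :: "nat \<Rightarrow> int list set" where
  "middle_roots n =
     {map2 (-) (unit_vec n i) (unit_vec n j) | i j. 1 \<le> i \<and> i < j \<and> j \<le> n} \<union>
     {map2 (+) (unit_vec n i) (unit_vec n j) | i j. 1 \<le> i \<and> i < j \<and> j \<le> n}"

definition BC_pos :: "nat \<Rightarrow> int list set" where
  "BC_pos n = short_roots n \<union> long_roots n \<union> middle_roots n"

text \<open>Multiplicities \<open>\<kappa> = (k\<^sub>1, k\<^sub>2, k\<^sub>3)\<close>, needed on positive roots only.\<close>

definition BC_mult :: "real \<times> real \<times> real \<Rightarrow> int list \<Rightarrow> real" where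
  "BC_mult \<kappa> \<alpha> =
     (case \<kappa> of (k1, k2, k3) \<Rightarrow>
        if \<alpha> \<in> short_roots (length \<alpha>) then k1
        else if \<alpha> \<in> long_roots (length \<alpha>) then k2
        else k3)"

definition BC_rho :: "nat \<Rightarrow> real \<times> real \<times> real \<Rightarrow> real list" where
  "BC_rho n \<kappa> = map (\<lambda>j. (\<Sum>\<alpha>\<in>BC_pos n. BC_mult \<kappa> \<alpha> * of_int (\<alpha> ! j)) / 2) [0..<n]"

definition root_refl :: "int list \<Rightarrow> complex list \<Rightarrow> complex list" where
  "root_refl \<alpha> z =
     map2 (\<lambda>a w. w - 2 * dot (map of_int \<alpha>) z / of_int (dot \<alpha> \<alpha>) * of_int a) \<alpha> z"

definition expo :: "int list \<Rightarrow> complex list \<Rightarrow> complex" where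
  "expo \<mu> z = exp (dot (map of_int \<mu>) z)"

definition cherednik ::
  "real \<times> real \<times> real \<Rightarrow> real list \<Rightarrow> (complex list \<Rightarrow> complex) \<Rightarrow> complex list \<Rightarrow> complex" where
  "cherednik \<kappa> \<xi> f z =
     deriv (\<lambda>t. f (map2 (\<lambda>w a. w + t * complex_of_real a) z \<xi>)) 0
     - of_real (dot (BC_rho (length \<xi>) \<kappa>) \<xi>) * f z
     + (\<Sum>\<alpha>\<in>BC_pos (length \<xi>).
          of_real (BC_mult \<kappa> \<alpha> * dot (map of_int \<alpha>) \<xi>) *
          ((f z - f (root_refl \<alpha> z)) / (1 - expo (map uminus \<alpha>) z)))"

text \<open>
  On exponential polynomials the quotients in the Cherednik operators have removable
  singularities, and the formula in \<^const>\<open>cherednik\<close> is the operator off the zeros of the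
  denominators, a dense open set.
\<close>

definition regular_points :: "nat \<Rightarrow> complex list set" where
  "regular_points n = {z. length z = n \<and> (\<forall>\<alpha>\<in>BC_pos n. expo (map uminus \<alpha>) z \<noteq> 1)}"

definition joint_eigenfunction ::
  "nat \<Rightarrow> real \<times> real \<times> real \<Rightarrow> (complex list \<Rightarrow> complex) \<Rightarrow> bool" where
  "joint_eigenfunction n \<kappa> f \<longleftrightarrow>
     (\<forall>\<xi>. length \<xi> = n \<longrightarrow> (\<exists>v. \<forall>z\<in>regular_points n. cherednik \<kappa> \<xi> f z = v * f z))"

definition dom_le :: "int list \<Rightarrow> int list \<Rightarrow> bool" where
  "dom_le \<mu> lam \<longleftrightarrow> (\<forall>p\<in>{1..length lam}. (\<Sum>i<p. \<mu> ! i) \<le> (\<Sum>i<p. lam ! i))"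

definition orbit_BC :: "int list \<Rightarrow> int list set" where
  "orbit_BC \<mu> =
     {map (\<lambda>i. \<epsilon> i * \<mu> ! \<pi> i) [0..<length \<mu>] | \<epsilon> \<pi>.
        \<pi> permutes {..<length \<mu>} \<and> (\<forall>i. \<epsilon> i \<in> {1, -1})}"

definition dominant :: "int list \<Rightarrow> int list" where
  "dominant \<mu> = (THE \<nu>. \<nu> \<in> orbit_BC \<mu> \<and> sorted_wrt (\<ge>) \<nu> \<and> (\<forall>a\<in>set \<nu>. 0 \<le> a))"

definition tri_le :: "int list \<Rightarrow> int list \<Rightarrow> bool" where
  "tri_le \<mu> lam \<longleftrightarrow>
     dominant \<mu> \<noteq> dominant lam \<and> dom_le (dominant \<mu>) (dominant lam) \<or>
     dominant \<mu> = dominant lam \<and> dom_le lam \<mu>"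

definition tri_lower :: "int list \<Rightarrow> int list set" where
  "tri_lower lam = {\<mu>. length \<mu> = length lam \<and> tri_le \<mu> lam \<and> \<mu> \<noteq> lam}"

text \<open>
  A combination of the \<^const>\<open>expo\<close> functions is determined, also at lists of a length other
  than \<open>length lam\<close>, by its coefficients, so no normalisation outside \<open>\<complex>\<^sup>n\<close> is needed for
  uniqueness.
\<close>

definition E_BC :: "real \<times> real \<times> real \<Rightarrow> int list \<Rightarrow> complex list \<Rightarrow> complex" where
  "E_BC \<kappa> lam =
     (THE f. (\<exists>A c. finite A \<and> A \<subseteq> tri_lower lam \<and>
                 f = (\<lambda>z. expo lam z + (\<Sum>\<mu>\<in>A. c \<mu> * expo \<mu> z))) \<and>
             joint_eigenfunction (length lam) \<kappa> f)"

text \<open>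
  The regime \<open>k\<^sub>1 + k\<^sub>2 \<rightarrow> \<infinity>\<close>, \<open>k\<^sub>1 / k\<^sub>2 \<rightarrow> \<infinity>\<close> with \<open>k\<^sub>1, k\<^sub>2 \<ge> 0\<close>, where \<open>k\<^sub>1 / 0 = \<infinity>\<close>.
\<close>

definition BC_filter :: "(real \<times> real) filter" where
  "BC_filter =
     (INF M. principal {(k1, k2). 0 \<le> k1 \<and> 0 \<le> k2 \<and> M \<le> k1 + k2 \<and> (k2 = 0 \<or> M \<le> k1 / k2)})"

definition E_BC_inf :: "real \<Rightarrow> int list \<Rightarrow> complex list \<Rightarrow> complex" where
  "E_BC_inf k3 lam z = Lim BC_filter (\<lambda>(k1, k2). E_BC (k1, k2, k3) lam z)"


section \<open>Non-symmetric Jack polynomials\<close>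

text \<open>The \<open>i\<close>-th entry of the list \<open>eta_bar k \<eta>\<close> (from \<open>0\<close>) is \<open>\<eta>\<close>-bar with index \<open>i + 1\<close>.\<close>

definition eta_bar :: "real \<Rightarrow> nat list \<Rightarrow> real list" where
  "eta_bar k \<eta> =
     map (\<lambda>i. real (\<eta> ! i)
            - k * real (card {j. j < i \<and> \<eta> ! j \<ge> \<eta> ! i})
            - k * real (card {j. i < j \<and> j < length \<eta> \<and> \<eta> ! j > \<eta> ! i})) [0..<length \<eta>]"

definition jack_Phi :: "nat list \<Rightarrow> nat list" where
  "jack_Phi \<eta> = tl \<eta> @ [hd \<eta> + 1]"

text \<open>
  The first conjunct only fixes the values outside \<open>\<complex>\<^sup>n\<close> and outside the index set \<open>\<nat>\<^sup>n\<close>,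
  so that the family is unique as a total function.
\<close>

definition jack_family :: "nat \<Rightarrow> real \<Rightarrow> (nat list \<Rightarrow> complex list \<Rightarrow> complex) \<Rightarrow> bool" where
  "jack_family n k E \<longleftrightarrow>
     (\<forall>\<eta> y. length \<eta> \<noteq> n \<or> length y \<noteq> n \<longrightarrow> E \<eta> y = 0) \<and>
     (\<forall>y. length y = n \<longrightarrow> E (replicate n 0) y = 1) \<and>
     (\<forall>\<eta> y. length \<eta> = n \<and> length y = n \<longrightarrow>
        E (jack_Phi \<eta>) y = last y * E \<eta> (last y # butlast y)) \<and>
     (\<forall>\<eta> y i. length \<eta> = n \<and> length y = n \<and> 1 \<le> i \<and> i < n \<and> \<eta> ! (i - 1) < \<eta> ! i \<longrightarrow>
        E (swap_adj i \<eta>) y =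
          E \<eta> (swap_adj i y) +
          of_real (k / (eta_bar k \<eta> ! i - eta_bar k \<eta> ! (i - 1))) * E \<eta> y)"

definition E_Jack :: "real \<Rightarrow> nat list \<Rightarrow> complex list \<Rightarrow> complex" where
  "E_Jack k \<eta> = (THE E. jack_family (length \<eta>) k E) \<eta>"


section \<open>Index operations\<close>

text \<open>
  \<open>pos_inds lam\<close> is \<open>i\<^sub>1 < \<dots> < i\<^sub>\<ell>\<close>; deleting the corresponding entries of \<open>x\<close> is
  \<open>select x (nonpos_inds lam)\<close>.
\<close>

definition pos_inds :: "int list \<Rightarrow> nat list" where
  "pos_inds lam = filter (\<lambda>i. 0 < lam ! (i - 1)) [1..<Suc (length lam)]"

definition nonpos_inds :: "int list \<Rightarrow> nat list" where
  "nonpos_inds lam = filter (\<lambda>i. \<not> 0 < lam ! (i - 1)) [1..<Suc (length lam)]"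

definition select :: "'a list \<Rightarrow> nat list \<Rightarrow> 'a list" where
  "select x I = map (\<lambda>i. x ! (i - 1)) I"

text \<open>\<open>refl_word a b\<close> is the composition \<open>s\<^sub>a \<circ> s\<^sub>a\<^sub>+\<^sub>1 \<circ> \<dots> \<circ> s\<^sub>b\<^sub>-\<^sub>1\<close>.\<close>

definition refl_word :: "nat \<Rightarrow> nat \<Rightarrow> 'a::ring_1 list \<Rightarrow> 'a list" where
  "refl_word a b = foldr aff_refl [a..<b]"

definition lam_star :: "int list \<Rightarrow> int list" where
  "lam_star lam = fold (refl_word 0) (pos_inds lam) lam"

definition sigma_perm :: "int list \<Rightarrow> 'a::ring_1 list \<Rightarrow> 'a list" where
  "sigma_perm lam = fold (refl_word 1) (pos_inds lam)"

definition lam_star2 :: "int list \<Rightarrow> int list" where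
  "lam_star2 lam = select lam (nonpos_inds lam) @ map uminus (select lam (rev (pos_inds lam)))"

definition sigma_star :: "int list \<Rightarrow> 'a list \<Rightarrow> 'a list" where
  "sigma_star lam y = select y (nonpos_inds lam) @ select y (rev (pos_inds lam))"

text \<open>The element \<open>-\<mu> \<in> \<nat>\<^sup>n\<close> for \<open>\<mu> \<in> -\<nat>\<^sup>n\<close>.\<close>

definition neg_index :: "int list \<Rightarrow> nat list" where
  "neg_index \<mu> = map (\<lambda>a. nat (- a)) \<mu>"

definition sign_average :: "nat \<Rightarrow> (complex list \<Rightarrow> complex) \<Rightarrow> real list \<Rightarrow> complex" where
  "sign_average n f x = 1 / 2 ^ n * (\<Sum>\<tau>\<in>sign_vectors n. f (cvec (sign_act \<tau> x)))"

end

theory Submission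
  imports Defs
begin

text \<open>
  The Cherednik operators, the sign changes and permutations \<open>s\<^sub>1, \<dots>, s\<^sub>n\<close> and the affine
  reflection \<open>s\<^sub>0 f(z) = exp z\<^sub>1 \<cdot> f (-z\<^sub>1, z\<^sub>2, \<dots>, z\<^sub>n)\<close> satisfy the relations of a degenerate affine
  Hecke algebra (\<open>cherednik_swap\<close>, \<open>cherednik_sign\<close>, \<open>cherednik_affine\<close>): moving \<open>D\<^sub>\<xi>\<close> past \<open>s\<^sub>i\<close>
  costs a scalar. Hence, if \<open>f\<close> is a joint eigenfunction, so is \<open>s\<^sub>i f + c f\<close> for a suitable
  scalar \<open>c\<close>. Starting from \<open>E\<^sub>0 = 1\<close> this produces every \<open>E\<^sub>\<lambda>\<close>: every \<open>\<lambda>\<close> arises from \<open>0\<close> by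
  simple affine reflections each of which raises the index, and
  \<open>E\<^bsub>s\<^sub>i \<lambda>\<^esub> = s\<^sub>i E\<^sub>\<lambda> + c\<^sub>i E\<^sub>\<lambda>\<close> (\<open>E_BC_aff_refl\<close>).

  For this to be the polynomial of the definition two things are needed. The first is
  triangularity. The order \<open>tri_le\<close> is not compatible with \<open>s\<^sub>0\<close>; for example \<open>(-2, 1, 1)\<close> lies
  below \<open>(0, 2, 2)\<close>, but \<open>(3, 1, 1)\<close> does not lie below \<open>(1, 2, 2)\<close>. The supports are therefore
  controlled by the smaller affine Bruhat order on \<open>\<int>\<^sup>n\<close>, which has the lifting property
  (\<open>bruhat_lifting\<close>) and implies \<open>tri_le\<close> (\<open>bruhat_lower_tri_lower\<close>). The second is uniqueness,
  which holds because the eigenvalues separate the indices. The spectral vector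
  \<open>\<gamma>(\<lambda>) = \<lambda> + 1/2 \<cdot> \<Sum>\<^sub>\<alpha> \<kappa>\<^sub>\<alpha> sgn \<langle>\<alpha>, \<lambda>\<rangle> \<alpha>\<close> is a monotone map of \<open>\<lambda>\<close> (\<open>spectral_monotone\<close>), hence
  injective, and the polynomials found above form a basis of the exponential sums
  (\<open>joint_eigenfunction_unique\<close>).

  In the limit the scalars \<open>c\<^sub>i\<close> converge (\<open>raise_coeff_tendsto\<close>): to \<open>1\<close> for \<open>s\<^sub>0\<close> and \<open>s\<^sub>n\<close>, to \<open>0\<close>
  for an exchange of a positive with a nonpositive entry, and to the constant in the recursion of
  the Jack polynomials for an exchange of two nonpositive entries. So \<open>E\<^sub>\<lambda>\<close> converges and its limit
  obeys the limiting recursion (\<open>E_BC_inf_aff_refl\<close>). For \<open>\<lambda> = -\<eta>\<close> the word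
  \<open>s\<^sub>n s\<^bsub>n-1\<^esub> \<cdots> s\<^sub>1 s\<^sub>0\<close> carries \<open>-\<eta>\<close> to \<open>-\<Phi>\<eta>\<close> and multiplies the limit by
  \<open>(exp z + 1) (exp (-z) + 1) = 4 cosh\<^sup>2 (z / 2)\<close>, with \<open>z\<close> the last variable. These are the two
  recursions of the Jack polynomials in the variables \<open>cosh\<^sup>2 (z\<^sub>j / 2)\<close>. By induction along them the
  limit is a function of these variables (\<open>E_BC_inf_neg_cosh\<close>), and this function is a Jack family
  (\<open>jack_family_limit\<close>); thus the limit also supplies the existence of the Jack polynomials, and
  the recursions give their uniqueness.

  For the remaining indices a positive entry preceded by nonpositive entries moves to the front
  without any change except the permutation of the variables, and there \<open>s\<^sub>0\<close> contributes the factor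
  \<open>exp w + 1\<close> (\<open>E_BC_inf_positive\<close>). Averaging over signs turns this factor into
  \<open>cosh w + 1 = 2 cosh\<^sup>2 (w / 2)\<close>, and these squares are absorbed by the recursion for \<open>\<Phi>\<close>
  (\<open>E_Jack_rotate\<close>).
\<close>

section \<open>Linear parts of the simple reflections\<close>

text \<open>
  The simple reflections \<open>s\<^sub>1, \<dots>, s\<^sub>n\<close> and the linear part of \<open>s\<^sub>0\<close> (the sign change of the first
  coordinate) are signed permutations. Writing all of them in the form \<open>x \<mapsto> (\<epsilon>\<^sub>j x\<^bsub>\<pi> j\<^esub>)\<^sub>j\<close>, with the sign
  \<open>refl_sign n i j\<close> and the index \<open>refl_idx n i j\<close>, lets most arguments treat them at once.
\<close>

definition refl_sign :: "nat \<Rightarrow> nat \<Rightarrow> nat \<Rightarrow> int" where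
  "refl_sign n i j = (if i = 0 \<and> j = 0 \<or> i = n \<and> Suc j = n then -1 else 1)"

definition refl_idx :: "nat \<Rightarrow> nat \<Rightarrow> nat \<Rightarrow> nat" where
  "refl_idx n i j =
     (if 0 < i \<and> i < n \<and> Suc j = i then i else if 0 < i \<and> i < n \<and> j = i then i - 1 else j)"

definition lin_refl :: "nat \<Rightarrow> 'a::comm_ring_1 list \<Rightarrow> 'a list" where
  "lin_refl i x =
     map (\<lambda>j. of_int (refl_sign (length x) i j) * x ! refl_idx (length x) i j) [0..<length x]"

lemma length_lin_refl [simp]: "length (lin_refl i x) = length x"
  by (simp add: lin_refl_def)

lemma nth_lin_refl:
  "j < length x \<Longrightarrow> lin_refl i x ! j = of_int (refl_sign (length x) i j) * x ! refl_idx (length x) i j"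
  by (simp add: lin_refl_def)

lemma refl_idx_less: "j < n \<Longrightarrow> refl_idx n i j < n"
  by (auto simp: refl_idx_def)

lemma refl_idx_idem [simp]: "refl_idx n i (refl_idx n i j) = j"
  by (auto simp: refl_idx_def)

lemma refl_idx_eq_iff [simp]: "refl_idx n i j = refl_idx n i k \<longleftrightarrow> j = k"
  by (metis refl_idx_idem)

lemma refl_sign_idx [simp]: "refl_sign n i (refl_idx n i j) = refl_sign n i j"
  by (auto simp: refl_sign_def refl_idx_def)

lemma refl_sign_square [simp]: "refl_sign n i j * refl_sign n i j = 1"
  by (auto simp: refl_sign_def)

lemma of_int_refl_sign_square [simp]:
  "of_int (refl_sign n i j) * (of_int (refl_sign n i j) * a) = (a :: 'a::comm_ring_1)"
  by (auto simp: refl_sign_def)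

lemma lin_refl_lin_refl [simp]: "lin_refl i (lin_refl i x) = x"
  by (rule nth_equalityI) (auto simp: nth_lin_refl refl_idx_less)

lemma bij_betw_refl_idx: "bij_betw (refl_idx n i) {..<n} {..<n}"
  by (rule bij_betw_byWitness[where f' = "refl_idx n i"]) (auto simp: refl_idx_less)

lemma dot_lin_refl_lin_refl:
  assumes "length x = length y"
  shows "dot (lin_refl i x) (lin_refl i y) = dot x y"
proof -
  let ?n = "length x" and ?p = "refl_idx (length x) i"
  have "dot (lin_refl i x) (lin_refl i y) = (\<Sum>j<?n. x ! ?p j * y ! ?p j)"
    unfolding dot_def using assms
    by (intro sum.cong) (auto simp: nth_lin_refl refl_sign_def)
  also have "\<dots> = (\<Sum>j<?n. x ! j * y ! j)"
    using sum.reindex_bij_betw[OF bij_betw_refl_idx[of ?n i], of "\<lambda>j. x ! j * y ! j"] by simp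
  finally show ?thesis by (simp add: dot_def)
qed

lemma dot_lin_refl: "length x = length y \<Longrightarrow> dot (lin_refl i x) y = dot x (lin_refl i y)"
  by (metis dot_lin_refl_lin_refl length_lin_refl lin_refl_lin_refl)

lemma lin_refl_of_int: "map of_int (lin_refl i \<alpha>) = lin_refl i (map of_int \<alpha>)"
  by (rule nth_equalityI) (auto simp: nth_lin_refl refl_idx_less)

lemma lin_refl_uminus: "lin_refl i (map uminus x) = map uminus (lin_refl i x)"
  by (rule nth_equalityI) (auto simp: nth_lin_refl refl_idx_less)

lemma aff_refl_eq_lin_refl:
  assumes "0 < i" "i \<le> length x"
  shows "aff_refl i x = lin_refl i x"
  using assms
  by (intro nth_equalityI)
     (auto simp: aff_refl_def swap_adj_def nth_lin_refl nth_list_update refl_sign_def refl_idx_def)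

lemma aff_refl_0_eq: "aff_refl 0 x = (lin_refl 0 x)[0 := 1 + lin_refl 0 x ! 0]"
  by (cases x; intro nth_equalityI)
     (auto simp: aff_refl_def nth_lin_refl nth_list_update refl_sign_def refl_idx_def)

lemma lin_refl_0_Cons: "lin_refl 0 (a # x) = - a # x"
  by (rule nth_equalityI) (auto simp: nth_lin_refl refl_sign_def refl_idx_def nth_Cons')

lemma length_aff_refl [simp]: "length (aff_refl i x) = length x"
  by (simp add: aff_refl_def swap_adj_def)

lemma aff_refl_aff_refl:
  fixes x :: "'a::comm_ring_1 list"
  assumes "i \<le> length x"
  shows "aff_refl i (aff_refl i x) = x"
proof (cases "i = 0")
  case True
  then show ?thesis by (cases x) (auto simp: aff_refl_def)
next
  case False
  then show ?thesis using assms by (simp add: aff_refl_eq_lin_refl)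
qed

text \<open>All simple reflections at once: the linear part plus a shift of the first coordinate.\<close>

lemma nth_aff_refl:
  fixes x :: "'a::comm_ring_1 list"
  assumes "i \<le> length x" "j < length x"
  shows "aff_refl i x ! j = lin_refl i x ! j + (if i = 0 \<and> j = 0 then 1 else 0)"
  using assms by (cases "i = 0") (auto simp: aff_refl_0_eq aff_refl_eq_lin_refl nth_list_update)

section \<open>Positive roots\<close>

text \<open>
  The vector \<open>a e\<^sub>i + b e\<^sub>j\<close> with coordinates counted from \<open>0\<close>. Every root has this form; for the
  multiples of \<open>e\<^sub>i\<close> the second term is \<open>0 e\<^sub>i\<close>.
\<close>

definition two_term :: "nat \<Rightarrow> int \<Rightarrow> nat \<Rightarrow> int \<Rightarrow> nat \<Rightarrow> int list" where
  "two_term n a i b j =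
     map (\<lambda>k. (if k = i then a else 0) + (if k = j then b else 0)) [0..<n]"

lemma length_two_term [simp]: "length (two_term n a i b j) = n"
  by (simp add: two_term_def)

lemma nth_two_term:
  "k < n \<Longrightarrow> two_term n a i b j ! k = (if k = i then a else 0) + (if k = j then b else 0)"
  by (simp add: two_term_def)

lemma dot_two_term:
  assumes "i < n" "j < n"
  shows "dot (map of_int (two_term n a i b j)) x = of_int a * x ! i + of_int b * x ! j"
proof -
  have "dot (map of_int (two_term n a i b j)) x
      = (\<Sum>k<n. (if k = i then of_int a * x ! k else 0) + (if k = j then of_int b * x ! k else 0))"
    unfolding dot_def by (intro sum.cong) (auto simp: nth_two_term distrib_right)
  also have "\<dots> = of_int a * x ! i + of_int b * x ! j"
    using assms by (simp add: sum.distrib)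
  finally show ?thesis .
qed

lemma dot_two_term_int:
  assumes "i < n" "j < n"
  shows "dot (two_term n a i b j) (x :: int list) = a * x ! i + b * x ! j"
  using dot_two_term[OF assms, of a b x] by (simp add: map_idI)

lemma lin_refl_two_term:
  assumes "i < n" "j < n"
  shows "lin_refl p (two_term n a i b j)
       = two_term n (refl_sign n p i * a) (refl_idx n p i) (refl_sign n p j * b) (refl_idx n p j)"
proof (rule nth_equalityI)
  fix k assume "k < length (lin_refl p (two_term n a i b j))"
  then have k: "k < n" by simp
  have inv: "refl_idx n p k = l \<longleftrightarrow> k = refl_idx n p l" for l
    by auto
  have s: "refl_sign n p (refl_idx n p l) = refl_sign n p l" for l by simp
  show "lin_refl p (two_term n a i b j) ! k
    = two_term n (refl_sign n p i * a) (refl_idx n p i) (refl_sign n p j * b) (refl_idx n p j) ! k"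
    using k by (auto simp: nth_lin_refl nth_two_term refl_idx_less inv distrib_left)
qed simp

lemma uminus_two_term: "map uminus (two_term n a i b j) = two_term n (- a) i (- b) j"
  by (rule nth_equalityI) (auto simp: nth_two_term)

lemma two_term_commute: "two_term n a i b j = two_term n b j a i"
  by (rule nth_equalityI) (auto simp: nth_two_term)

lemma unit_vec_eq: "unit_vec n (Suc i) = two_term n 1 i 0 i"
  by (rule nth_equalityI) (auto simp: nth_two_term unit_vec_def)

lemma double_unit_vec: "map ((*) 2) (unit_vec n (Suc i)) = two_term n 2 i 0 i"
  by (rule nth_equalityI) (auto simp: nth_two_term unit_vec_eq)

lemma atLeastAtMost_Suc_image: "{1..n} = Suc ` {..<n}"
  by (auto simp: image_iff gr0_conv_Suc Suc_le_eq)

lemma short_roots_eq: "short_roots n = (\<lambda>i. two_term n 1 i 0 i) ` {..<n}"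
  unfolding short_roots_def atLeastAtMost_Suc_image image_image unit_vec_eq ..

lemma long_roots_eq: "long_roots n = (\<lambda>i. two_term n 2 i 0 i) ` {..<n}"
  unfolding long_roots_def atLeastAtMost_Suc_image image_image double_unit_vec ..

lemma middle_roots_eq:
  "middle_roots n = {two_term n 1 i e j | i e j. i < j \<and> j < n \<and> e \<in> {1, -1}}"
proof -
  have m: "map2 (-) (unit_vec n (Suc i)) (unit_vec n (Suc j)) = two_term n 1 i (-1) j"
    "map2 (+) (unit_vec n (Suc i)) (unit_vec n (Suc j)) = two_term n 1 i 1 j" for i j
    by (rule nth_equalityI; auto simp: nth_two_term unit_vec_eq)+
  show ?thesis (is "?L = ?R")
  proof (rule Set.set_eqI)
    fix \<alpha>
    have "\<alpha> \<in> ?L \<longleftrightarrow> (\<exists>i j. 1 \<le> i \<and> i < j \<and> j \<le> n \<and>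
        (\<alpha> = map2 (-) (unit_vec n i) (unit_vec n j) \<or> \<alpha> = map2 (+) (unit_vec n i) (unit_vec n j)))"
      unfolding middle_roots_def by blast
    also have "\<dots> \<longleftrightarrow> (\<exists>i j. i < j \<and> j < n \<and>
        (\<alpha> = two_term n 1 i (-1) j \<or> \<alpha> = two_term n 1 i 1 j))" (is "?A \<longleftrightarrow> ?B")
    proof
      assume ?A
      then obtain i j where "1 \<le> i" "i < j" "j \<le> n" and
        e: "\<alpha> = map2 (-) (unit_vec n i) (unit_vec n j) \<or> \<alpha> = map2 (+) (unit_vec n i) (unit_vec n j)"
        by blast
      then obtain i' j' where "i = Suc i'" "j = Suc j'" "i' < j'" "j' < n"
        by (cases i; cases j) auto
      with e m show ?B by auto
    next
      assume ?B
      then obtain i j where "i < j" "j < n" "\<alpha> = two_term n 1 i (-1) j \<or> \<alpha> = two_term n 1 i 1 j"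
        by blast
      then show ?A by (intro exI[of _ "Suc i"] exI[of _ "Suc j"]) (auto simp: m)
    qed
    also have "\<dots> \<longleftrightarrow> \<alpha> \<in> ?R" by blast
    finally show "\<alpha> \<in> ?L \<longleftrightarrow> \<alpha> \<in> ?R" .
  qed
qed

lemma middle_rootsE:
  assumes "\<alpha> \<in> middle_roots n"
  obtains i e j where "i < j" "j < n" "e = 1 \<or> e = -1" "\<alpha> = two_term n 1 i e j"
  using assms unfolding middle_roots_eq mem_Collect_eq insert_iff empty_iff by metis

lemma finite_middle_roots: "finite (middle_roots n)"
proof (rule finite_subset)
  show "middle_roots n \<subseteq> (\<lambda>(i, e, j). two_term n 1 i e j) ` ({..<n} \<times> {1, -1} \<times> {..<n})"
  proof
    fix \<alpha> assume "\<alpha> \<in> middle_roots n"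
    then obtain i e j where "i < j" "j < n" "e = 1 \<or> e = -1" "\<alpha> = two_term n 1 i e j"
      by (rule middle_rootsE)
    then show "\<alpha> \<in> (\<lambda>(i, e, j). two_term n 1 i e j) ` ({..<n} \<times> {1, -1} \<times> {..<n})"
      by (intro image_eqI[of _ _ "(i, e, j)"]) simp_all
  qed
qed auto

lemma finite_BC_pos [simp]: "finite (BC_pos n)"
  by (simp add: BC_pos_def short_roots_eq long_roots_eq finite_middle_roots)

lemma BC_pos_cases [consumes 1, case_names short long middle]:
  assumes "\<alpha> \<in> BC_pos n"
  obtains i where "i < n" "\<alpha> = two_term n 1 i 0 i"
    | i where "i < n" "\<alpha> = two_term n 2 i 0 i"
    | i e j where "i < j" "j < n" "e = 1 \<or> e = -1" "\<alpha> = two_term n 1 i e j"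
proof -
  consider "\<alpha> \<in> short_roots n" | "\<alpha> \<in> long_roots n" | "\<alpha> \<in> middle_roots n"
    using assms by (auto simp: BC_pos_def)
  then show thesis
  proof cases
    case 1
    then show ?thesis using that(1) by (auto simp: short_roots_eq)
  next
    case 2
    then show ?thesis using that(2) by (auto simp: long_roots_eq)
  next
    case 3
    then obtain i e j where "i < j" "j < n" "e = 1 \<or> e = -1" "\<alpha> = two_term n 1 i e j"
      by (rule middle_rootsE)
    then show ?thesis using that(3)[of i j e] by simp
  qed
qed

lemma BC_pos_short: "i < n \<Longrightarrow> two_term n 1 i 0 i \<in> BC_pos n"
  and BC_pos_long: "i < n \<Longrightarrow> two_term n 2 i 0 i \<in> BC_pos n"
  and BC_pos_middle: "\<lbrakk>i < j; j < n; e = 1 \<or> e = -1\<rbrakk> \<Longrightarrow> two_term n 1 i e j \<in> BC_pos n"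
  unfolding BC_pos_def short_roots_eq long_roots_eq middle_roots_eq by blast+

lemma length_BC_pos: "\<alpha> \<in> BC_pos n \<Longrightarrow> length \<alpha> = n"
  by (erule BC_pos_cases) auto

lemma dot_root_self:
  "i < n \<Longrightarrow> dot (two_term n 1 i 0 i) (two_term n 1 i 0 i) = 1"
  "i < n \<Longrightarrow> dot (two_term n 2 i 0 i) (two_term n 2 i 0 i) = 4"
  "\<lbrakk>i < j; j < n; e = 1 \<or> e = -1\<rbrakk> \<Longrightarrow> dot (two_term n 1 i e j) (two_term n 1 i e j) = 2"
  by (simp add: dot_two_term_int nth_two_term, simp add: dot_two_term_int nth_two_term,
      elim disjE, simp_all add: dot_two_term_int nth_two_term)

text \<open>
  The three kinds of roots have squared lengths \<open>1\<close>, \<open>4\<close>, \<open>2\<close>, so the multiplicity is invariant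
  under isometries.
\<close>

lemma BC_mult_eq:
  assumes "\<alpha> \<in> BC_pos n"
  shows "BC_mult (k1, k2, k3) \<alpha> = (if dot \<alpha> \<alpha> = 1 then k1 else if dot \<alpha> \<alpha> = 4 then k2 else k3)"
proof -
  have l: "length \<alpha> = n" using assms by (rule length_BC_pos)
  have s: "dot \<beta> \<beta> = 1" if "\<beta> \<in> short_roots n" for \<beta>
    using that by (auto simp: short_roots_eq dot_root_self)
  have s2: "dot \<beta> \<beta> = 4" if "\<beta> \<in> long_roots n" for \<beta>
    using that by (auto simp: long_roots_eq dot_root_self)
  have s3: "dot \<beta> \<beta> = 2" if m: "\<beta> \<in> middle_roots n" for \<beta>
  proof -
    obtain i e j where "i < j" "j < n" "e = 1 \<or> e = -1" and \<beta>: "\<beta> = two_term n 1 i e j"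
      using m by (rule middle_rootsE)
    from dot_root_self(3)[OF this(1-3)] show ?thesis by (simp only: \<beta>)
  qed
  consider (short) "\<alpha> \<in> short_roots n" | (long) "\<alpha> \<in> long_roots n" | (middle) "\<alpha> \<in> middle_roots n"
    using assms by (auto simp: BC_pos_def)
  then show ?thesis
  proof cases
    case short
    with s[OF short] show ?thesis by (simp add: BC_mult_def l)
  next
    case long
    moreover have "\<alpha> \<notin> short_roots n" using s[of \<alpha>] s2[OF long] by auto
    ultimately show ?thesis using s2[OF long] by (simp add: BC_mult_def l)
  next
    case middle
    moreover have "\<alpha> \<notin> short_roots n" "\<alpha> \<notin> long_roots n"
      using s[of \<alpha>] s2[of \<alpha>] s3[OF middle] by auto
    ultimately show ?thesis using s3[OF middle] by (simp add: BC_mult_def l)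
  qed
qed

lemma BC_mult_nonneg: "0 \<le> k1 \<Longrightarrow> 0 \<le> k2 \<Longrightarrow> 0 \<le> k3 \<Longrightarrow> 0 \<le> BC_mult (k1, k2, k3) \<alpha>"
  by (auto simp: BC_mult_def)

lemma root_leading_pos:
  assumes "\<alpha> \<in> BC_pos n"
  shows "\<exists>i<n. 0 < \<alpha> ! i \<and> (\<forall>k<i. \<alpha> ! k = 0)"
  using assms
proof (cases rule: BC_pos_cases)
  case (middle i e j)
  then show ?thesis by (intro exI[of _ i]) (simp add: nth_two_term)
qed (auto simp: nth_two_term)

lemma uminus_notin_BC_pos:
  assumes "\<alpha> \<in> BC_pos n"
  shows "map uminus \<alpha> \<notin> BC_pos n"
proof
  assume u: "map uminus \<alpha> \<in> BC_pos n"
  have l: "length \<alpha> = n" using assms by (rule length_BC_pos)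
  obtain i j where ij: "i < n" "0 < \<alpha> ! i" "\<forall>k<i. \<alpha> ! k = 0"
     "j < n" "0 < map uminus \<alpha> ! j" "\<forall>k<j. map uminus \<alpha> ! k = 0"
    using root_leading_pos[OF assms] root_leading_pos[OF u] by blast
  then show False using l by (cases i j rule: linorder_cases) auto
qed

lemma lin_refl_root:
  assumes "\<alpha> \<in> BC_pos n"
  shows "lin_refl p \<alpha> \<in> BC_pos n \<or> map uminus (lin_refl p \<alpha>) \<in> BC_pos n"
  using assms
proof (cases rule: BC_pos_cases)
  case (short i)
  have "refl_sign n p i = 1 \<or> refl_sign n p i = -1" by (simp add: refl_sign_def)
  then show ?thesis
    using BC_pos_short[OF refl_idx_less[OF short(1)], of p] short
    by (elim disjE) (simp_all add: lin_refl_two_term uminus_two_term)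
next
  case (long i)
  have "refl_sign n p i = 1 \<or> refl_sign n p i = -1" by (simp add: refl_sign_def)
  then show ?thesis
    using BC_pos_long[OF refl_idx_less[OF long(1)], of p] long
    by (elim disjE) (simp_all add: lin_refl_two_term uminus_two_term)
next
  case (middle i e j)
  let ?i = "refl_idx n p i" and ?j = "refl_idx n p j"
  have neq: "?i \<noteq> ?j"
    using middle(1) by (metis less_irrefl refl_idx_idem)
  have l: "?i < n" "?j < n" "i < n" "j < n" using middle by (auto intro: refl_idx_less)
  have e: "refl_sign n p i = 1 \<or> refl_sign n p i = -1" "refl_sign n p j = 1 \<or> refl_sign n p j = -1"
    by (simp_all add: refl_sign_def)
  show ?thesis
  proof (cases "?i < ?j")
    case True
    note BC_pos_middle[OF True l(2)]
    with middle(3,4) e l show ?thesis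
      by (elim disjE) (simp_all add: lin_refl_two_term uminus_two_term)
  next
    case False
    with neq have "?j < ?i" by linarith
    note BC_pos_middle[OF this l(1)]
    moreover have "lin_refl p \<alpha> = two_term n (refl_sign n p j * e) ?j (refl_sign n p i) ?i"
      using middle(4) l by (simp add: lin_refl_two_term) (rule two_term_commute)
    ultimately show ?thesis using middle(3) e
      by (elim disjE) (simp_all add: uminus_two_term)
  qed
qed

text \<open>
  A simple reflection permutes the roots up to sign; choosing the positive one of \<open>\<plusminus>s\<^sub>i \<alpha>\<close> gives an
  involution of the positive roots along which sums over them can be reindexed.
\<close>

definition pos_refl :: "nat \<Rightarrow> int list \<Rightarrow> int list" where
  "pos_refl i \<alpha> =
     (if lin_refl i \<alpha> \<in> BC_pos (length \<alpha>) then lin_refl i \<alpha> else map uminus (lin_refl i \<alpha>))"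

lemma map_uminus_uminus [simp]: "map uminus (map uminus \<alpha>) = (\<alpha> :: 'a::group_add list)"
  by (simp add: map_idI)

lemma pos_refl_in: "\<alpha> \<in> BC_pos n \<Longrightarrow> pos_refl i \<alpha> \<in> BC_pos n"
  using lin_refl_root[of \<alpha> n i] length_BC_pos[of \<alpha> n] by (auto simp: pos_refl_def)

lemma pos_refl_idem: "\<alpha> \<in> BC_pos n \<Longrightarrow> pos_refl i (pos_refl i \<alpha>) = \<alpha>"
  using length_BC_pos[of \<alpha> n] uminus_notin_BC_pos[of \<alpha> n]
  by (auto simp: pos_refl_def lin_refl_uminus)

lemma bij_betw_pos_refl: "bij_betw (pos_refl i) (BC_pos n) (BC_pos n)"
  by (rule bij_betw_byWitness[where f' = "pos_refl i"]) (auto simp: pos_refl_in pos_refl_idem)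

lemma dot_uminus: "dot (map uminus x) y = - dot x y"
  by (auto simp: dot_def sum_negf[symmetric])

lemma dot_uminus_right: "length x = length y \<Longrightarrow> dot x (map uminus y) = - dot x y"
  by (auto simp: dot_def sum_negf[symmetric])

lemma BC_mult_pos_refl:
  assumes "\<alpha> \<in> BC_pos n"
  shows "BC_mult \<kappa> (pos_refl i \<alpha>) = BC_mult \<kappa> \<alpha>"
proof -
  have "dot (pos_refl i \<alpha>) (pos_refl i \<alpha>) = dot \<alpha> \<alpha>"
    by (simp add: pos_refl_def dot_uminus dot_uminus_right dot_lin_refl_lin_refl)
  then show ?thesis
    using BC_mult_eq[OF assms] BC_mult_eq[OF pos_refl_in[OF assms]] by (cases \<kappa>) auto
qed

text \<open>
  A simple reflection makes only the multiples of its own simple root negative, but the linear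
  part of \<open>s\<^sub>0\<close> does so with every positive root that involves the first coordinate.
\<close>

lemma flipped_swap:
  assumes "0 < p" "p < n" 
  shows "{\<alpha> \<in> BC_pos n. lin_refl p \<alpha> \<notin> BC_pos n} = {two_term n 1 (p - 1) (-1) p}"
proof -
  have sgn: "refl_sign n p k = 1" for k using assms by (auto simp: refl_sign_def)
  have sub: "\<alpha> = two_term n 1 (p - 1) (-1) p" if "\<alpha> \<in> BC_pos n" "lin_refl p \<alpha> \<notin> BC_pos n" for \<alpha>
    using that(1)
  proof (cases rule: BC_pos_cases)
    case (short i)
    then show ?thesis using that by (auto simp: lin_refl_two_term sgn refl_idx_less BC_pos_short)
  next
    case (long i)
    then show ?thesis using that by (auto simp: lin_refl_two_term sgn refl_idx_less BC_pos_long)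
  next
    case (middle i e j)
    let ?i = "refl_idx n p i" and ?j = "refl_idx n p j"
    have l: "?i < n" "?j < n" using middle by (auto simp: refl_idx_less)
    have "\<not> ?i < ?j" 
      using that middle l by (auto simp: lin_refl_two_term sgn intro: BC_pos_middle)
    then have ij: "i = p - 1" "j = p" using middle assms
      by (auto simp: refl_idx_def split: if_splits)
    then have r: "?i = p" "?j = p - 1" using assms by (auto simp: refl_idx_def)
    have "e \<noteq> 1"
    proof
      assume "e = 1"
      then have "lin_refl p \<alpha> = two_term n 1 (p - 1) 1 p"
        using middle r ij by (simp add: lin_refl_two_term sgn two_term_commute)
      then show False using that assms by (auto intro: BC_pos_middle)
    qed
    then show ?thesis using middle ij by auto
  qed
  have mem: "two_term n 1 (p - 1) (-1) p \<in> BC_pos n"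
    using assms by (intro BC_pos_middle) auto
  have neg: "lin_refl p (two_term n 1 (p - 1) (-1) p) = map uminus (two_term n 1 (p - 1) (-1) p)"
  proof -
    have "refl_idx n p (p - 1) = p" "refl_idx n p p = p - 1" using assms by (auto simp: refl_idx_def)
    then show ?thesis using assms
      by (simp add: lin_refl_two_term sgn uminus_two_term) (simp add: two_term_commute)
  qed
  show ?thesis
    using sub mem uminus_notin_BC_pos[OF mem, folded neg] by blast
qed

lemma flipped_sign:
  assumes "0 < n" 
  shows "{\<alpha> \<in> BC_pos n. lin_refl n \<alpha> \<notin> BC_pos n} = {two_term n 1 (n - 1) 0 (n - 1), two_term n 2 (n - 1) 0 (n - 1)}"
proof -
  have idx: "refl_idx n n k = k" for k by (auto simp: refl_idx_def)
  have sgn: "refl_sign n n k = (if k = n - 1 then -1 else 1)" for k using assms by (auto simp: refl_sign_def)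
  have sub: "\<alpha> = two_term n 1 (n - 1) 0 (n - 1) \<or> \<alpha> = two_term n 2 (n - 1) 0 (n - 1)" 
    if "\<alpha> \<in> BC_pos n" "lin_refl n \<alpha> \<notin> BC_pos n" for \<alpha>
    using that(1)
  proof (cases rule: BC_pos_cases)
    case (short i)
    then show ?thesis using that by (auto simp: lin_refl_two_term sgn idx BC_pos_short split: if_splits)
  next
    case (long i)
    then show ?thesis using that by (auto simp: lin_refl_two_term sgn idx BC_pos_long split: if_splits)
  next
    case (middle i e j)
    have "lin_refl n \<alpha> \<in> BC_pos n"
      using middle by (auto simp: lin_refl_two_term sgn idx intro!: BC_pos_middle)
    then show ?thesis using that by simp
  qed
  have mem: "two_term n 1 (n - 1) 0 (n - 1) \<in> BC_pos n" "two_term n 2 (n - 1) 0 (n - 1) \<in> BC_pos n"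
    using assms by (auto intro: BC_pos_short BC_pos_long)
  have neg: "lin_refl n (two_term n a (n - 1) 0 (n - 1)) = map uminus (two_term n a (n - 1) 0 (n - 1))" for a
    using assms by (simp add: lin_refl_two_term sgn idx uminus_two_term)
  show ?thesis
    using sub mem mem[THEN uminus_notin_BC_pos, folded neg] by blast
qed

lemma root_first_nonneg:
  assumes "\<alpha> \<in> BC_pos n"
  shows "0 \<le> \<alpha> ! 0"
  using assms by (cases rule: BC_pos_cases) (auto simp: nth_two_term)

lemma flipped_0:
  assumes "\<alpha> \<in> BC_pos n"
  shows "lin_refl 0 \<alpha> \<in> BC_pos n \<longleftrightarrow> \<alpha> ! 0 = 0"
proof -
  obtain a as where \<alpha>: "\<alpha> = a # as"
    using root_leading_pos[OF assms] length_BC_pos[OF assms] by (cases \<alpha>) auto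
  have "lin_refl 0 \<alpha> = \<alpha>" if "\<alpha> ! 0 = 0" using that by (simp add: \<alpha> lin_refl_0_Cons)
  moreover have "\<alpha> ! 0 = 0" if "lin_refl 0 \<alpha> \<in> BC_pos n"
    using root_first_nonneg[OF that] root_first_nonneg[OF assms] by (simp add: \<alpha> lin_refl_0_Cons)
  ultimately show ?thesis using assms by auto
qed

section \<open>Cherednik operators and simple reflections\<close>

text \<open>
  The summand of the Cherednik operator at \<open>\<alpha>\<close> with its share of \<open>\<rho>\<close> included. In this form
  replacing \<open>\<alpha>\<close> by \<open>-\<alpha>\<close> changes it, up to sign, by a mere reflection.
\<close>

definition root_term :: "int list \<Rightarrow> (complex list \<Rightarrow> complex) \<Rightarrow> complex list \<Rightarrow> complex" where
  "root_term \<alpha> f z = (f z - f (root_refl \<alpha> z)) / (1 - expo (map uminus \<alpha>) z) - f z / 2"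

definition line_point :: "complex list \<Rightarrow> real list \<Rightarrow> complex \<Rightarrow> complex list" where
  "line_point z \<xi> t = map2 (\<lambda>w a. w + t * complex_of_real a) z \<xi>"

lemma dot_rho:
  assumes "length \<xi> = n"
  shows "dot (BC_rho n \<kappa>) \<xi> = (\<Sum>\<alpha>\<in>BC_pos n. BC_mult \<kappa> \<alpha> * dot (map of_int \<alpha>) \<xi>) / 2"
proof -
  have "dot (BC_rho n \<kappa>) \<xi>
      = (\<Sum>j<n. \<Sum>\<alpha>\<in>BC_pos n. BC_mult \<kappa> \<alpha> * of_int (\<alpha> ! j) * \<xi> ! j / 2)"
    by (simp add: dot_def BC_rho_def sum_divide_distrib sum_distrib_right)
  also have "\<dots> = (\<Sum>\<alpha>\<in>BC_pos n. \<Sum>j<n. BC_mult \<kappa> \<alpha> * of_int (\<alpha> ! j) * \<xi> ! j / 2)"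
    by (rule sum.swap)
  also have "\<dots> = (\<Sum>\<alpha>\<in>BC_pos n. BC_mult \<kappa> \<alpha> * dot (map of_int \<alpha>) \<xi> / 2)"
    by (intro sum.cong refl)
       (simp add: dot_def length_BC_pos sum_distrib_left sum_divide_distrib mult.assoc)
  finally show ?thesis by (simp add: sum_divide_distrib)
qed

lemma cherednik_eq:
  assumes "length \<xi> = n"
  shows "cherednik \<kappa> \<xi> f z = deriv (\<lambda>t. f (line_point z \<xi> t)) 0
    + (\<Sum>\<alpha>\<in>BC_pos n. of_real (BC_mult \<kappa> \<alpha> * dot (map of_int \<alpha>) \<xi>) * root_term \<alpha> f z)"
  unfolding cherednik_def assms dot_rho[OF assms] root_term_def line_point_def
  by (simp add: algebra_simps sum_subtractf sum_distrib_left sum_divide_distrib sum_distrib_right)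

lemma expo_uminus: "expo (map uminus \<alpha>) z = inverse (expo \<alpha> z)"
proof -
  have "(map of_int (map uminus \<alpha>) :: complex list) = map uminus (map of_int \<alpha>)" by simp
  then show ?thesis by (simp only: expo_def dot_uminus exp_minus)
qed

lemma expo_neq_0 [simp]: "expo \<alpha> z \<noteq> 0"
  by (simp add: expo_def)

lemma expo_lin_refl: "length \<alpha> = length z \<Longrightarrow> expo (lin_refl i \<alpha>) z = expo \<alpha> (lin_refl i z)"
  by (simp add: expo_def lin_refl_of_int dot_lin_refl)

lemma length_root_refl [simp]: "length \<alpha> = length z \<Longrightarrow> length (root_refl \<alpha> z) = length z"
  by (simp add: root_refl_def)

lemma nth_root_refl:
  "length \<alpha> = length z \<Longrightarrow> j < length z \<Longrightarrow> root_refl \<alpha> z ! j =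
     z ! j - 2 * dot (map of_int \<alpha>) z / of_int (dot \<alpha> \<alpha>) * of_int (\<alpha> ! j)"
  by (simp add: root_refl_def)

lemma root_refl_lin_refl:
  assumes "length \<alpha> = length z"
  shows "root_refl (lin_refl i \<alpha>) (lin_refl i z) = lin_refl i (root_refl \<alpha> z)"
  using assms
  by (intro nth_equalityI)
     (simp_all add: nth_root_refl nth_lin_refl refl_idx_less lin_refl_of_int dot_lin_refl_lin_refl
        algebra_simps)

lemma root_refl_uminus: "length \<alpha> = length z \<Longrightarrow> root_refl (map uminus \<alpha>) z = root_refl \<alpha> z"
proof (rule nth_equalityI)
  have *: "(map of_int (map uminus \<alpha>) :: complex list) = map uminus (map of_int \<alpha>)" by simp
  fix j assume "length \<alpha> = length z" "j < length (root_refl (map uminus \<alpha>) z)"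
  then show "root_refl (map uminus \<alpha>) z ! j = root_refl \<alpha> z ! j"
    by (simp add: nth_root_refl * dot_uminus dot_uminus_right del: map_map)
qed simp

text \<open>
  This is \<open>1 / (1 - e) + 1 / (1 - 1/e) = 1\<close>.
\<close>

lemma root_term_uminus:
  assumes "length \<alpha> = length z" "expo (map uminus \<alpha>) z \<noteq> 1"
  shows "root_term (map uminus \<alpha>) f z = - root_term \<alpha> f z - f (root_refl \<alpha> z)"
proof -
  let ?e = "expo \<alpha> z"
  have e: "?e \<noteq> 0" "?e \<noteq> 1" using assms(2) by (auto simp: expo_uminus)
  have "(a - b) / (1 - ?e) - a / 2 = - ((a - b) / (1 - inverse ?e) - a / 2) - b" for a b
    using e by (simp add: divide_simps) (simp add: algebra_simps)
  then show ?thesis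
    unfolding root_term_def by (simp add: root_refl_uminus assms(1) expo_uminus del: map_map)
qed

lemma root_term_lin_refl:
  assumes "length \<alpha> = length z"
  shows "root_term \<alpha> (\<lambda>w. f (lin_refl i w)) z = root_term (lin_refl i \<alpha>) f (lin_refl i z)"
proof -
  have "expo (map uminus (lin_refl i \<alpha>)) (lin_refl i z) = expo (map uminus \<alpha>) z"
    using assms by (simp add: lin_refl_uminus[symmetric] expo_lin_refl)
  then show ?thesis
    using assms by (simp add: root_term_def root_refl_lin_refl)
qed

lemma regular_points_expo:
  assumes "z \<in> regular_points n" "\<alpha> \<in> BC_pos n"
  shows "expo (map uminus \<alpha>) z \<noteq> 1" "expo \<alpha> z \<noteq> 1"
proof -
  show *: "expo (map uminus \<alpha>) z \<noteq> 1"
    using assms by (auto simp: regular_points_def)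
  then show "expo \<alpha> z \<noteq> 1" by (auto simp: expo_uminus)
qed

lemma regular_points_length: "z \<in> regular_points n \<Longrightarrow> length z = n"
  by (simp add: regular_points_def)

lemma lin_refl_regular:
  assumes "z \<in> regular_points n"
  shows "lin_refl i z \<in> regular_points n"
proof -
  have "expo (map uminus \<alpha>) (lin_refl i z) \<noteq> 1" if a: "\<alpha> \<in> BC_pos n" for \<alpha>
  proof -
    have l: "length \<alpha> = length z" using assms a by (simp add: regular_points_length length_BC_pos)
    have "expo (map uminus \<alpha>) (lin_refl i z) = expo (map uminus (lin_refl i \<alpha>)) z"
      using l by (simp add: expo_lin_refl[symmetric] lin_refl_uminus)
    moreover consider "lin_refl i \<alpha> \<in> BC_pos n" | "map uminus (lin_refl i \<alpha>) \<in> BC_pos n"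
      using lin_refl_root[OF a] by blast
    then have "expo (map uminus (lin_refl i \<alpha>)) z \<noteq> 1"
      by cases (auto dest: regular_points_expo[OF assms] simp del: map_map)
    ultimately show ?thesis by simp
  qed
  then show ?thesis using assms by (simp add: regular_points_def)
qed

text \<open>
  The terms of \<open>\<alpha>\<close> and \<open>s\<^sub>i \<alpha>\<close> correspond under \<open>s\<^sub>i\<close>, so the sum is equivariant except for the
  roots that become negative, each of which contributes one reflected value.
\<close>

lemma sum_root_terms_lin_refl:
  fixes \<kappa> :: "real \<times> real \<times> real" and f :: "complex list \<Rightarrow> complex"
  assumes z: "z \<in> regular_points n" and \<xi>: "length \<xi> = n"
  defines "c \<equiv> \<lambda>\<alpha> \<xi>. complex_of_real (BC_mult \<kappa> \<alpha> * dot (map of_int \<alpha>) \<xi>)"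
  shows "(\<Sum>\<alpha>\<in>BC_pos n. c \<alpha> \<xi> * root_term \<alpha> (\<lambda>w. f (lin_refl i w)) z)
    = (\<Sum>\<alpha>\<in>BC_pos n. c \<alpha> (lin_refl i \<xi>) * root_term \<alpha> f (lin_refl i z))
      + (\<Sum>\<alpha> | \<alpha> \<in> BC_pos n \<and> lin_refl i \<alpha> \<notin> BC_pos n.
           c \<alpha> (lin_refl i \<xi>) * f (root_refl \<alpha> (lin_refl i z)))"
proof -
  define g where "g \<beta> = c \<beta> (lin_refl i \<xi>) * (root_term \<beta> f (lin_refl i z)
      + (if lin_refl i \<beta> \<in> BC_pos n then 0 else f (root_refl \<beta> (lin_refl i z))))" for \<beta>
  have lz: "length z = n" using z by (rule regular_points_length)
  have "c \<alpha> \<xi> * root_term \<alpha> (\<lambda>w. f (lin_refl i w)) z = g (pos_refl i \<alpha>)"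
    if a: "\<alpha> \<in> BC_pos n" for \<alpha>
  proof -
    define \<beta> where "\<beta> = pos_refl i \<alpha>"
    have l: "length \<alpha> = n" using a by (rule length_BC_pos)
    have b: "\<beta> \<in> BC_pos n" using a unfolding \<beta>_def by (rule pos_refl_in)
    have lb: "length \<beta> = n" using b by (rule length_BC_pos)
    have m: "BC_mult \<kappa> \<beta> = BC_mult \<kappa> \<alpha>" unfolding \<beta>_def by (rule BC_mult_pos_refl[OF a])
    have d: "dot (map of_int \<alpha>) \<xi> = dot (map of_int (lin_refl i \<alpha>)) (lin_refl i \<xi>)"
      using l \<xi> by (simp add: lin_refl_of_int dot_lin_refl_lin_refl)
    have t: "root_term \<alpha> (\<lambda>w. f (lin_refl i w)) z = root_term (lin_refl i \<alpha>) f (lin_refl i z)"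
      using l lz by (simp add: root_term_lin_refl)
    show ?thesis
    proof (cases "lin_refl i \<alpha> \<in> BC_pos n")
      case True
      then have "\<beta> = lin_refl i \<alpha>" using l by (simp add: \<beta>_def pos_refl_def)
      then show ?thesis using a d m t by (simp add: g_def c_def flip: \<beta>_def)
    next
      case False
      then have "\<beta> = map uminus (lin_refl i \<alpha>)" using l by (simp add: \<beta>_def pos_refl_def)
      then have e: "lin_refl i \<alpha> = map uminus \<beta>" by simp
      have "lin_refl i \<beta> = map uminus \<alpha>"
        using e by (metis lin_refl_lin_refl lin_refl_uminus map_uminus_uminus)
      then have nb: "lin_refl i \<beta> \<notin> BC_pos n" using uminus_notin_BC_pos[OF a] by simp
      have dm: "dot (map of_int \<alpha>) \<xi> = - dot (map of_int \<beta>) (lin_refl i \<xi>)"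
      proof -
        have "(map of_int (map uminus \<beta>) :: real list) = map uminus (map of_int \<beta>)" by simp
        then show ?thesis unfolding d e by (simp only: dot_uminus)
      qed
      have u: "root_term (map uminus \<beta>) f (lin_refl i z)
          = - root_term \<beta> f (lin_refl i z) - f (root_refl \<beta> (lin_refl i z))"
        using lb lz regular_points_expo(1)[OF lin_refl_regular[OF z] b]
        by (intro root_term_uminus) simp_all
      then show ?thesis
        unfolding t e u using nb m dm
        by (simp add: g_def c_def algebra_simps flip: \<beta>_def)
    qed
  qed
  then have "(\<Sum>\<alpha>\<in>BC_pos n. c \<alpha> \<xi> * root_term \<alpha> (\<lambda>w. f (lin_refl i w)) z)
      = (\<Sum>\<alpha>\<in>BC_pos n. g (pos_refl i \<alpha>))"
    by (intro sum.cong) auto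
  also have "\<dots> = (\<Sum>\<beta>\<in>BC_pos n. g \<beta>)"
    by (rule sum.reindex_bij_betw[OF bij_betw_pos_refl])
  also have "\<dots> = (\<Sum>\<alpha>\<in>BC_pos n. c \<alpha> (lin_refl i \<xi>) * root_term \<alpha> f (lin_refl i z))
      + (\<Sum>\<alpha>\<in>BC_pos n. if lin_refl i \<alpha> \<notin> BC_pos n
           then c \<alpha> (lin_refl i \<xi>) * f (root_refl \<alpha> (lin_refl i z)) else 0)"
    unfolding sum.distrib[symmetric] by (intro sum.cong) (auto simp: g_def algebra_simps)
  finally show ?thesis by (simp add: sum.If_cases Int_def)
qed

lemma lin_refl_line_point:
  assumes "length z = length \<xi>"
  shows "lin_refl i (line_point z \<xi> t) = line_point (lin_refl i z) (lin_refl i \<xi>) t"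
  using assms
  by (intro nth_equalityI)
     (simp_all add: line_point_def nth_lin_refl refl_idx_less algebra_simps)

lemma cherednik_lin_refl:
  assumes z: "z \<in> regular_points n" and \<xi>: "length \<xi> = n"
  shows "cherednik \<kappa> \<xi> (\<lambda>w. f (lin_refl i w)) z = cherednik \<kappa> (lin_refl i \<xi>) f (lin_refl i z)
    + (\<Sum>\<alpha> | \<alpha> \<in> BC_pos n \<and> lin_refl i \<alpha> \<notin> BC_pos n.
         of_real (BC_mult \<kappa> \<alpha> * dot (map of_int \<alpha>) (lin_refl i \<xi>))
           * f (root_refl \<alpha> (lin_refl i z)))"
proof -
  have "length (lin_refl i \<xi>) = n" "length z = length \<xi>"
    using \<xi> regular_points_length[OF z] by simp_all
  then show ?thesis
    by (simp only: cherednik_eq[OF \<xi>] cherednik_eq[of "lin_refl i \<xi>" n]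
        lin_refl_line_point sum_root_terms_lin_refl[OF z \<xi>] add.assoc)
qed

lemma root_refl_simple_swap:
  assumes "0 < p" "p < n" "length z = n"
  shows "root_refl (two_term n 1 (p - 1) (-1) p) z = lin_refl p z"
proof (rule nth_equalityI)
  fix j assume "j < length (root_refl (two_term n 1 (p - 1) (-1) p) z)"
  then have "j < n" using assms by simp
  moreover have "dot (two_term n 1 (p - 1) (-1) p) (two_term n 1 (p - 1) (-1) p) = 2"
    using assms by (intro dot_root_self) auto
  ultimately show "root_refl (two_term n 1 (p - 1) (-1) p) z ! j = lin_refl p z ! j"
    using assms
    by (auto simp: nth_root_refl nth_two_term dot_two_term nth_lin_refl refl_sign_def refl_idx_def
        field_simps)
qed (use assms in simp)

lemma root_refl_coordinate:
  assumes "i < n" "length z = n" "a \<noteq> 0"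
  shows "root_refl (two_term n a i 0 i) z = z[i := - z ! i]"
proof (rule nth_equalityI)
  fix j assume "j < length (root_refl (two_term n a i 0 i) z)"
  then have "j < n" using assms by simp
  moreover have "dot (two_term n a i 0 i) (two_term n a i 0 i) = a * a"
    using assms by (simp add: dot_two_term_int nth_two_term)
  ultimately show "root_refl (two_term n a i 0 i) z ! j = z[i := - z ! i] ! j"
    using assms
    by (auto simp: nth_root_refl nth_two_term dot_two_term nth_list_update)
qed (use assms in simp)

lemma lin_refl_last: "0 < length x \<Longrightarrow> lin_refl (length x) x = x[length x - 1 := - x ! (length x - 1)]"
  by (rule nth_equalityI) (auto simp: nth_lin_refl refl_sign_def refl_idx_def nth_list_update)

lemma lin_refl_first: "lin_refl 0 x = x[0 := - x ! 0]"
  by (rule nth_equalityI) (auto simp: nth_lin_refl refl_sign_def refl_idx_def nth_list_update)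

lemma nth_lin_refl_swap:
  "0 < p \<Longrightarrow> p < length x \<Longrightarrow> lin_refl p x ! (p - Suc 0) = x ! p"
  "0 < p \<Longrightarrow> p < length x \<Longrightarrow> lin_refl p x ! p = x ! (p - Suc 0)"
  by (auto simp: nth_lin_refl refl_sign_def refl_idx_def)

lemma BC_mult_two_term:
  "i < n \<Longrightarrow> BC_mult (k1, k2, k3) (two_term n 1 i 0 i) = k1"
  "i < n \<Longrightarrow> BC_mult (k1, k2, k3) (two_term n 2 i 0 i) = k2"
  "\<lbrakk>i < j; j < n; e = 1 \<or> e = -1\<rbrakk> \<Longrightarrow> BC_mult (k1, k2, k3) (two_term n 1 i e j) = k3"
  using BC_mult_eq[OF BC_pos_short[of i n]] BC_mult_eq[OF BC_pos_long[of i n]]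
    BC_mult_eq[OF BC_pos_middle[of i j n e]] dot_root_self(1,2)[of i n] dot_root_self(3)[of i j n e]
  by simp_all

text \<open>
  For \<open>s\<^sub>i\<close> with \<open>0 < i < n\<close> only the simple root becomes negative, and its reflection undoes \<open>s\<^sub>i\<close>.
\<close>

lemma cherednik_swap:
  assumes z: "z \<in> regular_points n" and \<xi>: "length \<xi> = n" and p: "0 < p" "p < n"
  shows "cherednik (k1, k2, k3) \<xi> (\<lambda>w. f (lin_refl p w)) z
     = cherednik (k1, k2, k3) (lin_refl p \<xi>) f (lin_refl p z)
       - of_real (k3 * (\<xi> ! (p - 1) - \<xi> ! p)) * f z"
proof -
  have lz: "length z = n" using z by (rule regular_points_length)
  let ?\<alpha> = "two_term n 1 (p - 1) (-1) p"
  have m: "BC_mult (k1, k2, k3) ?\<alpha> = k3" using p by (intro BC_mult_two_term) auto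
  have d: "dot (map of_int ?\<alpha>) (lin_refl p \<xi>) = \<xi> ! p - \<xi> ! (p - 1)"
    using p \<xi> by (simp add: dot_two_term nth_lin_refl_swap)
  have r: "root_refl ?\<alpha> (lin_refl p z) = z"
    using root_refl_simple_swap[OF p, of "lin_refl p z"] lz by simp
  show ?thesis
    unfolding cherednik_lin_refl[OF z \<xi>] flipped_swap[OF p]
    by (subst sum.insert, simp, simp, subst m, subst d, subst r) (simp add: algebra_simps)
qed

lemma cherednik_sign:
  assumes z: "z \<in> regular_points n" and \<xi>: "length \<xi> = n" and n: "0 < n"
  shows "cherednik (k1, k2, k3) \<xi> (\<lambda>w. f (lin_refl n w)) z
     = cherednik (k1, k2, k3) (lin_refl n \<xi>) f (lin_refl n z)
       - of_real ((k1 + 2 * k2) * \<xi> ! (n - 1)) * f z"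
proof -
  have lz: "length z = n" using z by (rule regular_points_length)
  have l: "lin_refl n x ! (n - 1) = - x ! (n - 1)" if "length x = n" for x :: "real list"
    using n that lin_refl_last[of x] by auto
  have r: "root_refl (two_term n a (n - 1) 0 (n - 1)) (lin_refl n z) = z" if "a \<noteq> 0" for a
  proof -
    have "root_refl (two_term n a (n - 1) 0 (n - 1)) (lin_refl n z) = lin_refl n (lin_refl n z)"
      using n lz that root_refl_coordinate[of "n - 1" n "lin_refl n z" a] lin_refl_last[of "lin_refl n z"]
      by simp
    then show ?thesis by simp
  qed
  have ne: "two_term n 1 (n - 1) 0 (n - 1) \<noteq> two_term n 2 (n - 1) 0 (n - 1)"
    using dot_root_self(1,2)[of "n - 1" n] n by auto
  show ?thesis
    unfolding cherednik_lin_refl[OF z \<xi>] flipped_sign[OF n] using n ne \<xi>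
    by (simp add: r[simplified] BC_mult_two_term dot_two_term l[simplified] algebra_simps)
qed

text \<open>
  Conjugating by \<open>exp z\<^sub>1\<close> multiplies the reflected value at \<open>\<alpha>\<close> by \<open>exp ((s\<^sub>\<alpha> z)\<^sub>1 - z\<^sub>1)\<close>. This
  exponent is \<open>0\<close> if \<open>\<alpha>\<^sub>1 = 0\<close>, it is \<open>-\<langle>\<alpha>, z\<rangle>\<close> for \<open>2 e\<^sub>1\<close> and \<open>e\<^sub>1 \<plusminus> e\<^sub>j\<close>, and \<open>-2 \<langle>\<alpha>, z\<rangle>\<close> for
  \<open>e\<^sub>1\<close>, so the denominator always divides the numerator.
\<close>

lemma affine_quotient:
  assumes z: "z \<in> regular_points n" and a: "\<alpha> \<in> BC_pos n"
  shows "(1 - exp (root_refl \<alpha> z ! 0 - z ! 0)) / (1 - expo (map uminus \<alpha>) z)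
     = (if \<alpha> ! 0 = 0 then 0 else 1) + (if \<alpha> = two_term n 1 0 0 0 then exp (- z ! 0) else 0)"
proof -
  have l: "length \<alpha> = n" "length z = n" using z a by (simp_all add: regular_points_length length_BC_pos)
  have n: "0 < n" using root_leading_pos[OF a] by auto
  define e where "e = expo (map uminus \<alpha>) z"
  have e1: "e \<noteq> 1" using regular_points_expo[OF z a] by (simp add: e_def)
  have e: "e = exp (- dot (map of_int \<alpha>) z)"
    by (simp only: e_def expo_uminus exp_minus) (simp only: expo_def)
  have r: "root_refl \<alpha> z ! 0 - z ! 0
      = - 2 * dot (map of_int \<alpha>) z / of_int (dot \<alpha> \<alpha>) * of_int (\<alpha> ! 0)"
    using l n by (simp add: nth_root_refl)
  have dne: "dot \<alpha> \<alpha> \<noteq> 1 \<Longrightarrow> \<alpha> \<noteq> two_term n 1 0 0 0" using dot_root_self(1)[OF n] by auto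
  have z0: ?thesis if "\<alpha> ! 0 = 0"
  proof -
    have "\<alpha> \<noteq> two_term n 1 0 0 0" using that n by (auto simp: nth_two_term)
    with that show ?thesis by (simp add: r)
  qed
  have one: ?thesis if "\<alpha> ! 0 \<noteq> 0" "dot \<alpha> \<alpha> = 2 * \<alpha> ! 0"
  proof -
    have "dot \<alpha> \<alpha> \<noteq> 1" using that(2) by presburger
    moreover have "root_refl \<alpha> z ! 0 - z ! 0 = - dot (map of_int \<alpha>) z"
      unfolding r that(2) using that(1) by simp
    ultimately show ?thesis
      using that(1) e1 dne by (simp flip: e e_def)
  qed
  from a show ?thesis
  proof (cases rule: BC_pos_cases)
    case (short i)
    show ?thesis
    proof (cases "i = 0")
      case True
      have "\<alpha> ! 0 = 1" "dot \<alpha> \<alpha> = 1" "dot (map of_int \<alpha>) z = z ! 0"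
        using short True n by (auto simp: nth_two_term dot_root_self dot_two_term)
      then have "root_refl \<alpha> z ! 0 - z ! 0 = - z ! 0 + (- z ! 0)" "e = exp (- z ! 0)"
        unfolding r e by simp_all
      then have "exp (root_refl \<alpha> z ! 0 - z ! 0) = e * e" by (simp only: exp_add)
      moreover have "(1 - e * e) / (1 - e) = 1 + e"
        using e1 by (simp add: divide_simps) (simp add: algebra_simps)
      moreover have "\<alpha> = two_term n 1 0 0 0" using short True by simp
      ultimately show ?thesis
        using \<open>\<alpha> ! 0 = 1\<close> \<open>e = exp (- z ! 0)\<close> unfolding e_def[symmetric] by simp
    next
      case False
      then show ?thesis using short n by (intro z0) (simp add: nth_two_term)
    qed
  next
    case (long i)
    show ?thesis
    proof (cases "i = 0")
      case True
      then show ?thesis using long n by (intro one) (simp_all add: nth_two_term dot_root_self)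
    next
      case False
      then show ?thesis using long n by (intro z0) (simp add: nth_two_term)
    qed
  next
    case (middle i e' j)
    show ?thesis
    proof (cases "i = 0")
      case True
      with middle show ?thesis
        by (intro one) (simp_all add: nth_two_term dot_root_self)
    next
      case False
      then show ?thesis using middle n by (intro z0) (simp add: nth_two_term)
    qed
  qed
qed

text \<open>
  The reflected values created by the conjugation with \<open>exp z\<^sub>1\<close> cancel those created by the linear
  part of \<open>s\<^sub>0\<close>; only the second part of the quotient for the root \<open>e\<^sub>1\<close> survives.
\<close>

lemma cherednik_affine:
  assumes z: "z \<in> regular_points n" and \<xi>: "length \<xi> = n" and n: "0 < n"
    and diff: "(\<lambda>t. f (line_point (lin_refl 0 z) (lin_refl 0 \<xi>) t)) field_differentiable at 0"
  shows "cherednik (k1, k2, k3) \<xi> (\<lambda>w. exp (w ! 0) * f (lin_refl 0 w)) z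
     = of_real (\<xi> ! 0) * (exp (z ! 0) * f (lin_refl 0 z))
       + exp (z ! 0) * cherednik (k1, k2, k3) (lin_refl 0 \<xi>) f (lin_refl 0 z)
       + of_real (k1 * \<xi> ! 0) * f z"
proof -
  let ?\<theta> = "lin_refl 0" and ?\<kappa> = "(k1, k2, k3)" and ?h = "\<lambda>w. f (lin_refl 0 w)"
  let ?g = "\<lambda>w. exp (w ! 0) * f (lin_refl 0 w)"
  define c where "c \<alpha> x = complex_of_real (BC_mult ?\<kappa> \<alpha> * dot (map of_int \<alpha>) x)" for \<alpha> x
  have lz: "length z = n" using z by (rule regular_points_length)
  define F where "F t = f (line_point (?\<theta> z) (?\<theta> \<xi>) t)" for t
  have "(F has_field_derivative deriv F 0) (at 0)"
    using diff unfolding F_def by (rule field_differentiable_derivI)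
  then have "((\<lambda>t. exp (z ! 0 + t * of_real (\<xi> ! 0)) * F t) has_field_derivative
      of_real (\<xi> ! 0) * (exp (z ! 0) * F 0) + exp (z ! 0) * deriv F 0) (at 0)"
    by (auto intro!: derivative_eq_intros)
  moreover have "?g (line_point z \<xi> t) = exp (z ! 0 + t * of_real (\<xi> ! 0)) * F t" for t
    unfolding F_def using lz \<xi> n
    by (simp add: lin_refl_line_point flip: lin_refl_line_point) (simp add: line_point_def)
  ultimately have D: "deriv (\<lambda>t. ?g (line_point z \<xi> t)) 0
      = of_real (\<xi> ! 0) * (exp (z ! 0) * F 0) + exp (z ! 0) * deriv F 0"
    by (simp add: DERIV_imp_deriv)
  have F0: "F 0 = f (?\<theta> z)"
  proof -
    have "line_point (?\<theta> z) (?\<theta> \<xi>) 0 = ?\<theta> z"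
      using lz \<xi> by (intro nth_equalityI) (auto simp: line_point_def)
    then show ?thesis by (simp add: F_def)
  qed
  have rt: "root_term \<alpha> ?g z = exp (z ! 0) * (root_term \<alpha> ?h z
      + (if \<alpha> ! 0 = 0 then 0 else ?h (root_refl \<alpha> z))
      + (if \<alpha> = two_term n 1 0 0 0 then exp (- z ! 0) * ?h (root_refl \<alpha> z) else 0))"
    if a: "\<alpha> \<in> BC_pos n" for \<alpha>
  proof -
    let ?d = "1 - expo (map uminus \<alpha>) z" and ?r = "root_refl \<alpha> z"
    have d: "?d \<noteq> 0" using regular_points_expo[OF z a] by simp
    have ex: "exp (?r ! 0) = exp (z ! 0) * exp (?r ! 0 - z ! 0)"
      by (simp flip: exp_add)
    have "root_term \<alpha> ?g z
        = exp (z ! 0) * (root_term \<alpha> ?h z + (1 - exp (?r ! 0 - z ! 0)) / ?d * ?h ?r)"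
      unfolding root_term_def ex using d by (simp add: divide_simps) (simp add: algebra_simps)
    then show ?thesis
      unfolding affine_quotient[OF z a] by (auto simp: algebra_simps)
  qed
  have r0: "root_refl (two_term n 1 0 0 0) z = ?\<theta> z"
    using n lz by (simp add: root_refl_coordinate lin_refl_first)
  \<comment> \<open>These values cancel the reflected values in the equivariance of the sum, \<open>\<alpha>\<close> corresponding to \<open>-\<theta>\<alpha>\<close>.\<close>
  have mid: "(\<Sum>\<alpha>\<in>BC_pos n. c \<alpha> \<xi> * (if \<alpha> ! 0 = 0 then 0 else ?h (root_refl \<alpha> z)))
     = - (\<Sum>\<alpha> | \<alpha> \<in> BC_pos n \<and> ?\<theta> \<alpha> \<notin> BC_pos n. c \<alpha> (?\<theta> \<xi>) * f (root_refl \<alpha> (?\<theta> z)))"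
  proof -
    define G where "G \<beta> = (if ?\<theta> \<beta> \<notin> BC_pos n then - c \<beta> (?\<theta> \<xi>) * f (root_refl \<beta> (?\<theta> z)) else 0)" for \<beta>
    have "c \<alpha> \<xi> * (if \<alpha> ! 0 = 0 then 0 else ?h (root_refl \<alpha> z)) = G (pos_refl 0 \<alpha>)"
      if a: "\<alpha> \<in> BC_pos n" for \<alpha>
    proof (cases "\<alpha> ! 0 = 0")
      case True
      then have "?\<theta> \<alpha> \<in> BC_pos n" using flipped_0[OF a] by simp
      then show ?thesis using True a length_BC_pos[OF a] by (simp add: G_def pos_refl_def)
    next
      case False
      then have na: "?\<theta> \<alpha> \<notin> BC_pos n" using flipped_0[OF a] by simp
      define \<beta> where "\<beta> = pos_refl 0 \<alpha>"
      have l: "length \<alpha> = n" using a by (rule length_BC_pos)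
      have \<beta>: "\<beta> = map uminus (?\<theta> \<alpha>)" using l na by (simp add: \<beta>_def pos_refl_def)
      have "?\<theta> \<beta> \<notin> BC_pos n"
        using uminus_notin_BC_pos[OF a] by (simp add: \<beta> lin_refl_uminus)
      moreover have "root_refl \<beta> (?\<theta> z) = ?\<theta> (root_refl \<alpha> z)"
        using l lz by (simp add: \<beta> root_refl_uminus root_refl_lin_refl)
      moreover have "c \<beta> (?\<theta> \<xi>) = - c \<alpha> \<xi>"
      proof -
        have "(map of_int \<beta> :: real list) = map uminus (?\<theta> (map of_int \<alpha>))"
          by (simp add: \<beta> flip: lin_refl_of_int)
        then have "dot (map of_int \<beta>) (?\<theta> \<xi>) = - dot (map of_int \<alpha>) \<xi>"
          using l \<xi> by (simp add: dot_uminus dot_lin_refl_lin_refl)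
        then show ?thesis using BC_mult_pos_refl[OF a, of ?\<kappa> 0] by (simp add: c_def \<beta>_def)
      qed
      ultimately show ?thesis using False by (simp add: G_def flip: \<beta>_def)
    qed
    then have "(\<Sum>\<alpha>\<in>BC_pos n. c \<alpha> \<xi> * (if \<alpha> ! 0 = 0 then 0 else ?h (root_refl \<alpha> z)))
        = (\<Sum>\<alpha>\<in>BC_pos n. G (pos_refl 0 \<alpha>))"
      by (intro sum.cong) auto
    also have "\<dots> = (\<Sum>\<beta>\<in>BC_pos n. G \<beta>)"
      by (rule sum.reindex_bij_betw[OF bij_betw_pos_refl])
    finally show ?thesis by (simp add: G_def sum.If_cases Int_def sum_negf)
  qed
  have last: "(\<Sum>\<alpha>\<in>BC_pos n. c \<alpha> \<xi> * (if \<alpha> = two_term n 1 0 0 0 then exp (- z ! 0) * ?h (root_refl \<alpha> z) else 0))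
     = of_real (k1 * \<xi> ! 0) * (exp (- z ! 0) * f z)"
  proof -
    have "(\<Sum>\<alpha>\<in>BC_pos n. c \<alpha> \<xi> * (if \<alpha> = two_term n 1 0 0 0 then exp (- z ! 0) * ?h (root_refl \<alpha> z) else 0))
      = (\<Sum>\<alpha>\<in>BC_pos n. if \<alpha> = two_term n 1 0 0 0 then c (two_term n 1 0 0 0) \<xi> * (exp (- z ! 0) * f z) else 0)"
      by (intro sum.cong) (auto simp: r0)
    also have "\<dots> = c (two_term n 1 0 0 0) \<xi> * (exp (- z ! 0) * f z)"
      using BC_pos_short[OF n] by simp
    finally show ?thesis using n by (simp add: c_def BC_mult_two_term dot_two_term)
  qed
  have "(\<Sum>\<alpha>\<in>BC_pos n. c \<alpha> \<xi> * root_term \<alpha> ?g z)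
      = exp (z ! 0) * ((\<Sum>\<alpha>\<in>BC_pos n. c \<alpha> \<xi> * root_term \<alpha> ?h z)
      + (\<Sum>\<alpha>\<in>BC_pos n. c \<alpha> \<xi> * (if \<alpha> ! 0 = 0 then 0 else ?h (root_refl \<alpha> z)))
      + (\<Sum>\<alpha>\<in>BC_pos n. c \<alpha> \<xi> * (if \<alpha> = two_term n 1 0 0 0 then exp (- z ! 0) * ?h (root_refl \<alpha> z) else 0)))"
    unfolding sum.distrib[symmetric] sum_distrib_left
    by (intro sum.cong refl) (simp only: rt algebra_simps)
  also have "\<dots> = exp (z ! 0) * ((\<Sum>\<alpha>\<in>BC_pos n. c \<alpha> (?\<theta> \<xi>) * root_term \<alpha> f (?\<theta> z))
      + of_real (k1 * \<xi> ! 0) * (exp (- z ! 0) * f z))"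
    unfolding mid last using sum_root_terms_lin_refl[OF z \<xi>, of ?\<kappa> f 0]
    by (simp add: c_def)
  also have "\<dots> = exp (z ! 0) * (\<Sum>\<alpha>\<in>BC_pos n. c \<alpha> (?\<theta> \<xi>) * root_term \<alpha> f (?\<theta> z))
      + of_real (k1 * \<xi> ! 0) * f z"
    by (simp add: exp_minus field_simps)
  finally have S: "(\<Sum>\<alpha>\<in>BC_pos n. c \<alpha> \<xi> * root_term \<alpha> ?g z) = \<dots>" .
  have C: "cherednik ?\<kappa> (?\<theta> \<xi>) f (?\<theta> z)
      = deriv F 0 + (\<Sum>\<alpha>\<in>BC_pos n. c \<alpha> (?\<theta> \<xi>) * root_term \<alpha> f (?\<theta> z))"
    using \<xi> by (simp add: cherednik_eq[of _ n] c_def F_def[abs_def])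
  show ?thesis
    unfolding cherednik_eq[OF \<xi>, of ?\<kappa> ?g z] D C F0 using S
    by (simp add: c_def algebra_simps)
qed

section \<open>The affine Bruhat order and the triangularity order\<close>

definition add_root :: "int list \<Rightarrow> int \<Rightarrow> int list \<Rightarrow> int list" where
  "add_root \<mu> c \<alpha> = map2 (\<lambda>m a. m + c * a) \<mu> \<alpha>"

text \<open>
  The generating pairs of the affine Bruhat order on \<open>\<int>\<^sup>n\<close>, the orbit of \<open>0\<close> under the affine Weyl
  group: \<open>\<nu>\<close> arises from \<open>\<mu>\<close> by an affine reflection whose hyperplane separates \<open>\<nu>\<close> from the
  fundamental alcove \<open>1/2 > x\<^sub>1 > \<dots> > x\<^sub>n > 0\<close>, while \<open>\<mu>\<close> is on the same side as the alcove. If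
  \<open>\<nu> = \<mu> + c \<alpha>\<close>, then the hyperplane is \<open>2 \<langle>\<alpha>, x\<rangle> = \<langle>\<alpha>, \<mu> + \<nu>\<rangle>\<close>, and the condition amounts to the
  sign condition below. Every integer \<open>c\<close> occurs, because the group contains the reflections
  in all these hyperplanes.
\<close>

definition bruhat_step :: "int list \<Rightarrow> int list \<Rightarrow> bool" where
  "bruhat_step \<mu> \<nu> \<longleftrightarrow> (\<exists>\<alpha>\<in>BC_pos (length \<mu>). \<exists>c. \<nu> = add_root \<mu> c \<alpha> \<and>
     (0 < c \<and> 0 < dot \<alpha> \<mu> + dot \<alpha> \<nu> \<or> c < 0 \<and> dot \<alpha> \<mu> + dot \<alpha> \<nu> \<le> 0))"

text \<open>
  Here \<open>s\<^sub>i \<mu>\<close> lies above \<open>\<mu>\<close>, that is, \<open>\<mu>\<close> lies strictly on the alcove's side of the hyperplane of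
  \<open>s\<^sub>i\<close>.
\<close>

definition raises :: "nat \<Rightarrow> int list \<Rightarrow> bool" where
  "raises i \<mu> \<longleftrightarrow> (if i = 0 then \<mu> ! 0 \<le> 0
     else if i < length \<mu> then \<mu> ! i < \<mu> ! (i - 1) else 0 < \<mu> ! (i - 1))"

lemma length_add_root: "length \<alpha> = length \<mu> \<Longrightarrow> length (add_root \<mu> c \<alpha>) = length \<mu>"
  by (simp add: add_root_def)

lemma nth_add_root:
  "length \<alpha> = length \<mu> \<Longrightarrow> j < length \<mu> \<Longrightarrow> add_root \<mu> c \<alpha> ! j = \<mu> ! j + c * \<alpha> ! j"
  by (simp add: add_root_def)

lemma dot_commute: "length x = length y \<Longrightarrow> dot x y = dot y x"
  by (simp add: dot_def mult.commute)

lemma dot_add_root: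
  "length \<alpha> = length \<mu> \<Longrightarrow> length \<beta> = length \<mu> \<Longrightarrow>
     dot \<beta> (add_root \<mu> c \<alpha>) = dot \<beta> \<mu> + c * dot \<beta> \<alpha>"
  by (simp add: dot_def nth_add_root sum.distrib sum_distrib_left algebra_simps)

lemma bruhat_stepE:
  assumes "bruhat_step \<mu> \<nu>"
  obtains \<alpha> c where "\<alpha> \<in> BC_pos (length \<mu>)" "length \<alpha> = length \<mu>" "\<nu> = add_root \<mu> c \<alpha>"
    "0 < c \<and> 0 < 2 * dot \<alpha> \<mu> + c * dot \<alpha> \<alpha> \<or> c < 0 \<and> 2 * dot \<alpha> \<mu> + c * dot \<alpha> \<alpha> \<le> 0"
proof -
  obtain \<alpha> c where *: "\<alpha> \<in> BC_pos (length \<mu>)" "\<nu> = add_root \<mu> c \<alpha>"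
    "0 < c \<and> 0 < dot \<alpha> \<mu> + dot \<alpha> \<nu> \<or> c < 0 \<and> dot \<alpha> \<mu> + dot \<alpha> \<nu> \<le> 0"
    using assms unfolding bruhat_step_def by blast
  moreover have "dot \<alpha> \<nu> = dot \<alpha> \<mu> + c * dot \<alpha> \<alpha>"
    using * by (simp add: dot_add_root length_BC_pos)
  ultimately show thesis using that[of \<alpha> c] by (simp add: length_BC_pos)
qed

lemma length_bruhat_step: "bruhat_step \<mu> \<nu> \<Longrightarrow> length \<nu> = length \<mu>"
  by (erule bruhat_stepE) (simp add: length_add_root)

lemma dot_aff_refl:
  fixes \<mu> :: "'a::comm_ring_1 list"
  assumes "length \<beta> = length \<mu>" "i \<le> length \<mu>" "0 < length \<mu>"
  shows "dot \<beta> (aff_refl i \<mu>) = dot (lin_refl i \<beta>) \<mu> + (if i = 0 then \<beta> ! 0 else 0)"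
proof -
  have "dot \<beta> (aff_refl i \<mu>) = (\<Sum>j<length \<mu>. \<beta> ! j * lin_refl i \<mu> ! j + (if j = 0 then if i = 0 then \<beta> ! 0 else 0 else 0))"
    unfolding dot_def using assms by (intro sum.cong) (auto simp: nth_aff_refl algebra_simps)
  also have "\<dots> = dot \<beta> (lin_refl i \<mu>) + (if i = 0 then \<beta> ! 0 else 0)"
    using assms by (simp add: sum.distrib dot_def)
  finally show ?thesis using assms by (simp add: dot_lin_refl)
qed

lemma aff_refl_add_root:
  assumes "length \<alpha> = length \<mu>" "i \<le> length \<mu>"
  shows "aff_refl i (add_root \<mu> c \<alpha>) = add_root (aff_refl i \<mu>) c (lin_refl i \<alpha>)"
  using assms
  by (intro nth_equalityI)
     (auto simp: length_add_root nth_add_root nth_aff_refl nth_lin_refl refl_idx_less algebra_simps)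

lemma add_root_uminus: "length \<alpha> = length \<mu> \<Longrightarrow> add_root \<mu> c (map uminus \<alpha>) = add_root \<mu> (- c) \<alpha>"
  by (intro nth_equalityI) (auto simp: length_add_root nth_add_root)

text \<open>
  A simple reflection maps the fundamental alcove to a neighbour, so among all hyperplanes only
  that of \<open>s\<^sub>i\<close> separates the two alcoves. Therefore it preserves the direction of every step except
  the step along its own hyperplane.
\<close>

lemma bruhat_step_aff_refl:
  assumes step: "bruhat_step \<mu> \<nu>" and i: "i \<le> length \<mu>"
  shows "\<nu> = aff_refl i \<mu> \<or> bruhat_step (aff_refl i \<mu>) (aff_refl i \<nu>)"
proof -
  let ?n = "length \<mu>"
  obtain \<alpha> c where a: "\<alpha> \<in> BC_pos ?n" "length \<alpha> = ?n" and \<nu>: "\<nu> = add_root \<mu> c \<alpha>"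
    and c: "0 < c \<and> 0 < 2 * dot \<alpha> \<mu> + c * dot \<alpha> \<alpha> \<or> c < 0 \<and> 2 * dot \<alpha> \<mu> + c * dot \<alpha> \<alpha> \<le> 0"
    using step by (rule bruhat_stepE)
  define M where "M = 2 * dot \<alpha> \<mu> + c * dot \<alpha> \<alpha>"
  have n: "0 < ?n" using root_leading_pos[OF a(1)] by auto
  have lin: "dot (lin_refl i \<alpha>) (lin_refl i \<alpha>) = dot \<alpha> \<alpha>" by (simp add: dot_lin_refl_lin_refl)
  show ?thesis
  proof (cases "lin_refl i \<alpha> \<in> BC_pos ?n")
    case True
    have "lin_refl 0 \<alpha> ! 0 = 0" if "i = 0"
      using flipped_0[OF a(1)] True that n a(2) by (simp add: lin_refl_first)
    then have "dot (lin_refl i \<alpha>) (aff_refl i \<mu>) = dot \<alpha> \<mu>"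
      using a(2) i n by (simp add: dot_aff_refl)
    then have "dot (lin_refl i \<alpha>) (aff_refl i \<mu>) + dot (lin_refl i \<alpha>) (aff_refl i \<nu>) = M"
      using i by (simp add: \<nu> aff_refl_add_root a(2) dot_add_root lin M_def)
    moreover have "aff_refl i \<nu> = add_root (aff_refl i \<mu>) c (lin_refl i \<alpha>)"
      using a i by (simp add: \<nu> aff_refl_add_root)
    ultimately have "bruhat_step (aff_refl i \<mu>) (aff_refl i \<nu>)"
      unfolding bruhat_step_def using True c
      by (intro bexI[of _ "lin_refl i \<alpha>"] exI[of _ c]) (simp_all add: M_def)
    then show ?thesis ..
  next
    case False
    define \<beta> where "\<beta> = map uminus (lin_refl i \<alpha>)"
    have b: "\<beta> \<in> BC_pos ?n" "length \<beta> = ?n"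
      using lin_refl_root[OF a(1), of i] False a(2) by (auto simp: \<beta>_def)
    have lin_b: "lin_refl i \<beta> = map uminus \<alpha>" by (simp add: \<beta>_def lin_refl_uminus)
    have bb: "dot \<beta> \<beta> = dot \<alpha> \<alpha>" by (simp add: \<beta>_def dot_uminus dot_uminus_right lin)
    have first: "\<beta> ! 0 = \<alpha> ! 0" if "i = 0"
      using that n a(2) by (simp add: \<beta>_def lin_refl_first)
    define s where "s = (if i = 0 then \<alpha> ! 0 else 0)"
    have \<nu>': "aff_refl i \<nu> = add_root (aff_refl i \<mu>) (- c) \<beta>"
      using a i by (simp add: \<nu> aff_refl_add_root \<beta>_def add_root_uminus)
    have d: "dot \<beta> (aff_refl i \<mu>) = - dot \<alpha> \<mu> + s"
      using b(2) i n by (simp add: dot_aff_refl lin_b dot_uminus s_def first)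
    then have "dot \<beta> (aff_refl i \<mu>) + dot \<beta> (aff_refl i \<nu>) = 2 * s - M"
      by (simp add: \<nu>' b(2) dot_add_root bb M_def)
    then have st: "bruhat_step (aff_refl i \<mu>) (aff_refl i \<nu>)"
      if "0 < c \<and> 2 * s - M \<le> 0 \<or> c < 0 \<and> 0 < 2 * s - M"
      unfolding bruhat_step_def using b \<nu>' that
      by (intro bexI[of _ \<beta>] exI[of _ "- c"]) auto
    have cM: "0 < c \<and> 0 < M \<or> c < 0 \<and> M \<le> 0" using c by (simp add: M_def)
    show ?thesis
    proof (cases "0 < c \<and> 2 * s - M \<le> 0 \<or> c < 0 \<and> 0 < 2 * s - M")
      case True
      then show ?thesis using st by simp
    next
      case stuck: False
      have "\<nu> = aff_refl i \<mu>"
      proof (rule nth_equalityI)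
        show "length \<nu> = length (aff_refl i \<mu>)" by (simp add: \<nu> length_add_root a(2))
        fix j assume "j < length \<nu>"
        then have j: "j < ?n" by (simp add: \<nu> length_add_root a(2))
        consider (zero) "i = 0" | (swap) "0 < i" "i < ?n" | (last) "i = ?n"
          using i by linarith
        then show "\<nu> ! j = aff_refl i \<mu> ! j"
        proof cases
          case zero
          have s0: "0 < s"
            using False flipped_0[OF a(1)] root_first_nonneg[OF a(1)] zero by (simp add: s_def)
          have cM': "0 < c" "0 < M" "M < 2 * s" using stuck cM s0 by linarith+
          \<comment> \<open>For \<open>2 e\<^sub>1\<close> and \<open>e\<^sub>1 \<plusminus> e\<^sub>j\<close> the number \<open>M\<close> is a multiple of \<open>2 s\<close>, so only \<open>e\<^sub>1\<close> with \<open>M = 1\<close> remains.\<close>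
          have "\<alpha> = two_term ?n 1 0 0 0 \<and> 2 * \<mu> ! 0 + c = 1"
            using a(1)
          proof (cases rule: BC_pos_cases)
            case (short k)
            then have "k = 0" using s0 n zero by (auto simp: s_def nth_two_term split: if_splits)
            with short n cM' zero show ?thesis
              by (simp add: s_def M_def nth_two_term dot_two_term_int)
          next
            case (long k)
            then have "k = 0" using s0 n zero by (auto simp: s_def nth_two_term split: if_splits)
            with long n zero have "M = 4 * (\<mu> ! 0 + c)" "s = 2"
              by (simp_all add: s_def M_def nth_two_term dot_two_term_int)
            then show ?thesis using cM' by presburger
          next
            case (middle k e l)
            then have "k = 0" using s0 n zero by (auto simp: s_def nth_two_term split: if_splits)
            then have "s = 1" using middle n zero by (simp add: s_def nth_two_term)
            have "M = 2 * (dot \<alpha> \<mu> + c)" using middle dot_root_self(3)[of k l ?n e]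
              by (simp add: M_def)
            then show ?thesis using cM' \<open>s = 1\<close> by presburger
          qed
          then show ?thesis using j zero n i
            by (auto simp: \<nu> nth_add_root nth_two_term aff_refl_def nth_list_update)
        next
          case swap
          have \<alpha>: "\<alpha> = two_term ?n 1 (i - 1) (-1) i"
            using flipped_swap[OF swap] a(1) False by blast
          \<comment> \<open>The step stays a step unless its hyperplane contains the origin; then it is that of \<open>s\<^sub>i\<close>.\<close>
          have "M = 0" using stuck cM swap by (auto simp: s_def)
          then have "c = \<mu> ! i - \<mu> ! (i - 1)"
            using swap by (auto simp: M_def \<alpha> dot_two_term_int nth_two_term split: if_splits)
          then show ?thesis using j swap
            by (auto simp: \<nu> a(2) nth_add_root) (auto simp: \<alpha> nth_two_term aff_refl_def swap_adj_def nth_list_update)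
        next
          case last
          have "M = 0" using stuck cM last n by (auto simp: s_def)
          obtain m where \<alpha>: "\<alpha> = two_term ?n m (?n - 1) 0 (?n - 1)" "m = 1 \<or> m = 2"
            using flipped_sign[OF n] a(1) False last by blast
          have "m * c = - 2 * \<mu> ! (?n - 1)"
            using n \<open>M = 0\<close> \<alpha>(2) by (auto simp: M_def \<alpha>(1) dot_two_term_int nth_two_term)
          then show ?thesis using j last n \<alpha>(2)
            by (auto simp: \<nu> a(2) nth_add_root) (auto simp: \<alpha>(1) nth_two_term aff_refl_def nth_list_update)
        qed
      qed
      then show ?thesis ..
    qed
  qed
qed

lemma raises_bruhat_step:
  assumes "raises i \<mu>" "i \<le> length \<mu>" "0 < length \<mu>"
  shows "bruhat_step \<mu> (aff_refl i \<mu>)"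
proof -
  let ?n = "length \<mu>"
  consider (zero) "i = 0" | (swap) "0 < i" "i < ?n" | (last) "i = ?n" "0 < i"
    using assms by linarith
  then show ?thesis
  proof cases
    case zero
    let ?\<alpha> = "two_term ?n 1 0 0 0" and ?c = "1 - 2 * \<mu> ! 0"
    have "aff_refl i \<mu> = add_root \<mu> ?c ?\<alpha>"
      using zero assms
      by (intro nth_equalityI) (auto simp: length_add_root nth_add_root nth_two_term aff_refl_def nth_list_update)
    moreover have "dot ?\<alpha> \<mu> + dot ?\<alpha> (aff_refl i \<mu>) = 1"
      using zero assms by (simp add: dot_two_term_int aff_refl_def)
    ultimately show ?thesis
      unfolding bruhat_step_def using assms zero
      by (intro bexI[of _ ?\<alpha>] exI[of _ ?c]) (auto simp: raises_def intro: BC_pos_short)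
  next
    case swap
    let ?\<alpha> = "two_term ?n 1 (i - 1) (-1) i" and ?c = "\<mu> ! i - \<mu> ! (i - 1)"
    have "aff_refl i \<mu> = add_root \<mu> ?c ?\<alpha>"
      using swap
      by (intro nth_equalityI) (auto simp: length_add_root nth_add_root nth_two_term aff_refl_def swap_adj_def nth_list_update)
    moreover have "dot ?\<alpha> \<mu> + dot ?\<alpha> (aff_refl i \<mu>) = 0"
      using swap by (simp add: dot_two_term_int aff_refl_def swap_adj_def nth_list_update)
    ultimately show ?thesis
      unfolding bruhat_step_def using assms swap
      by (intro bexI[of _ ?\<alpha>] exI[of _ ?c]) (auto simp: raises_def intro: BC_pos_middle)
  next
    case last
    let ?\<alpha> = "two_term ?n 1 (?n - 1) 0 (?n - 1)" and ?c = "- 2 * \<mu> ! (?n - 1)"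
    have "aff_refl i \<mu> = add_root \<mu> ?c ?\<alpha>"
      using last
      by (intro nth_equalityI) (auto simp: length_add_root nth_add_root nth_two_term aff_refl_def nth_list_update)
    moreover have "dot ?\<alpha> \<mu> + dot ?\<alpha> (aff_refl i \<mu>) = 0"
      using last by (simp add: dot_two_term_int aff_refl_def)
    ultimately show ?thesis
      unfolding bruhat_step_def using assms last
      by (intro bexI[of _ ?\<alpha>] exI[of _ ?c]) (auto simp: raises_def intro: BC_pos_short)
  qed
qed

lemma length_bruhat_rtrancl: "bruhat_step\<^sup>*\<^sup>* \<mu> \<nu> \<Longrightarrow> length \<mu> = length \<nu>"
  by (induction rule: rtranclp_induct) (auto dest: length_bruhat_step)

text \<open>
  The lifting property of the Bruhat order. Moving a chain from \<open>\<mu>\<close> to \<open>\<nu>\<close> by \<open>s\<^sub>i\<close> step by step either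
  gives a chain from \<open>s\<^sub>i \<mu>\<close> to \<open>s\<^sub>i \<nu>\<close>, or meets a step along \<open>s\<^sub>i\<close> itself, and then \<open>s\<^sub>i \<mu>\<close> is below \<open>\<nu>\<close>.
\<close>

lemma bruhat_lifting:
  assumes "bruhat_step\<^sup>*\<^sup>* \<mu> \<nu>" "raises i \<nu>" "i \<le> length \<nu>" "0 < length \<nu>"
  shows "bruhat_step\<^sup>*\<^sup>* (aff_refl i \<mu>) (aff_refl i \<nu>)"
proof -
  have "bruhat_step\<^sup>*\<^sup>* (aff_refl i \<mu>) \<nu> \<or> bruhat_step\<^sup>*\<^sup>* (aff_refl i \<mu>) (aff_refl i \<nu>)"
    using assms(1)
  proof (induction rule: converse_rtranclp_induct)
    case (step \<mu> \<mu>')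
    have "i \<le> length \<mu>"
      using step(1,2) assms(3) by (metis length_bruhat_step length_bruhat_rtrancl)
    from bruhat_step_aff_refl[OF step(1) this] step.IH step(2) show ?case
      by (metis converse_rtranclp_into_rtranclp)
  qed simp
  with raises_bruhat_step[OF assms(2-4)] show ?thesis
    by (metis rtranclp.rtrancl_into_rtrancl)
qed

subsection \<open>A rank function increasing along Bruhat steps\<close>

text \<open>
  Along a step the squared length grows, or it stays and a positive root is subtracted a positive
  number of times, which lowers \<open>\<Sum>\<^sub>j (n - j) \<mu>\<^sub>j\<close> (with \<open>j\<close> counted from \<open>0\<close>). The second component is
  the negative of this sum, shifted so as to be a natural number.
\<close>

definition bruhat_rank :: "int list \<Rightarrow> nat \<times> nat" where
  "bruhat_rank \<mu> = (nat (dot \<mu> \<mu>), nat (\<Sum>j<length \<mu>. int (length \<mu> - j) * (dot \<mu> \<mu> - \<mu> ! j)))"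

lemma dot_self_nonneg: "0 \<le> dot \<mu> (\<mu> :: int list)"
  unfolding dot_def by (intro sum_nonneg) simp

lemma nth_le_dot_self:
  assumes "j < length \<mu>"
  shows "\<mu> ! j \<le> dot \<mu> (\<mu> :: int list)"
proof -
  have "\<mu> ! j \<le> \<mu> ! j * \<mu> ! j"
    by (cases "\<mu> ! j \<ge> 1") (use mult_left_mono[of 1 "\<mu> ! j" "\<mu> ! j"] zero_le_square[of "\<mu> ! j"] in linarith)+
  also have "\<dots> \<le> dot \<mu> \<mu>"
    unfolding dot_def using assms by (intro member_le_sum) auto
  finally show ?thesis .
qed

lemma root_partial_sum_nonneg:
  assumes "\<alpha> \<in> BC_pos n" "p \<le> n"
  shows "0 \<le> (\<Sum>i<p. \<alpha> ! i)"
proof -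
  have "(\<Sum>k<p. two_term n a i b j ! k) = (if i < p then a else 0) + (if j < p then b else 0)" for a i b j
  proof -
    have "(\<Sum>k<p. two_term n a i b j ! k) = (\<Sum>k<p. (if k = i then a else 0) + (if k = j then b else 0))"
      using assms by (intro sum.cong) (auto simp: nth_two_term)
    then show ?thesis by (simp add: sum.distrib)
  qed
  with assms(1) show ?thesis by (cases rule: BC_pos_cases) auto
qed

lemma root_height_pos:
  assumes "\<alpha> \<in> BC_pos n"
  shows "0 < (\<Sum>j<n. int (n - j) * \<alpha> ! j)"
proof -
  have s: "(\<Sum>k<n. int (n - k) * two_term n a i b j ! k) = int (n - i) * a + int (n - j) * b"
    if "i < n" "j < n" for a i b j
  proof -
    have "(\<Sum>k<n. int (n - k) * two_term n a i b j ! k)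
        = (\<Sum>k<n. (if k = i then int (n - k) * a else 0) + (if k = j then int (n - k) * b else 0))"
      by (intro sum.cong) (auto simp: nth_two_term algebra_simps)
    then show ?thesis using that by (simp add: sum.distrib)
  qed
  from assms show ?thesis by (cases rule: BC_pos_cases) (auto simp: s simp del: of_nat_diff)
qed

lemma bruhat_step_dot:
  assumes "\<nu> = add_root \<mu> c \<alpha>" "length \<alpha> = length \<mu>"
  shows "dot \<nu> \<nu> = dot \<mu> \<mu> + c * (2 * dot \<alpha> \<mu> + c * dot \<alpha> \<alpha>)"
  using assms
  by (simp add: dot_add_root length_add_root dot_commute[of "add_root \<mu> c \<alpha>"] algebra_simps
      dot_commute[of \<mu> \<alpha>])

lemma bruhat_step_rank:
  assumes "bruhat_step \<mu> \<nu>"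
  shows "(bruhat_rank \<mu>, bruhat_rank \<nu>) \<in> less_than <*lex*> less_than"
proof -
  obtain \<alpha> c where a: "\<alpha> \<in> BC_pos (length \<mu>)" "length \<alpha> = length \<mu>" "\<nu> = add_root \<mu> c \<alpha>"
    and c: "0 < c \<and> 0 < 2 * dot \<alpha> \<mu> + c * dot \<alpha> \<alpha> \<or> c < 0 \<and> 2 * dot \<alpha> \<mu> + c * dot \<alpha> \<alpha> \<le> 0"
    using assms by (rule bruhat_stepE)
  note d = bruhat_step_dot[OF a(3,2)]
  show ?thesis
  proof (cases "2 * dot \<alpha> \<mu> + c * dot \<alpha> \<alpha> = 0")
    case False
    with c have "0 < c * (2 * dot \<alpha> \<mu> + c * dot \<alpha> \<alpha>)"
      by (auto intro: mult_pos_pos mult_neg_neg)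
    then show ?thesis using d dot_self_nonneg[of \<mu>] by (simp add: bruhat_rank_def)
  next
    case True
    then have e: "dot \<nu> \<nu> = dot \<mu> \<mu>" and c: "c < 0" using d c by auto
    let ?S = "\<lambda>x. \<Sum>j<length x. int (length x - j) * (dot x x - x ! j)"
    have l: "length \<nu> = length \<mu>" using assms by (rule length_bruhat_step)
    have "?S \<nu> = ?S \<mu> - c * (\<Sum>j<length \<mu>. int (length \<mu> - j) * \<alpha> ! j)"
      unfolding l e using a
      by (simp add: nth_add_root sum_distrib_left algebra_simps flip: sum_subtractf sum.distrib)
    then have "?S \<mu> < ?S \<nu>"
      using mult_neg_pos[OF c root_height_pos[OF a(1)]] by simp
    moreover have "0 \<le> ?S \<mu>"
      by (intro sum_nonneg mult_nonneg_nonneg) (auto simp: nth_le_dot_self)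
    ultimately show ?thesis using e by (simp add: bruhat_rank_def)
  qed
qed

lemma bruhat_trancl_rank:
  "bruhat_step\<^sup>+\<^sup>+ \<mu> \<nu> \<Longrightarrow> (bruhat_rank \<mu>, bruhat_rank \<nu>) \<in> less_than <*lex*> less_than"
proof (induction rule: tranclp_induct)
  case (base \<nu>)
  then show ?case by (rule bruhat_step_rank)
next
  case (step \<nu> \<nu>')
  have "trans (less_than <*lex*> less_than)" by (simp add: trans_lex_prod trans_less_than)
  then show ?case using step.IH bruhat_step_rank[OF step(2)] by (rule transD)
qed

lemma bruhat_trancl_irrefl: "\<not> bruhat_step\<^sup>+\<^sup>+ \<mu> \<mu>"
  using bruhat_trancl_rank[of \<mu> \<mu>] wf_lex_prod[OF wf_less_than wf_less_than] by (auto dest: wf_not_refl)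

lemma bruhat_induct [case_names less]:
  assumes "\<And>\<nu>. (\<And>\<mu>. bruhat_step\<^sup>+\<^sup>+ \<mu> \<nu> \<Longrightarrow> P \<mu>) \<Longrightarrow> P \<nu>"
  shows "P \<nu>"
proof (induction "bruhat_rank \<nu>" arbitrary: \<nu> rule: wf_induct[of "less_than <*lex*> less_than"])
  case 1
  show ?case by (simp add: wf_lex_prod)
next
  case 2
  then show ?case using assms bruhat_trancl_rank by blast
qed

text \<open>
  If no simple reflection lowers \<open>\<nu>\<close>, then \<open>0 \<ge> \<nu>\<^sub>1 \<ge> \<dots> \<ge> \<nu>\<^sub>n \<ge> 0\<close>.
\<close>

lemma raising_exists:
  assumes "0 < length \<nu>" "\<nu> \<noteq> replicate (length \<nu>) 0"
  shows "\<exists>i\<le>length \<nu>. raises i (aff_refl i \<nu>)"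
proof (rule ccontr)
  let ?n = "length \<nu>"
  assume no: "\<not> ?thesis"
  have "\<not> raises 0 (aff_refl 0 \<nu>)" using no by simp
  then have first: "\<nu> ! 0 \<le> 0" using assms by (simp add: raises_def aff_refl_def)
  have "\<not> raises ?n (aff_refl ?n \<nu>)" using no by simp
  then have last: "0 \<le> \<nu> ! (?n - 1)" using assms by (simp add: raises_def aff_refl_def)
  have desc: "\<nu> ! Suc i \<le> \<nu> ! i" if "Suc i < ?n" for i
  proof -
    have "\<not> raises (Suc i) (aff_refl (Suc i) \<nu>)" using no that by (meson less_imp_le_nat)
    then show ?thesis
      using that by (simp add: raises_def aff_refl_def swap_adj_def nth_list_update)
  qed
  have mono: "\<nu> ! j \<le> \<nu> ! i" if "i \<le> j" "j < ?n" for i j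
    using that by (induction j rule: dec_induct) (auto intro: order_trans[OF desc])
  have "\<nu> ! j = 0" if "j < ?n" for j
  proof -
    have "\<nu> ! j \<le> 0" using mono[of 0 j] first that by simp
    moreover have "0 \<le> \<nu> ! j" using mono[of j "?n - 1"] last that assms(1) by linarith
    ultimately show ?thesis by simp
  qed
  then have "\<nu> = replicate ?n 0" by (intro nth_equalityI) auto
  then show False using assms by simp
qed

text \<open>
  Every index is reached from \<open>0\<close> by simple reflections that raise it.
\<close>

lemma raising_induct [consumes 2, case_names zero raise]:
  assumes "length \<nu> = n" "0 < n"
    and zero: "P (replicate n 0)"
    and raise: "\<And>i \<mu>. length \<mu> = n \<Longrightarrow> i \<le> n \<Longrightarrow> raises i \<mu> \<Longrightarrow> P \<mu> \<Longrightarrow> P (aff_refl i \<mu>)"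
  shows "P \<nu>"
  using assms(1)
proof (induction \<nu> rule: bruhat_induct)
  case (less \<nu>)
  show ?case
  proof (cases "\<nu> = replicate n 0")
    case False
    then obtain i where i: "i \<le> n" "raises i (aff_refl i \<nu>)"
      using raising_exists[of \<nu>] less.prems \<open>0 < n\<close> by auto
    have inv: "aff_refl i (aff_refl i \<nu>) = \<nu>" using i less.prems by (simp add: aff_refl_aff_refl)
    then have "bruhat_step (aff_refl i \<nu>) \<nu>"
      using raises_bruhat_step[OF i(2)] i(1) less.prems \<open>0 < n\<close> by simp
    then have "P (aff_refl i \<nu>)" using less by (simp add: tranclp.r_into_trancl)
    from raise[OF _ i this] less.prems inv show ?thesis by simp
  qed (use zero in simp)
qed


subsection \<open>Bruhat order and the triangularity order\<close>

lemma dominant_unique: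
  assumes "\<nu> \<in> orbit_BC \<mu>" "sorted_wrt (\<ge>) \<nu>" "\<forall>a\<in>set \<nu>. 0 \<le> a"
  shows "\<nu> = rev (sort (map abs \<mu>))"
proof -
  obtain \<epsilon> \<pi> where \<nu>: "\<nu> = map (\<lambda>i. \<epsilon> i * \<mu> ! \<pi> i) [0..<length \<mu>]"
    and \<pi>: "\<pi> permutes {..<length \<mu>}" and \<epsilon>: "\<forall>i. \<epsilon> i \<in> {1, -1}"
    using assms(1) unfolding orbit_BC_def by blast
  have "\<nu> = permute_list \<pi> (map abs \<mu>)"
  proof (rule nth_equalityI)
    fix i assume "i < length \<nu>"
    then have i: "i < length \<mu>" by (simp add: \<nu>)
    then have "\<pi> i < length \<mu>" using permutes_in_image[OF \<pi>, of i] by simp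
    moreover have "0 \<le> \<nu> ! i" using assms(3) \<open>i < length \<nu>\<close> by simp
    moreover have "\<epsilon> i = 1 \<or> \<epsilon> i = -1" using \<epsilon> by blast
    ultimately show "\<nu> ! i = permute_list \<pi> (map abs \<mu>) ! i"
      using i \<pi> by (auto simp: \<nu> permute_list_nth)
  qed (simp add: \<nu>)
  then have "mset \<nu> = mset (map abs \<mu>)" using \<pi> by simp
  moreover have "sorted (rev \<nu>)" using assms(2) by (simp add: sorted_wrt_rev)
  ultimately have "sort (map abs \<mu>) = rev \<nu>"
    by (intro properties_for_sort) (simp_all add: mset_map)
  then show ?thesis by simp
qed

lemma dominant_eq: "dominant \<mu> = rev (sort (map abs \<mu>))"
  and dominant_permutation: "\<exists>\<pi>. \<pi> permutes {..<length \<mu>} \<and> (\<forall>i<length \<mu>. dominant \<mu> ! i = \<bar>\<mu> ! \<pi> i\<bar>)"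
proof -
  let ?d = "rev (sort (map abs \<mu>))"
  have "mset ?d = mset (map abs \<mu>)" by simp
  then obtain \<pi> where \<pi>: "\<pi> permutes {..<length \<mu>}" and d: "permute_list \<pi> (map abs \<mu>) = ?d"
    by (metis mset_eq_permutation length_map)
  have nth: "?d ! i = \<bar>\<mu> ! \<pi> i\<bar>" if "i < length \<mu>" for i
    using that \<pi> permutes_in_image[OF \<pi>, of i] by (simp flip: d add: permute_list_nth)
  define \<epsilon> where "\<epsilon> i = (if 0 \<le> \<mu> ! \<pi> i then 1 else -1 :: int)" for i
  have "?d = map (\<lambda>i. \<epsilon> i * \<mu> ! \<pi> i) [0..<length \<mu>]"
    by (rule nth_equalityI) (simp_all add: nth \<epsilon>_def)
  moreover have "\<forall>i. \<epsilon> i \<in> {1, -1}" by (simp add: \<epsilon>_def)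
  ultimately have orb: "?d \<in> orbit_BC \<mu>" unfolding orbit_BC_def using \<pi> by blast
  have "sorted_wrt (\<ge>) ?d" by (simp add: sorted_wrt_rev)
  moreover have "\<forall>a\<in>set ?d. 0 \<le> a" by auto
  ultimately show e: "dominant \<mu> = ?d"
    unfolding dominant_def using orb by (intro the_equality conjI) (auto intro: dominant_unique)
  show "\<exists>\<pi>. \<pi> permutes {..<length \<mu>} \<and> (\<forall>i<length \<mu>. dominant \<mu> ! i = \<bar>\<mu> ! \<pi> i\<bar>)"
    unfolding e using \<pi> nth by blast
qed

lemma length_dominant [simp]: "length (dominant \<mu>) = length \<mu>"
  by (simp add: dominant_eq)

lemma dominant_antimono: "i \<le> j \<Longrightarrow> j < length \<mu> \<Longrightarrow> dominant \<mu> ! j \<le> dominant \<mu> ! i"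
  using sorted_rev_nth_mono[of "dominant \<mu>" i j] by (simp add: dominant_eq)

lemma dot_dominant: "dot (dominant \<mu>) (dominant \<mu>) = dot \<mu> \<mu>"
proof -
  obtain \<pi> where \<pi>: "\<pi> permutes {..<length \<mu>}" "\<forall>i<length \<mu>. dominant \<mu> ! i = \<bar>\<mu> ! \<pi> i\<bar>"
    using dominant_permutation by blast
  have "dot (dominant \<mu>) (dominant \<mu>) = (\<Sum>i<length \<mu>. \<mu> ! \<pi> i * \<mu> ! \<pi> i)"
    unfolding dot_def using \<pi>(2) by (intro sum.cong) simp_all
  also have "\<dots> = dot \<mu> \<mu>"
    unfolding dot_def using sum.permute[OF \<pi>(1), of "\<lambda>i. \<mu> ! i * \<mu> ! i"] by (simp add: comp_def)
  finally show ?thesis .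
qed

lemma sum_subset_le_prefix:
  fixes d :: "nat \<Rightarrow> int"
  assumes "J \<subseteq> {..<n}" "\<And>i j. i \<le> j \<Longrightarrow> j < n \<Longrightarrow> d j \<le> d i"
  shows "sum d J \<le> (\<Sum>i<card J. d i)"
  using assms
proof (induction n arbitrary: J)
  case (Suc n)
  show ?case
  proof (cases "n \<in> J")
    case False
    with Suc.prems have "J \<subseteq> {..<n}" by (auto simp: less_Suc_eq)
    then show ?thesis using Suc.prems(2) by (intro Suc.IH) auto
  next
    case True
    let ?J = "J - {n}"
    have fin: "finite J" using Suc.prems(1) finite_subset by blast
    have sub: "?J \<subseteq> {..<n}" using Suc.prems(1) by (auto simp: less_Suc_eq)
    have card: "card J = Suc (card ?J)" using fin True by (rule card.remove)
    have "card ?J \<le> n" using card_mono[OF _ sub] by simp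
    then have "d n \<le> d (card ?J)" using Suc.prems(2) by simp
    moreover have "sum d ?J \<le> (\<Sum>i<card ?J. d i)" using sub Suc.prems(2) by (intro Suc.IH) auto
    moreover have "sum d J = d n + sum d ?J" using fin True by (rule sum.remove)
    ultimately show ?thesis unfolding card by simp
  qed
qed simp

text \<open>
  The partial sums of the dominant representative are the largest sums of absolute values over
  index sets of the given size, which makes dominance a statement about subsets.
\<close>

lemma dom_le_dominantI:
  assumes l: "length \<mu> = n" "length \<nu> = n"
    and J: "\<And>J. J \<subseteq> {..<n} \<Longrightarrow>
      \<exists>J'\<subseteq>{..<n}. card J' = card J \<and> (\<Sum>j\<in>J. \<bar>\<mu> ! j\<bar>) \<le> (\<Sum>j\<in>J'. \<bar>\<nu> ! j\<bar>)"
  shows "dom_le (dominant \<mu>) (dominant \<nu>)"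
  unfolding dom_le_def
proof
  fix p assume "p \<in> {1..length (dominant \<nu>)}"
  then have p: "p \<le> n" using l by simp
  obtain \<pi> where \<pi>: "\<pi> permutes {..<n}" "\<forall>i<n. dominant \<mu> ! i = \<bar>\<mu> ! \<pi> i\<bar>"
    using dominant_permutation[of \<mu>] l by auto
  obtain \<rho> where \<rho>: "\<rho> permutes {..<n}" "\<forall>i<n. dominant \<nu> ! i = \<bar>\<nu> ! \<rho> i\<bar>"
    using dominant_permutation[of \<nu>] l by auto
  have inj: "inj_on \<pi> A" "inj_on \<rho> A" for A
    using permutes_inj[OF \<pi>(1)] permutes_inj[OF \<rho>(1)] by (meson inj_on_subset subset_UNIV)+
  have sub: "\<pi> ` {..<p} \<subseteq> {..<n}"
    using p image_mono[of "{..<p}" "{..<n}" \<pi>] permutes_image[OF \<pi>(1)] by simp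
  have card: "card (\<pi> ` {..<p}) = p" using inj(1) by (simp add: card_image)
  obtain J' where J': "J' \<subseteq> {..<n}" "card J' = p"
    and le: "(\<Sum>j\<in>\<pi> ` {..<p}. \<bar>\<mu> ! j\<bar>) \<le> (\<Sum>j\<in>J'. \<bar>\<nu> ! j\<bar>)"
    using J[OF sub] unfolding card by blast
  define K where "K = {k. k < n \<and> \<rho> k \<in> J'}"
  have K: "K \<subseteq> {..<n}" by (auto simp: K_def)
  have img: "\<rho> ` K = J'"
  proof
    show "J' \<subseteq> \<rho> ` K"
    proof
      fix j assume j: "j \<in> J'"
      then have "j \<in> \<rho> ` {..<n}" using J'(1) permutes_image[OF \<rho>(1)] by blast
      then show "j \<in> \<rho> ` K" using j by (auto simp: K_def)
    qed
  qed (auto simp: K_def)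
  then have cK: "card K = p" using J'(2) inj(2) card_image by metis
  have "(\<Sum>i<p. dominant \<mu> ! i) = (\<Sum>j\<in>\<pi> ` {..<p}. \<bar>\<mu> ! j\<bar>)"
    using p \<pi>(2) by (simp add: sum.reindex inj)
  also note le
  also have "(\<Sum>j\<in>J'. \<bar>\<nu> ! j\<bar>) = (\<Sum>k\<in>K. dominant \<nu> ! k)"
    unfolding img[symmetric] using \<rho>(2) by (simp add: sum.reindex inj K_def)
  also have "\<dots> \<le> (\<Sum>i<card K. dominant \<nu> ! i)"
    using K l by (intro sum_subset_le_prefix[of K n]) (auto intro: dominant_antimono)
  finally show "(\<Sum>i<p. dominant \<mu> ! i) \<le> (\<Sum>i<p. dominant \<nu> ! i)" by (simp add: cK)
qed

lemma dom_le_refl: "dom_le \<mu> \<mu>"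
  by (simp add: dom_le_def)

lemma dom_le_trans: "dom_le \<mu> \<nu> \<Longrightarrow> dom_le \<nu> \<rho> \<Longrightarrow> length \<nu> = length \<rho> \<Longrightarrow> dom_le \<mu> \<rho>"
  unfolding dom_le_def by (metis order_trans)

lemma dom_le_antisym:
  assumes "dom_le \<mu> \<nu>" "dom_le \<nu> \<mu>" "length \<mu> = length \<nu>"
  shows "\<mu> = \<nu>"
proof (rule nth_equalityI)
  have eq: "(\<Sum>i<p. \<mu> ! i) = (\<Sum>i<p. \<nu> ! i)" if "p \<le> length \<mu>" for p
  proof (cases "p = 0")
    case False
    then have "p \<in> {1..length \<nu>}" "p \<in> {1..length \<mu>}" using that assms(3) by auto
    then show ?thesis
      using assms(1,2) unfolding dom_le_def by (blast intro: antisym)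
  qed simp
  fix i assume "i < length \<mu>"
  then show "\<mu> ! i = \<nu> ! i" using eq[of i] eq[of "Suc i"] by simp
qed (use assms in simp)

lemma tri_le_dominant: "tri_le \<mu> \<nu> \<Longrightarrow> dom_le (dominant \<mu>) (dominant \<nu>)"
  by (auto simp: tri_le_def dom_le_refl)

lemma tri_le_trans:
  assumes "tri_le \<mu> \<nu>" "tri_le \<nu> \<rho>" "length \<mu> = length \<nu>" "length \<nu> = length \<rho>"
  shows "tri_le \<mu> \<rho>"
proof (cases "dominant \<mu> = dominant \<rho>")
  case True
  then have "dominant \<mu> = dominant \<nu>"
    using tri_le_dominant[OF assms(1)] tri_le_dominant[OF assms(2)] assms(3,4)
    by (intro dom_le_antisym) simp_all
  moreover from this True have "dominant \<nu> = dominant \<rho>" by simp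
  ultimately have "dom_le \<nu> \<mu>" "dom_le \<rho> \<nu>" using assms(1,2) by (simp_all add: tri_le_def)
  then have "dom_le \<rho> \<mu>" using assms(3) dom_le_trans[of \<rho> \<nu> \<mu>] by simp
  with True show ?thesis by (simp add: tri_le_def)
next
  case False
  have "dom_le (dominant \<mu>) (dominant \<rho>)"
    using tri_le_dominant[OF assms(1)] tri_le_dominant[OF assms(2)] assms(4)
    by (rule dom_le_trans[OF _ _ trans[OF length_dominant trans[OF _ length_dominant[symmetric]]]])
  with False show ?thesis by (simp add: tri_le_def)
qed

lemma tri_le_antisym:
  assumes "tri_le \<mu> \<nu>" "tri_le \<nu> \<mu>" "length \<mu> = length \<nu>"
  shows "\<mu> = \<nu>"
proof -
  have "dominant \<mu> = dominant \<nu>"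
    using tri_le_dominant[OF assms(1)] tri_le_dominant[OF assms(2)] assms(3)
    by (intro dom_le_antisym) simp_all
  then have "dom_le \<nu> \<mu>" "dom_le \<mu> \<nu>" using assms(1,2) by (simp_all add: tri_le_def)
  then show ?thesis using assms(3) by (intro dom_le_antisym)
qed

text \<open>
  Adding \<open>c\<close> to both entries keeps \<open>u - v\<close> and, by the hypothesis, does not decrease \<open>\<bar>u + v\<bar>\<close>;
  moreover
  \<open>\<bar>u\<bar> + \<bar>v\<bar> = max \<bar>u + v\<bar> \<bar>u - v\<bar>\<close>, \<open>2 max \<bar>u\<bar> \<bar>v\<bar> = \<bar>u + v\<bar> + \<bar>u - v\<bar>\<close>.
\<close>

lemma abs_pair_spread:
  fixes u v c :: int
  assumes "0 < c \<and> 0 < u + v + c \<or> c < 0 \<and> u + v + c \<le> 0"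
  shows "\<bar>u\<bar> + \<bar>v\<bar> \<le> \<bar>u + c\<bar> + \<bar>v + c\<bar>"
    and "\<bar>u\<bar> \<le> max \<bar>u + c\<bar> \<bar>v + c\<bar>" and "\<bar>v\<bar> \<le> max \<bar>u + c\<bar> \<bar>v + c\<bar>"
  using assms by (auto simp: abs_if max_def)

text \<open>
  A step changes at most two entries, and their absolute values spread. A subset containing one of
  the two positions is compared with the subset containing the position of the larger new entry.
\<close>

lemma dom_le_dominant_bruhat_step:
  assumes "bruhat_step \<mu> \<nu>"
  shows "dom_le (dominant \<mu>) (dominant \<nu>)"
proof -
  let ?n = "length \<mu>"
  obtain \<alpha> c where a: "\<alpha> \<in> BC_pos ?n" "length \<alpha> = length \<mu>" and \<nu>: "\<nu> = add_root \<mu> c \<alpha>"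
    and c: "0 < c \<and> 0 < 2 * dot \<alpha> \<mu> + c * dot \<alpha> \<alpha> \<or> c < 0 \<and> 2 * dot \<alpha> \<mu> + c * dot \<alpha> \<alpha> \<le> 0"
    using assms by (rule bruhat_stepE)
  have l: "length \<nu> = ?n" using assms by (rule length_bruhat_step)
  have one: ?thesis if le: "\<And>k. k < ?n \<Longrightarrow> \<bar>\<mu> ! k\<bar> \<le> \<bar>\<nu> ! k\<bar>"
    using l
  proof (rule dom_le_dominantI[OF refl])
    fix J assume "J \<subseteq> {..<?n}"
    then show "\<exists>J'\<subseteq>{..<?n}. card J' = card J \<and> (\<Sum>j\<in>J. \<bar>\<mu> ! j\<bar>) \<le> (\<Sum>j\<in>J'. \<bar>\<nu> ! j\<bar>)"
      using le by (intro exI[of _ J]) (auto intro!: sum_mono)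
  qed
  have single: ?thesis if "i < ?n" "\<alpha> = two_term ?n m i 0 i" "m = 1 \<or> m = 2" for i m
  proof (rule one)
    fix k assume k: "k < ?n"
    have "dot \<alpha> \<mu> = m * \<mu> ! i" "dot \<alpha> \<alpha> = m * m"
      using that by (simp_all add: dot_two_term_int nth_two_term)
    with c that(3) have "\<bar>\<mu> ! i\<bar> \<le> \<bar>\<mu> ! i + c * m\<bar>"
      by (elim disjE) auto
    then show "\<bar>\<mu> ! k\<bar> \<le> \<bar>\<nu> ! k\<bar>"
      using k that by (auto simp: \<nu> nth_add_root nth_two_term)
  qed
  from a(1) show ?thesis
  proof (cases rule: BC_pos_cases)
    case (short i)
    then show ?thesis by (intro single) auto
  next
    case (long i)
    then show ?thesis by (intro single) auto
  next
    case (middle i e j)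
    have ij: "i \<noteq> j" "i < ?n" "j < ?n" using middle by auto
    have \<nu>i: "\<nu> ! i = \<mu> ! i + c" and \<nu>j: "\<nu> ! j = \<mu> ! j + c * e"
      and \<nu>k: "\<And>k. k < ?n \<Longrightarrow> k \<noteq> i \<Longrightarrow> k \<noteq> j \<Longrightarrow> \<nu> ! k = \<mu> ! k"
      using middle by (auto simp: \<nu> nth_add_root nth_two_term)
    have "dot \<alpha> \<mu> = \<mu> ! i + e * \<mu> ! j" "dot \<alpha> \<alpha> = 2"
      using middle dot_root_self(3)[of i j ?n e] by (simp_all add: dot_two_term_int)
    then have eq: "2 * dot \<alpha> \<mu> + c * dot \<alpha> \<alpha> = 2 * (\<mu> ! i + e * \<mu> ! j + c)" by simp
    from c[unfolded eq] have c': "0 < c \<and> 0 < \<mu> ! i + e * \<mu> ! j + c \<or> c < 0 \<and> \<mu> ! i + e * \<mu> ! j + c \<le> 0"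
      unfolding zero_less_mult_iff mult_le_0_iff by simp
    have "\<bar>e * \<mu> ! j\<bar> = \<bar>\<mu> ! j\<bar>" "\<bar>e * \<mu> ! j + c\<bar> = \<bar>\<nu> ! j\<bar>"
      using middle(3) by (auto simp: \<nu>j)
    with abs_pair_spread[OF c']
    have sum: "\<bar>\<mu> ! i\<bar> + \<bar>\<mu> ! j\<bar> \<le> \<bar>\<nu> ! i\<bar> + \<bar>\<nu> ! j\<bar>"
      and mx: "\<bar>\<mu> ! i\<bar> \<le> max \<bar>\<nu> ! i\<bar> \<bar>\<nu> ! j\<bar>" "\<bar>\<mu> ! j\<bar> \<le> max \<bar>\<nu> ! i\<bar> \<bar>\<nu> ! j\<bar>"
      by (simp_all add: \<nu>i)
    show ?thesis
      using l
    proof (rule dom_le_dominantI[OF refl])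
      fix J assume J: "J \<subseteq> {..<?n}"
      then have fin: "finite J" using finite_subset by blast
      define J0 where "J0 = J - {i, j}"
      have J0: "finite J0" "i \<notin> J0" "j \<notin> J0" "J0 \<subseteq> {..<?n}" using fin J by (auto simp: J0_def)
      have rest: "(\<Sum>k\<in>J0. \<bar>\<mu> ! k\<bar>) = (\<Sum>k\<in>J0. \<bar>\<nu> ! k\<bar>)"
      proof (rule sum.cong[OF refl])
        fix k assume "k \<in> J0"
        then have "k < ?n" "k \<noteq> i" "k \<noteq> j" using J0 by blast+
        from \<nu>k[OF this] show "\<bar>\<mu> ! k\<bar> = \<bar>\<nu> ! k\<bar>" by (rule arg_cong[OF sym])
      qed
      let ?goal = "\<exists>J'\<subseteq>{..<?n}. card J' = card J \<and> (\<Sum>j\<in>J. \<bar>\<mu> ! j\<bar>) \<le> (\<Sum>j\<in>J'. \<bar>\<nu> ! j\<bar>)"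
      have mixed: ?goal if "J = insert k J0" "k = i \<or> k = j" for k
      proof -
        define m where "m = (if \<bar>\<nu> ! i\<bar> \<le> \<bar>\<nu> ! j\<bar> then j else i)"
        have "\<bar>\<mu> ! k\<bar> \<le> \<bar>\<nu> ! m\<bar>" using that(2) mx by (auto simp: m_def max_def)
        moreover have "m \<notin> J0" "m < ?n" "k \<notin> J0" using J0 that(2) ij by (auto simp: m_def)
        ultimately show ?goal
          using J0 rest that(1) by (intro exI[of _ "insert m J0"]) simp
      qed
      have both: ?goal if "J = insert i (insert j J0)"
        using J0 rest that sum ij J by (intro exI[of _ J]) simp
      have none: ?goal if "J = J0"
        using J0 rest that by (intro exI[of _ J]) simp
      consider "J = J0" | "J = insert i J0" | "J = insert j J0" | "J = insert i (insert j J0)"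
        by (auto simp: J0_def)
      then show ?goal
        using mixed[of i] mixed[of j] both none by cases auto
    qed
  qed
qed

text \<open>
  If the dominant representatives agree, then so do the squared lengths. Hence a positive multiple
  of a positive root is subtracted, and this does not increase any partial sum.
\<close>

lemma bruhat_step_tri_le:
  assumes "bruhat_step \<mu> \<nu>"
  shows "tri_le \<mu> \<nu>"
proof (cases "dominant \<mu> = dominant \<nu>")
  case False
  then show ?thesis using dom_le_dominant_bruhat_step[OF assms] by (simp add: tri_le_def)
next
  case True
  obtain \<alpha> c where a: "\<alpha> \<in> BC_pos (length \<mu>)" "length \<alpha> = length \<mu>" and \<nu>: "\<nu> = add_root \<mu> c \<alpha>"
    and c: "0 < c \<and> 0 < 2 * dot \<alpha> \<mu> + c * dot \<alpha> \<alpha> \<or> c < 0 \<and> 2 * dot \<alpha> \<mu> + c * dot \<alpha> \<alpha> \<le> 0"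
    using assms by (rule bruhat_stepE)
  have "dot \<nu> \<nu> = dot \<mu> \<mu>" using True dot_dominant by metis
  then have "c < 0" using bruhat_step_dot[OF \<nu> a(2)] c by auto
  have "(\<Sum>i<p. \<nu> ! i) \<le> (\<Sum>i<p. \<mu> ! i)" if "p \<le> length \<mu>" for p
  proof -
    have "(\<Sum>i<p. \<nu> ! i) = (\<Sum>i<p. \<mu> ! i) + c * (\<Sum>i<p. \<alpha> ! i)"
      using that a(2) by (simp add: \<nu> nth_add_root sum.distrib sum_distrib_left)
    moreover have "c * (\<Sum>i<p. \<alpha> ! i) \<le> 0"
      using \<open>c < 0\<close> root_partial_sum_nonneg[OF a(1) that] by (simp add: mult_nonpos_nonneg)
    ultimately show ?thesis by simp
  qed
  then have "dom_le \<nu> \<mu>" by (simp add: dom_le_def)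
  with True show ?thesis by (simp add: tri_le_def)
qed

lemma bruhat_lower_tri_lower:
  assumes "bruhat_step\<^sup>+\<^sup>+ \<mu> \<nu>"
  shows "\<mu> \<in> tri_lower \<nu>"
proof -
  have "length \<mu> = length \<nu> \<and> tri_le \<mu> \<nu>"
    using assms
  proof (induction rule: tranclp_induct)
    case (base \<nu>)
    then show ?case by (simp add: length_bruhat_step bruhat_step_tri_le)
  next
    case (step \<nu> \<nu>')
    have len: "length \<nu>' = length \<nu>" using step(2) by (rule length_bruhat_step)
    have "tri_le \<mu> \<nu>'"
      by (rule tri_le_trans[OF conjunct2[OF step.IH] bruhat_step_tri_le[OF step(2)]
            conjunct1[OF step.IH] len[symmetric]])
    then show ?case using len conjunct1[OF step.IH] by (simp only:)
  qed
  moreover have "\<mu> \<noteq> \<nu>" using assms bruhat_trancl_irrefl by auto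
  ultimately show ?thesis by (simp add: tri_lower_def)
qed

section \<open>Spectral vectors\<close>

text \<open>
  The sign that counts \<open>0\<close> as negative: integral points on the hyperplane of a positive root belong
  to the side opposite to the fundamental alcove.
\<close>

definition sgn_strict :: "int \<Rightarrow> real" where
  "sgn_strict m = (if 0 < m then 1 else -1)"

text \<open>
  The joint eigenvalue of \<open>E\<^sub>\<nu>\<close>: the operator \<open>D\<^sub>\<xi>\<close> acts on it by \<open>\<langle>\<gamma>, \<xi>\<rangle>\<close> with
  \<open>\<gamma> = \<nu> + 1/2 \<cdot> \<Sum>\<^sub>\<alpha> \<kappa>\<^sub>\<alpha> sgn \<langle>\<alpha>, \<nu>\<rangle> \<alpha>\<close>. For \<open>\<nu> = 0\<close> this is \<open>-\<rho>\<close>.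
\<close>

definition spectral :: "real \<times> real \<times> real \<Rightarrow> int list \<Rightarrow> real list" where
  "spectral \<kappa> \<nu> = map (\<lambda>j. of_int (\<nu> ! j) + (\<Sum>\<alpha>\<in>BC_pos (length \<nu>).
      BC_mult \<kappa> \<alpha> * sgn_strict (dot \<alpha> \<nu>) * of_int (\<alpha> ! j)) / 2) [0..<length \<nu>]"

lemma length_spectral [simp]: "length (spectral \<kappa> \<nu>) = length \<nu>"
  by (simp add: spectral_def)

lemma dot_spectral:
  assumes "length \<xi> = n" "length \<nu> = n"
  shows "dot (spectral \<kappa> \<nu>) \<xi> = dot (map of_int \<nu>) \<xi>
    + (\<Sum>\<alpha>\<in>BC_pos n. BC_mult \<kappa> \<alpha> * sgn_strict (dot \<alpha> \<nu>) * dot (map of_int \<alpha>) \<xi>) / 2"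
proof -
  let ?k = "\<lambda>\<alpha>. BC_mult \<kappa> \<alpha> * sgn_strict (dot \<alpha> \<nu>)"
  have "dot (spectral \<kappa> \<nu>) \<xi> = (\<Sum>j<n. of_int (\<nu> ! j) * \<xi> ! j)
      + (\<Sum>j<n. \<Sum>\<alpha>\<in>BC_pos n. ?k \<alpha> * of_int (\<alpha> ! j) * \<xi> ! j / 2)"
    using assms
    by (simp add: dot_def spectral_def distrib_right sum.distrib sum_divide_distrib sum_distrib_right)
  also have "(\<Sum>j<n. \<Sum>\<alpha>\<in>BC_pos n. ?k \<alpha> * of_int (\<alpha> ! j) * \<xi> ! j / 2)
      = (\<Sum>\<alpha>\<in>BC_pos n. \<Sum>j<n. ?k \<alpha> * of_int (\<alpha> ! j) * \<xi> ! j / 2)"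
    by (rule sum.swap)
  also have "\<dots> = (\<Sum>\<alpha>\<in>BC_pos n. ?k \<alpha> * dot (map of_int \<alpha>) \<xi> / 2)"
    by (intro sum.cong refl)
       (simp add: dot_def length_BC_pos sum_distrib_left sum_divide_distrib mult.assoc)
  finally show ?thesis using assms by (simp add: sum_divide_distrib dot_def)
qed

lemma of_int_aff_refl:
  assumes "i \<le> length \<nu>"
  shows "map of_int (aff_refl i \<nu>) = (aff_refl i (map of_int \<nu>) :: 'a::comm_ring_1 list)"
  using assms
  by (intro nth_equalityI) (simp_all add: nth_aff_refl lin_refl_of_int[symmetric])

text \<open>
  Both factors change sign exactly for the roots made negative. For \<open>s\<^sub>0\<close> this uses that \<open>m\<close> and
  \<open>1 - m\<close> have opposite strict signs, and likewise \<open>m\<close> and \<open>2 - m\<close> for even \<open>m\<close>, which is the case of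
  \<open>2 e\<^sub>1\<close>.
\<close>

lemma dot_pos_refl_aff_refl:
  assumes "raises i \<nu>" "i \<le> n" "length \<nu> = n" "length \<xi> = n" and a: "\<alpha> \<in> BC_pos n"
  shows "sgn_strict (dot (pos_refl i \<alpha>) (aff_refl i \<nu>)) * dot (map of_int (pos_refl i \<alpha>)) \<xi>
       = sgn_strict (dot \<alpha> \<nu>) * dot (map of_int \<alpha>) (lin_refl i \<xi> :: real list)"
proof -
  define \<beta> where "\<beta> = pos_refl i \<alpha>"
  have l: "length \<alpha> = n" using a by (rule length_BC_pos)
  have n: "0 < n" using root_leading_pos[OF a] by auto
  have d: "dot (map of_int (lin_refl i \<alpha>)) \<xi> = dot (map of_int \<alpha>) (lin_refl i \<xi>)"
    using l assms(4) by (simp add: lin_refl_of_int dot_lin_refl)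
  show ?thesis
  proof (cases "lin_refl i \<alpha> \<in> BC_pos n")
    case True
    then have \<beta>: "\<beta> = lin_refl i \<alpha>" using l by (simp add: \<beta>_def pos_refl_def)
    have "\<beta> ! 0 = 0" if "i = 0"
      using flipped_0[OF a] True that n l by (simp add: \<beta> lin_refl_first)
    then have "dot \<beta> (aff_refl i \<nu>) = dot \<alpha> \<nu>"
      using assms l n by (simp add: dot_aff_refl \<beta>)
    then show ?thesis using d by (simp add: \<beta> flip: \<beta>_def)
  next
    case False
    then have \<beta>: "\<beta> = map uminus (lin_refl i \<alpha>)" using l by (simp add: \<beta>_def pos_refl_def)
    have lb: "length \<beta> = n" using l by (simp add: \<beta>)
    have "lin_refl i \<beta> = map uminus \<alpha>" by (simp add: \<beta> lin_refl_uminus)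
    then have e: "dot \<beta> (aff_refl i \<nu>) = - dot \<alpha> \<nu> + (if i = 0 then \<beta> ! 0 else 0)"
      using assms lb n by (simp add: dot_aff_refl dot_uminus)
    have "(map of_int \<beta> :: real list) = map uminus (map of_int (lin_refl i \<alpha>))" by (simp add: \<beta>)
    then have dm: "dot (map of_int \<beta>) \<xi> = - dot (map of_int \<alpha>) (lin_refl i \<xi>)"
      by (simp only: dot_uminus d)
    consider (zero) "i = 0" | (swap) "0 < i" "i < n" | (last) "i = n"
      using assms(2) by linarith
    then have "sgn_strict (dot \<beta> (aff_refl i \<nu>)) = - sgn_strict (dot \<alpha> \<nu>)"
    proof cases
      case zero
      have b0: "\<beta> ! 0 = \<alpha> ! 0" using zero l n by (simp add: \<beta> lin_refl_first)
      have a0: "\<alpha> ! 0 \<noteq> 0" using flipped_0[OF a] False zero by simp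
      have "\<alpha> ! 0 = 1 \<or> \<alpha> ! 0 = 2 \<and> even (dot \<alpha> \<nu>)"
        using a
      proof (cases rule: BC_pos_cases)
        case (long k)
        then show ?thesis using a0 n by (auto simp: nth_two_term dot_two_term_int split: if_splits)
      qed (use a0 n in \<open>auto simp: nth_two_term split: if_splits\<close>)
      then show ?thesis
        unfolding e b0 sgn_strict_def using zero by (auto elim!: evenE)
    next
      case swap
      have "\<alpha> = two_term n 1 (i - 1) (-1) i" using flipped_swap[OF swap] a False by blast
      then have "0 < dot \<alpha> \<nu>" using swap assms by (simp add: dot_two_term_int raises_def)
      then show ?thesis unfolding e sgn_strict_def using swap by simp
    next
      case last
      obtain m where "\<alpha> = two_term n m (n - 1) 0 (n - 1)" "m = 1 \<or> m = 2"
        using flipped_sign[OF n] a False last by blast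
      then have "0 < dot \<alpha> \<nu>" using last assms n by (auto simp: dot_two_term_int raises_def)
      then show ?thesis unfolding e sgn_strict_def using last n by simp
    qed
    then show ?thesis using dm by (simp flip: \<beta>_def)
  qed
qed

text \<open>
  Reindexing the positive roots by \<open>s\<^sub>i\<close> shows that the same affine action moves the index and its
  spectral vector.
\<close>

lemma dot_spectral_aff_refl:
  assumes "raises i \<nu>" "i \<le> n" "0 < n" "length \<nu> = n" "length \<xi> = n"
  shows "dot (spectral \<kappa> (aff_refl i \<nu>)) \<xi>
       = dot (spectral \<kappa> \<nu>) (lin_refl i \<xi>) + (if i = 0 then \<xi> ! 0 else 0)"
proof -
  let ?g = "\<lambda>\<beta>. BC_mult \<kappa> \<beta> * sgn_strict (dot \<beta> (aff_refl i \<nu>)) * dot (map of_int \<beta>) \<xi>"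
  have "dot (map of_int (aff_refl i \<nu>)) \<xi> = dot \<xi> (aff_refl i (map of_int \<nu>))"
    using assms by (simp add: of_int_aff_refl dot_commute)
  also have "\<dots> = dot (map of_int \<nu>) (lin_refl i \<xi>) + (if i = 0 then \<xi> ! 0 else 0)"
    using assms by (simp add: dot_aff_refl dot_commute)
  finally have 1: "dot (map of_int (aff_refl i \<nu>)) \<xi>
    = dot (map of_int \<nu>) (lin_refl i \<xi>) + (if i = 0 then \<xi> ! 0 else 0)" .
  have "(\<Sum>\<beta>\<in>BC_pos n. ?g \<beta>) = (\<Sum>\<alpha>\<in>BC_pos n. ?g (pos_refl i \<alpha>))"
    by (rule sum.reindex_bij_betw[OF bij_betw_pos_refl, symmetric])
  also have "\<dots> = (\<Sum>\<alpha>\<in>BC_pos n. BC_mult \<kappa> \<alpha> * sgn_strict (dot \<alpha> \<nu>) * dot (map of_int \<alpha>) (lin_refl i \<xi>))"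
  proof (rule sum.cong[OF refl])
    fix \<alpha> assume a: "\<alpha> \<in> BC_pos n"
    show "?g (pos_refl i \<alpha>) = BC_mult \<kappa> \<alpha> * sgn_strict (dot \<alpha> \<nu>) * dot (map of_int \<alpha>) (lin_refl i \<xi>)"
      unfolding mult.assoc BC_mult_pos_refl[OF a]
        dot_pos_refl_aff_refl[OF assms(1,2,4,5) a] ..
  qed
  finally have 2: "(\<Sum>\<beta>\<in>BC_pos n. ?g \<beta>) = \<dots>" .
  have l: "length (aff_refl i \<nu>) = n" "length (lin_refl i \<xi>) = n" using assms by simp_all
  show ?thesis
    unfolding dot_spectral[OF assms(5) l(1)] dot_spectral[OF l(2) assms(4)] 1 2 by simp
qed

text \<open>
  Each summand pairs \<open>sgn \<langle>\<alpha>, \<mu>\<rangle> - sgn \<langle>\<alpha>, \<nu>\<rangle>\<close> with \<open>\<langle>\<alpha>, \<mu>\<rangle> - \<langle>\<alpha>, \<nu>\<rangle>\<close>, and the sign is a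
  nondecreasing function.
\<close>

lemma spectral_monotone:
  assumes "length \<mu> = n" "length \<nu> = n" and \<kappa>: "0 \<le> k1" "0 \<le> k2" "0 \<le> k3"
  defines "d \<equiv> map2 (-) \<mu> \<nu>"
  shows "of_int (dot d d) \<le> dot (spectral (k1, k2, k3) \<mu>) (map of_int d)
                           - dot (spectral (k1, k2, k3) \<nu>) (map of_int d)"
proof -
  let ?\<kappa> = "(k1, k2, k3)"
  have ld: "length d = n" using assms by (simp add: d_def)
  have lrd: "length (map real_of_int d) = n" using ld by simp
  have dd: "dot (map of_int \<alpha>) (map of_int d) = real_of_int (dot \<alpha> \<mu> - dot \<alpha> \<nu>)"
    if "length \<alpha> = n" for \<alpha>
    using that assms by (simp add: dot_def d_def algebra_simps flip: sum_subtractf)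
  have first: "dot (map of_int \<mu>) (map of_int d) - dot (map of_int \<nu>) (map real_of_int d) = of_int (dot d d)"
    using assms by (simp add: dot_def d_def algebra_simps flip: sum_subtractf)
  let ?S = "\<lambda>\<nu>. \<Sum>\<alpha>\<in>BC_pos n. BC_mult ?\<kappa> \<alpha> * sgn_strict (dot \<alpha> \<nu>) * dot (map of_int \<alpha>) (map real_of_int d)"
  have "?S \<nu> \<le> ?S \<mu>"
  proof (rule sum_mono)
    fix \<alpha> assume a: "\<alpha> \<in> BC_pos n"
    have "sgn_strict (dot \<alpha> \<nu>) * real_of_int (dot \<alpha> \<mu> - dot \<alpha> \<nu>)
        \<le> sgn_strict (dot \<alpha> \<mu>) * real_of_int (dot \<alpha> \<mu> - dot \<alpha> \<nu>)"
      by (auto simp: sgn_strict_def)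
    then show "BC_mult ?\<kappa> \<alpha> * sgn_strict (dot \<alpha> \<nu>) * dot (map of_int \<alpha>) (map real_of_int d)
        \<le> BC_mult ?\<kappa> \<alpha> * sgn_strict (dot \<alpha> \<mu>) * dot (map of_int \<alpha>) (map real_of_int d)"
      unfolding dd[OF length_BC_pos[OF a]] mult.assoc
      by (rule mult_left_mono) (rule BC_mult_nonneg[OF \<kappa>])
  qed
  then show ?thesis
    unfolding dot_spectral[OF lrd assms(1)] dot_spectral[OF lrd assms(2)] using first by linarith
qed

lemma spectral_inj:
  assumes "length \<mu> = n" "length \<nu> = n" "0 \<le> k1" "0 \<le> k2" "0 \<le> k3"
    and eq: "\<And>\<xi>. length \<xi> = n \<Longrightarrow> dot (spectral (k1, k2, k3) \<mu>) \<xi> = dot (spectral (k1, k2, k3) \<nu>) \<xi>"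
  shows "\<mu> = \<nu>"
proof (rule nth_equalityI)
  let ?d = "map2 (-) \<mu> \<nu>"
  have "length (map real_of_int ?d) = n" using assms(1,2) by simp
  then have "real_of_int (dot ?d ?d) \<le> 0"
    using spectral_monotone[OF assms(1-5)] eq by (metis diff_self)
  then have "dot ?d ?d \<le> 0" by simp
  then have z: "(\<Sum>j<length ?d. ?d ! j * ?d ! j) = 0"
    using dot_self_nonneg[of ?d] unfolding dot_def by linarith
  fix j assume j: "j < length \<mu>"
  have "\<forall>j\<in>{..<length ?d}. ?d ! j * ?d ! j = 0"
    using z by (subst (asm) sum_nonneg_eq_0_iff) (simp_all del: nth_map length_map)
  then have "?d ! j * ?d ! j = 0" using j assms(1,2) by (auto simp del: nth_map)
  then show "\<mu> ! j = \<nu> ! j" using j assms(1,2) by simp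
qed (use assms in simp)

lemma dot_list_update:
  assumes "i < length x" "length \<xi> = length x"
  shows "dot x (\<xi>[i := a]) = dot x \<xi> + x ! i * (a - \<xi> ! i)"
proof -
  have "dot x (\<xi>[i := a]) = (\<Sum>j<length x. x ! j * \<xi> ! j + (if j = i then x ! i * (a - \<xi> ! i) else 0))"
    unfolding dot_def using assms by (intro sum.cong) (auto simp: nth_list_update algebra_simps)
  then show ?thesis using assms by (simp add: sum.distrib dot_def)
qed

lemma dot_lin_refl_swap:
  assumes "0 < p" "p < n" "length x = n" "length \<xi> = n"
  shows "dot x (lin_refl p \<xi>) = dot x \<xi> - (x ! (p - 1) - x ! p) * (\<xi> ! (p - 1) - \<xi> ! p)"
proof -
  have ne: "p - 1 \<noteq> p" using assms by simp
  have "lin_refl p \<xi> = \<xi>[p - 1 := \<xi> ! p, p := \<xi> ! (p - 1)]"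
    using assms aff_refl_eq_lin_refl[of p \<xi>] by (simp add: aff_refl_def swap_adj_def)
  then show ?thesis
    using assms ne by (simp add: dot_list_update algebra_simps)
qed

lemma dot_lin_refl_last:
  assumes "0 < n" "length x = n" "length \<xi> = n"
  shows "dot x (lin_refl n \<xi>) = dot x \<xi> - 2 * x ! (n - 1) * \<xi> ! (n - 1)"
  using assms lin_refl_last[of \<xi>] by (simp add: dot_list_update algebra_simps)

lemma dot_lin_refl_first:
  assumes "0 < n" "length x = n" "length \<xi> = n"
  shows "dot x (lin_refl 0 \<xi>) = dot x \<xi> - 2 * x ! 0 * \<xi> ! 0"
  using assms by (simp add: lin_refl_first dot_list_update algebra_simps)

text \<open>
  The scalar \<open>c\<close> that makes \<open>s\<^sub>i E\<^sub>\<nu> + c E\<^sub>\<nu>\<close> an eigenfunction.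
\<close>

definition raise_coeff :: "real \<times> real \<times> real \<Rightarrow> nat \<Rightarrow> int list \<Rightarrow> real" where
  "raise_coeff \<kappa> i \<nu> = (case \<kappa> of (k1, k2, k3) \<Rightarrow>
     let \<gamma> = spectral \<kappa> \<nu> in
     if i = 0 then k1 / (1 - 2 * \<gamma> ! 0)
     else if i < length \<nu> then k3 / (\<gamma> ! (i - 1) - \<gamma> ! i)
     else (k1 + 2 * k2) / (2 * \<gamma> ! (i - 1)))"

lemma raises_neq:
  assumes "raises i \<nu>" "i \<le> length \<nu>" "0 < length \<nu>"
  shows "aff_refl i \<nu> \<noteq> \<nu>"
  using raises_bruhat_step[OF assms] bruhat_trancl_irrefl[of \<nu>] by auto

text \<open>
  The defining equation of the scalar. The denominators do not vanish: otherwise \<open>s\<^sub>i\<close> would fix the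
  spectral vector of \<open>\<nu>\<close> and hence, by injectivity, \<open>\<nu>\<close> itself.
\<close>

lemma raise_coeff_eq:
  assumes "raises i \<nu>" "i \<le> n" "0 < n" "length \<nu> = n" "length \<xi> = n"
    and \<kappa>: "0 \<le> k1" "0 \<le> k2" "0 \<le> k3"
  defines "\<gamma> \<equiv> spectral (k1, k2, k3) \<nu>"
  shows "(dot \<gamma> (lin_refl i \<xi>) + (if i = 0 then \<xi> ! 0 else 0) - dot \<gamma> \<xi>) * raise_coeff (k1, k2, k3) i \<nu>
      = (if i = 0 then k1 * \<xi> ! 0
         else if i < n then - k3 * (\<xi> ! (i - 1) - \<xi> ! i)
         else - (k1 + 2 * k2) * \<xi> ! (n - 1))"
proof -
  have l\<gamma>: "length \<gamma> = n" using assms by (simp add: \<gamma>_def)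
  have "\<not> (\<forall>\<xi>. length \<xi> = n \<longrightarrow> dot \<gamma> (lin_refl i \<xi>) + (if i = 0 then \<xi> ! 0 else 0) = dot \<gamma> \<xi>)"
  proof
    assume *: "\<forall>\<xi>. length \<xi> = n \<longrightarrow> dot \<gamma> (lin_refl i \<xi>) + (if i = 0 then \<xi> ! 0 else 0) = dot \<gamma> \<xi>"
    have "aff_refl i \<nu> = \<nu>"
    proof (rule spectral_inj[of _ n _ k1 k2 k3])
      fix \<xi> :: "real list" assume l: "length \<xi> = n"
      show "dot (spectral (k1, k2, k3) (aff_refl i \<nu>)) \<xi> = dot (spectral (k1, k2, k3) \<nu>) \<xi>"
        unfolding dot_spectral_aff_refl[OF assms(1-4) l] using * l by (simp add: \<gamma>_def)
    qed (use assms in simp_all)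
    then show False using raises_neq[of i \<nu>] assms by simp
  qed
  then obtain \<zeta> where \<zeta>: "length \<zeta> = n"
    "dot \<gamma> (lin_refl i \<zeta>) + (if i = 0 then \<zeta> ! 0 else 0) \<noteq> dot \<gamma> \<zeta>"
    by blast
  consider (zero) "i = 0" | (swap) "0 < i" "i < n" | (last) "i = n" "0 < i"
    using assms(2,3) by linarith
  then show ?thesis
  proof cases
    case zero
    have "1 - 2 * \<gamma> ! 0 \<noteq> 0"
      using \<zeta> zero assms(3) l\<gamma> by (auto simp: dot_lin_refl_first algebra_simps)
    then show ?thesis using zero assms(3,5) l\<gamma>
      by (simp add: dot_lin_refl_first raise_coeff_def Let_def flip: \<gamma>_def) (simp add: field_simps)
  next
    case swap
    have "\<gamma> ! (i - 1) - \<gamma> ! i \<noteq> 0"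
      using \<zeta> swap l\<gamma> by (auto simp: dot_lin_refl_swap)
    then show ?thesis using swap assms(4,5) l\<gamma>
      by (simp add: dot_lin_refl_swap raise_coeff_def Let_def flip: \<gamma>_def)
  next
    case last
    have "\<gamma> ! (n - 1) \<noteq> 0"
      using \<zeta> last l\<gamma> by (auto simp: dot_lin_refl_last)
    then show ?thesis using last assms(4,5) l\<gamma>
      by (simp add: dot_lin_refl_last raise_coeff_def Let_def flip: \<gamma>_def)
         (simp add: algebra_simps)
  qed
qed

section \<open>Exponential sums\<close>

text \<open>
  Exponential sums are kept as coefficient functions, since reflections act on the indices and since the
  definition of \<open>E_BC\<close> compares functions on lists of every length, where a reflection of the
  variables and one of the indices need not agree.
\<close>

definition expsum :: "(int list \<Rightarrow> complex) \<Rightarrow> complex list \<Rightarrow> complex" where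
  "expsum c z = (\<Sum>\<mu> | c \<mu> \<noteq> 0. c \<mu> * expo \<mu> z)"

definition fin_coeffs :: "nat \<Rightarrow> (int list \<Rightarrow> complex) \<Rightarrow> bool" where
  "fin_coeffs n c \<longleftrightarrow> finite {\<mu>. c \<mu> \<noteq> 0} \<and> (\<forall>\<mu>. c \<mu> \<noteq> 0 \<longrightarrow> length \<mu> = n)"

lemma expsum_superset:
  assumes "finite A" "\<And>\<mu>. c \<mu> \<noteq> 0 \<Longrightarrow> \<mu> \<in> A"
  shows "expsum c z = (\<Sum>\<mu>\<in>A. c \<mu> * expo \<mu> z)"
  unfolding expsum_def using assms by (intro sum.mono_neutral_left) auto

lemma expsum_linear:
  assumes "fin_coeffs n c" "fin_coeffs n d"
  shows "expsum (\<lambda>\<mu>. c \<mu> + a * d \<mu>) z = expsum c z + a * expsum d z"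
    and "fin_coeffs n (\<lambda>\<mu>. c \<mu> + a * d \<mu>)"
proof -
  let ?A = "{\<mu>. c \<mu> \<noteq> 0} \<union> {\<mu>. d \<mu> \<noteq> 0}"
  have fin: "finite ?A" using assms by (simp add: fin_coeffs_def)
  have nz: "c \<mu> \<noteq> 0 \<or> d \<mu> \<noteq> 0" if "c \<mu> + a * d \<mu> \<noteq> 0" for \<mu> using that by auto
  have "expsum (\<lambda>\<mu>. c \<mu> + a * d \<mu>) z = (\<Sum>\<mu>\<in>?A. (c \<mu> + a * d \<mu>) * expo \<mu> z)"
    using fin nz by (intro expsum_superset) auto
  also have "\<dots> = (\<Sum>\<mu>\<in>?A. c \<mu> * expo \<mu> z) + a * (\<Sum>\<mu>\<in>?A. d \<mu> * expo \<mu> z)"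
    by (simp add: algebra_simps sum.distrib sum_distrib_left)
  also have "(\<Sum>\<mu>\<in>?A. c \<mu> * expo \<mu> z) = expsum c z"
    using fin by (intro expsum_superset[symmetric]) auto
  also have "(\<Sum>\<mu>\<in>?A. d \<mu> * expo \<mu> z) = expsum d z"
    using fin by (intro expsum_superset[symmetric]) auto
  finally show "expsum (\<lambda>\<mu>. c \<mu> + a * d \<mu>) z = expsum c z + a * expsum d z" .
  have "finite {\<mu>. c \<mu> + a * d \<mu> \<noteq> 0}"
    by (rule finite_subset[OF _ fin]) (use nz in auto)
  then show "fin_coeffs n (\<lambda>\<mu>. c \<mu> + a * d \<mu>)"
    using assms nz unfolding fin_coeffs_def by blast
qed

lemma fin_coeffs_zero: "fin_coeffs n (\<lambda>_. 0)"
  by (simp add: fin_coeffs_def)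

lemma expsum_zero [simp]: "expsum (\<lambda>_. 0) z = 0"
  by (simp add: expsum_def)

lemma expsum_sum:
  assumes "finite S" "\<And>\<nu>. \<nu> \<in> S \<Longrightarrow> fin_coeffs n (G \<nu>)"
  shows "expsum (\<lambda>\<mu>. \<Sum>\<nu>\<in>S. b \<nu> * G \<nu> \<mu>) z = (\<Sum>\<nu>\<in>S. b \<nu> * expsum (G \<nu>) z)
    \<and> fin_coeffs n (\<lambda>\<mu>. \<Sum>\<nu>\<in>S. b \<nu> * G \<nu> \<mu>)"
  using assms
proof (induction S rule: finite_induct)
  case empty
  then show ?case by (simp add: fin_coeffs_zero)
next
  case (insert \<nu> S)
  have IH: "expsum (\<lambda>\<mu>. \<Sum>\<nu>\<in>S. b \<nu> * G \<nu> \<mu>) z = (\<Sum>\<nu>\<in>S. b \<nu> * expsum (G \<nu>) z)"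
    "fin_coeffs n (\<lambda>\<mu>. \<Sum>\<nu>\<in>S. b \<nu> * G \<nu> \<mu>)"
    using insert.IH insert.prems by auto
  have G: "fin_coeffs n (G \<nu>)" using insert.prems by simp
  have e: "(\<lambda>\<mu>. \<Sum>\<nu>\<in>insert \<nu> S. b \<nu> * G \<nu> \<mu>) = (\<lambda>\<mu>. (\<Sum>\<nu>\<in>S. b \<nu> * G \<nu> \<mu>) + b \<nu> * G \<nu> \<mu>)"
    using insert.hyps by (simp add: add.commute)
  show ?case
    unfolding e using expsum_linear[OF IH(2) G, of "b \<nu>"] IH(1) insert.hyps
    by (simp add: add.commute)
qed

lemma expo_line_point:
  assumes "length \<mu> = n" "length z = n" "length \<xi> = n"
  shows "expo \<mu> (line_point z \<xi> t)
    = exp (dot (map of_int \<mu>) z + t * dot (map of_int \<mu>) (map of_real \<xi>))"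
proof -
  have "dot (map of_int \<mu>) (line_point z \<xi> t)
      = dot (map of_int \<mu>) z + t * dot (map of_int \<mu>) (map of_real \<xi>)"
    using assms by (simp add: dot_def line_point_def sum.distrib sum_distrib_left algebra_simps)
  then show ?thesis by (simp add: expo_def)
qed

lemma expsum_differentiable:
  assumes "fin_coeffs n c" "length z = n" "length \<xi> = n"
  shows "(\<lambda>t. expsum c (line_point z \<xi> t)) field_differentiable at t0"
proof -
  have "(\<lambda>t. c \<mu> * expo \<mu> (line_point z \<xi> t)) field_differentiable at t0" if "c \<mu> \<noteq> 0" for \<mu>
  proof -
    have l: "length \<mu> = n" using assms that by (simp add: fin_coeffs_def)
    have "((\<lambda>t. C * exp (a + t * b)) has_field_derivative C * (exp (a + t0 * b) * b)) (at t0)"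
      for a b C :: complex
      by (auto intro!: derivative_eq_intros)
    then show ?thesis
      unfolding expo_line_point[OF l assms(2,3)] field_differentiable_def by blast
  qed
  then show ?thesis unfolding expsum_def by (intro field_differentiable_sum) auto
qed

text \<open>
  The action of \<open>s\<^sub>i\<close> on functions that sends \<open>expo \<nu>\<close> to \<open>expo (s\<^sub>i \<nu>)\<close>.
\<close>

definition simple_act :: "nat \<Rightarrow> (complex list \<Rightarrow> complex) \<Rightarrow> complex list \<Rightarrow> complex" where
  "simple_act i f z = (if i = 0 then exp (z ! 0) else 1) * f (lin_refl i z)"

lemma expo_aff_refl:
  assumes "i \<le> n" "0 < n" "length \<nu> = n" "length z = n"
  shows "expo (aff_refl i \<nu>) z = simple_act i (expo \<nu>) z"
proof -
  have "dot (map of_int (aff_refl i \<nu>)) z = dot z (aff_refl i (map of_int \<nu>))"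
    using assms by (simp add: of_int_aff_refl dot_commute)
  also have "\<dots> = dot (map of_int \<nu>) (lin_refl i z) + (if i = 0 then z ! 0 else 0)"
    using assms by (simp add: dot_aff_refl dot_commute)
  finally show ?thesis
    by (simp add: expo_def simple_act_def exp_add)
qed

lemma expsum_aff_refl:
  assumes "fin_coeffs n c" "i \<le> n" "0 < n"
  shows "length z = n \<Longrightarrow> expsum (\<lambda>\<mu>. c (aff_refl i \<mu>)) z = simple_act i (expsum c) z"
    and "fin_coeffs n (\<lambda>\<mu>. c (aff_refl i \<mu>))"
proof -
  let ?A = "{\<mu>. c \<mu> \<noteq> 0}"
  have fin: "finite ?A" and len: "\<And>\<mu>. \<mu> \<in> ?A \<Longrightarrow> length \<mu> = n"
    using assms by (auto simp: fin_coeffs_def)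
  have inv: "aff_refl i (aff_refl i \<mu>) = \<mu>" if "length \<mu> = n" for \<mu> :: "int list"
    using that assms by (simp add: aff_refl_aff_refl)
  have supp: "length \<mu> = n \<and> \<mu> \<in> aff_refl i ` ?A" if "c (aff_refl i \<mu>) \<noteq> 0" for \<mu>
  proof -
    have "length (aff_refl i \<mu>) = n" using that len by blast
    then have l: "length \<mu> = n" by simp
    then show ?thesis using inv[OF l] that by (metis (mono_tags) imageI mem_Collect_eq)
  qed
  have inj: "inj_on (aff_refl i) ?A"
    using inv[OF len] by (rule inj_on_inverseI)
  have "finite {\<mu>. c (aff_refl i \<mu>) \<noteq> 0}"
    by (rule finite_subset[OF _ finite_imageI[OF fin, of "aff_refl i"]]) (use supp in blast)
  then show "fin_coeffs n (\<lambda>\<mu>. c (aff_refl i \<mu>))"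
    unfolding fin_coeffs_def using supp by blast
  assume z: "length z = n"
  have "expsum (\<lambda>\<mu>. c (aff_refl i \<mu>)) z = (\<Sum>\<mu>\<in>aff_refl i ` ?A. c (aff_refl i \<mu>) * expo \<mu> z)"
    using fin supp by (intro expsum_superset) blast+
  also have "\<dots> = (\<Sum>\<nu>\<in>?A. c (aff_refl i (aff_refl i \<nu>)) * expo (aff_refl i \<nu>) z)"
    by (simp add: sum.reindex[OF inj])
  also have "\<dots> = (\<Sum>\<nu>\<in>?A. c \<nu> * simple_act i (expo \<nu>) z)"
    by (intro sum.cong refl) (simp only: inv[OF len] expo_aff_refl[OF assms(2,3) len z])
  also have "\<dots> = simple_act i (expsum c) z"
    by (simp add: simple_act_def expsum_def sum_distrib_left algebra_simps)
  finally show "expsum (\<lambda>\<mu>. c (aff_refl i \<mu>)) z = simple_act i (expsum c) z" .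
qed

subsection \<open>Cherednik operators on functions\<close>

lemma length_line_point: "length z = n \<Longrightarrow> length \<xi> = n \<Longrightarrow> length (line_point z \<xi> t) = n"
  by (simp add: line_point_def)

lemma cherednik_cong:
  assumes "\<And>w. length w = n \<Longrightarrow> f w = g w" "length z = n" "length \<xi> = n"
  shows "cherednik \<kappa> \<xi> f z = cherednik \<kappa> \<xi> g z"
proof -
  have "(\<lambda>t. f (line_point z \<xi> t)) = (\<lambda>t. g (line_point z \<xi> t))"
    using assms by (intro ext) (simp add: length_line_point)
  moreover have "root_term \<alpha> f z = root_term \<alpha> g z" if "\<alpha> \<in> BC_pos n" for \<alpha>
    unfolding root_term_def using assms(1)[of z] assms(1)[of "root_refl \<alpha> z"] assms(2)
      length_BC_pos[OF that] by simp
  ultimately show ?thesis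
    unfolding cherednik_eq[OF assms(3)] by (intro arg_cong2[of _ _ _ _ plus] sum.cong) simp_all
qed

lemma cherednik_linear:
  assumes "length \<xi> = n"
    and "(\<lambda>t. f (line_point z \<xi> t)) field_differentiable at 0"
    and "(\<lambda>t. g (line_point z \<xi> t)) field_differentiable at 0"
  shows "cherednik \<kappa> \<xi> (\<lambda>w. f w + a * g w) z = cherednik \<kappa> \<xi> f z + a * cherednik \<kappa> \<xi> g z"
proof -
  have "deriv (\<lambda>t. f (line_point z \<xi> t) + a * g (line_point z \<xi> t)) 0
      = deriv (\<lambda>t. f (line_point z \<xi> t)) 0 + a * deriv (\<lambda>t. g (line_point z \<xi> t)) 0"
    using assms(2,3)[THEN field_differentiable_derivI]
    by (intro DERIV_imp_deriv derivative_eq_intros) auto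
  moreover have "root_term \<alpha> (\<lambda>w. f w + a * g w) z = root_term \<alpha> f z + a * root_term \<alpha> g z" for \<alpha>
    by (simp add: root_term_def add_divide_distrib diff_divide_distrib algebra_simps)
  ultimately show ?thesis
    unfolding cherednik_eq[OF assms(1)]
    by (simp add: algebra_simps sum.distrib sum_distrib_left)
qed

lemma cherednik_expsum_sum:
  assumes "finite S" "\<And>\<nu>. \<nu> \<in> S \<Longrightarrow> fin_coeffs n (G \<nu>)" "length z = n" "length \<xi> = n"
  shows "cherednik \<kappa> \<xi> (expsum (\<lambda>\<mu>. \<Sum>\<nu>\<in>S. b \<nu> * G \<nu> \<mu>)) z
    = (\<Sum>\<nu>\<in>S. b \<nu> * cherednik \<kappa> \<xi> (expsum (G \<nu>)) z)"
  using assms(1,2)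
proof (induction S rule: finite_induct)
  case empty
  show ?case
    unfolding cherednik_eq[OF assms(4)] by (simp add: root_term_def)
next
  case (insert \<nu> S)
  let ?C = "\<lambda>\<mu>. \<Sum>\<nu>\<in>S. b \<nu> * G \<nu> \<mu>"
  have C: "fin_coeffs n ?C" using expsum_sum[of S n G] insert by auto
  have G: "fin_coeffs n (G \<nu>)" using insert.prems by simp
  have e: "expsum (\<lambda>\<mu>. \<Sum>\<nu>\<in>insert \<nu> S. b \<nu> * G \<nu> \<mu>) = (\<lambda>w. expsum ?C w + b \<nu> * expsum (G \<nu>) w)"
    unfolding expsum_linear(1)[OF C G, symmetric] using insert.hyps by (simp add: add.commute)
  have "cherednik \<kappa> \<xi> (expsum (\<lambda>\<mu>. \<Sum>\<nu>\<in>insert \<nu> S. b \<nu> * G \<nu> \<mu>)) z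
     = cherednik \<kappa> \<xi> (expsum ?C) z + b \<nu> * cherednik \<kappa> \<xi> (expsum (G \<nu>)) z"
    unfolding e using C G assms(3,4) by (intro cherednik_linear) (auto intro: expsum_differentiable)
  then show ?case using insert by (simp add: add.commute)
qed

definition spectral_eigenfunction ::
  "real \<times> real \<times> real \<Rightarrow> int list \<Rightarrow> (complex list \<Rightarrow> complex) \<Rightarrow> bool" where
  "spectral_eigenfunction \<kappa> \<nu> f \<longleftrightarrow> (\<forall>\<xi>. length \<xi> = length \<nu> \<longrightarrow>
     (\<forall>z\<in>regular_points (length \<nu>). cherednik \<kappa> \<xi> f z = of_real (dot (spectral \<kappa> \<nu>) \<xi>) * f z))"

lemma spectral_eigenfunctionD:
  assumes "spectral_eigenfunction \<kappa> \<nu> f" "length \<nu> = n" "length \<xi> = n" "z \<in> regular_points n"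
  shows "cherednik \<kappa> \<xi> f z = of_real (dot (spectral \<kappa> \<nu>) \<xi>) * f z"
  using assms(1,3,4) unfolding spectral_eigenfunction_def assms(2) by simp

text \<open>
  On the span of \<open>f\<close> and \<open>s\<^sub>i f\<close> the operator \<open>D\<^sub>\<xi>\<close> is triangular: \<open>f\<close> is an eigenfunction, and \<open>s\<^sub>i f\<close>
  is one modulo \<open>f\<close>. The scalar \<open>C\<close> diagonalises it.
\<close>

lemma spectral_eigenfunction_raise:
  assumes f: "spectral_eigenfunction (k1, k2, k3) \<nu> (expsum c)" and c: "fin_coeffs n c"
    and i: "raises i \<nu>" "i \<le> n" "0 < n" and l: "length \<nu> = n"
    and \<kappa>: "0 \<le> k1" "0 \<le> k2" "0 \<le> k3"
  defines "C \<equiv> complex_of_real (raise_coeff (k1, k2, k3) i \<nu>)"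
  shows "spectral_eigenfunction (k1, k2, k3) (aff_refl i \<nu>) (expsum (\<lambda>\<mu>. c (aff_refl i \<mu>) + C * c \<mu>))"
  unfolding spectral_eigenfunction_def
proof (intro allI impI ballI)
  let ?\<kappa> = "(k1, k2, k3)" and ?f = "expsum c" and ?\<gamma> = "spectral (k1, k2, k3) \<nu>"
  let ?s = "\<lambda>\<mu>. c (aff_refl i \<mu>)"
  fix \<xi> :: "real list" and z
  assume "length \<xi> = length (aff_refl i \<nu>)" "z \<in> regular_points (length (aff_refl i \<nu>))"
  then have \<xi>: "length \<xi> = n" and z: "z \<in> regular_points n" using l by auto
  have lz: "length z = n" using z by (rule regular_points_length)
  have s: "fin_coeffs n ?s" using expsum_aff_refl(2)[OF c i(2,3)] .
  let ?g = "simple_act i ?f"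
  have g: "expsum ?s w = ?g w" if "length w = n" for w
    using expsum_aff_refl(1)[OF c i(2,3) that] .
  define r where "r = (if i = 0 then k1 * \<xi> ! 0
         else if i < n then - k3 * (\<xi> ! (i - 1) - \<xi> ! i) else - (k1 + 2 * k2) * \<xi> ! (n - 1))"
  define e where "e = dot ?\<gamma> (lin_refl i \<xi>) + (if i = 0 then \<xi> ! 0 else 0)"
  have lin: "length (lin_refl i \<xi>) = n" "lin_refl i z \<in> regular_points n"
    using \<xi> z by (auto intro: lin_refl_regular)
  have fl: "cherednik ?\<kappa> (lin_refl i \<xi>) ?f (lin_refl i z)
      = of_real (dot ?\<gamma> (lin_refl i \<xi>)) * ?f (lin_refl i z)"
    by (rule spectral_eigenfunctionD[OF f l lin])
  have fz: "cherednik ?\<kappa> \<xi> ?f z = of_real (dot ?\<gamma> \<xi>) * ?f z"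
    by (rule spectral_eigenfunctionD[OF f l \<xi> z])
  have act: "cherednik ?\<kappa> \<xi> ?g z = of_real e * ?g z + of_real r * ?f z"
  proof -
    consider (zero) "i = 0" | (swap) "0 < i" "i < n" | (last) "i = n" "0 < i"
      using i by linarith
    then show ?thesis
    proof cases
      case zero
      have d: "(\<lambda>t. ?f (line_point (lin_refl 0 z) (lin_refl 0 \<xi>) t)) field_differentiable at 0"
        using c lz \<xi> by (intro expsum_differentiable) simp_all
      have "?g = (\<lambda>w. exp (w ! 0) * ?f (lin_refl 0 w))" by (simp add: simple_act_def zero fun_eq_iff)
      then show ?thesis
        using cherednik_affine[OF z \<xi> i(3) d, of k1 k2 k3] fl zero
        by (simp add: e_def r_def algebra_simps)
    next
      case swap
      have "?g = (\<lambda>w. ?f (lin_refl i w))" using swap by (simp add: simple_act_def fun_eq_iff)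
      then show ?thesis
        using cherednik_swap[OF z \<xi> swap, of k1 k2 k3 ?f] fl swap
        by (simp add: e_def r_def algebra_simps)
    next
      case last
      have "?g = (\<lambda>w. ?f (lin_refl n w))" using last by (simp add: simple_act_def fun_eq_iff)
      then show ?thesis
        using cherednik_sign[OF z \<xi> i(3), of k1 k2 k3 ?f] fl last
        by (simp add: e_def r_def algebra_simps)
    qed
  qed
  have "(e - dot ?\<gamma> \<xi>) * raise_coeff ?\<kappa> i \<nu> = r"
    unfolding e_def r_def by (rule raise_coeff_eq[OF i l \<xi> \<kappa>])
  then have C: "of_real r = (of_real e - of_real (dot ?\<gamma> \<xi>)) * C"
    unfolding C_def by (metis of_real_diff of_real_mult)
  have lin_f: "expsum (\<lambda>\<mu>. ?s \<mu> + C * c \<mu>) = (\<lambda>w. expsum ?s w + C * ?f w)"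
    using expsum_linear(1)[OF s c] by (intro ext)
  have "cherednik ?\<kappa> \<xi> (expsum (\<lambda>\<mu>. ?s \<mu> + C * c \<mu>)) z
      = cherednik ?\<kappa> \<xi> (expsum ?s) z + C * cherednik ?\<kappa> \<xi> ?f z"
    unfolding lin_f using s c lz \<xi> by (intro cherednik_linear) (auto intro: expsum_differentiable)
  also have "cherednik ?\<kappa> \<xi> (expsum ?s) z = cherednik ?\<kappa> \<xi> ?g z"
    using g lz \<xi> by (rule cherednik_cong)
  finally have "cherednik ?\<kappa> \<xi> (expsum (\<lambda>\<mu>. ?s \<mu> + C * c \<mu>)) z
      = of_real e * (expsum ?s z + C * ?f z)"
    unfolding act fz g[OF lz] C by (simp add: algebra_simps)
  moreover have "dot (spectral ?\<kappa> (aff_refl i \<nu>)) \<xi> = e"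
    unfolding e_def by (rule dot_spectral_aff_refl[OF i l \<xi>])
  ultimately show "cherednik ?\<kappa> \<xi> (expsum (\<lambda>\<mu>. ?s \<mu> + C * c \<mu>)) z
      = of_real (dot (spectral ?\<kappa> (aff_refl i \<nu>)) \<xi>) * expsum (\<lambda>\<mu>. ?s \<mu> + C * c \<mu>) z"
    by (simp add: lin_f)
qed

section \<open>Linear independence of exponentials\<close>

lemma poly_Poly_eq_sum: "poly (Poly as) (x :: real) = (\<Sum>j<length as. as ! j * x ^ j)"
  by (induction as)
     (simp_all add: sum.lessThan_Suc_shift sum_distrib_left algebra_simps del: sum.lessThan_Suc)

text \<open>
  For \<open>v = (1, x, x\<^sup>2, \<dots>)\<close> the pairing with \<open>d\<close> is the value at \<open>x\<close> of a nonzero polynomial, so all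
  but finitely many \<open>x\<close> will do.
\<close>

lemma generic_direction:
  assumes "finite F" "\<And>d. d \<in> F \<Longrightarrow> length d = n \<and> d \<noteq> replicate n 0"
  shows "\<exists>v. length v = n \<and> (\<forall>d\<in>F. dot (map real_of_int d) v \<noteq> 0)"
proof -
  let ?p = "\<lambda>d. Poly (map real_of_int d)"
  have "?p d \<noteq> 0" if d: "d \<in> F" for d
  proof
    assume "?p d = 0"
    then obtain m where m: "map real_of_int d = replicate m 0" unfolding Poly_eq_0 by blast
    then have "length d = m" by (metis length_map length_replicate)
    moreover have "d ! j = 0" if "j < length d" for j
    proof -
      have "map real_of_int d ! j = 0" using m that \<open>length d = m\<close> by simp
      then show ?thesis using that by simp
    qed
    ultimately have "d = replicate (length d) 0" by (intro nth_equalityI) auto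
    then show False using assms(2)[OF d] by simp
  qed
  then have "finite (\<Union>d\<in>F. {x. poly (?p d) x = 0})"
    using assms(1) by (intro finite_UN_I poly_roots_finite) auto
  then obtain x where "x \<notin> (\<Union>d\<in>F. {x. poly (?p d) x = 0})"
    using ex_new_if_finite[OF infinite_UNIV_char_0] by blast
  then have x: "poly (?p d) x \<noteq> 0" if "d \<in> F" for d using that by blast
  have "dot (map real_of_int d) (map (\<lambda>j. x ^ j) [0..<n]) = poly (?p d) x" if "d \<in> F" for d
    using assms(2)[OF that] by (simp add: dot_def poly_Poly_eq_sum)
  then show ?thesis using x by (intro exI[of _ "map (\<lambda>j. x ^ j) [0..<n]"]) simp
qed

text \<open>
  Restrict to a generic real ray. It consists of regular points, and on it the exponents are
  distinct real numbers, so the coefficient with the largest exponent is the limit of the suitably normalised sum.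
\<close>

lemma expsum_eq_zero:
  assumes c: "fin_coeffs n c" and zero: "\<And>z. z \<in> regular_points n \<Longrightarrow> expsum c z = 0"
  shows "c \<mu> = 0"
proof (rule ccontr)
  assume "c \<mu> \<noteq> 0"
  define A where "A = {\<mu>. c \<mu> \<noteq> 0}"
  have A: "finite A" "A \<noteq> {}" "\<And>\<mu>. \<mu> \<in> A \<Longrightarrow> length \<mu> = n"
    using c \<open>c \<mu> \<noteq> 0\<close> by (auto simp: fin_coeffs_def A_def)
  \<comment> \<open>A direction on which no difference of exponents vanishes separates the exponents; one on which no root vanishes gives regular points.\<close>
  define D where "D = (\<lambda>(\<mu>, \<nu>). map2 (-) \<mu> \<nu>) ` {(\<mu>, \<nu>) \<in> A \<times> A. \<mu> \<noteq> \<nu>}"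
  have D: "map2 (-) \<mu> \<nu> \<in> D" if "\<mu> \<in> A" "\<nu> \<in> A" "\<mu> \<noteq> \<nu>" for \<mu> \<nu>
    unfolding D_def using that by (intro image_eqI[of _ _ "(\<mu>, \<nu>)"]) auto
  have "\<exists>v. length v = n \<and> (\<forall>d\<in>D \<union> BC_pos n. dot (map real_of_int d) v \<noteq> 0)"
  proof (rule generic_direction)
    have "finite {(\<mu>, \<nu>) \<in> A \<times> A. \<mu> \<noteq> \<nu>}"
      by (rule finite_subset[OF _ finite_cartesian_product[OF A(1) A(1)]]) blast
    then show "finite (D \<union> BC_pos n)" unfolding D_def by simp
    fix d assume "d \<in> D \<union> BC_pos n"
    then show "length d = n \<and> d \<noteq> replicate n 0"
    proof
      assume "d \<in> D"
      then obtain \<mu> \<nu> where d: "d = map2 (-) \<mu> \<nu>" "\<mu> \<in> A" "\<nu> \<in> A" "\<mu> \<noteq> \<nu>"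
        by (auto simp: D_def)
      then obtain j where "j < n" "\<mu> ! j \<noteq> \<nu> ! j"
        using A(3) by (metis nth_equalityI)
      moreover have ld: "length d = n" using d A(3) by simp
      ultimately have "d ! j \<noteq> 0" using d A(3) by simp
      then have "d \<noteq> replicate n 0" using \<open>j < n\<close> by (metis nth_replicate)
      with ld show ?thesis by blast
    next
      assume "d \<in> BC_pos n"
      then show ?thesis
        using length_BC_pos[of d n] root_leading_pos[of d n] by (metis less_irrefl nth_replicate)
    qed
  qed
  then obtain v where v: "length v = n" "\<And>d. d \<in> D \<Longrightarrow> dot (map real_of_int d) v \<noteq> 0"
      "\<And>\<alpha>. \<alpha> \<in> BC_pos n \<Longrightarrow> dot (map real_of_int \<alpha>) v \<noteq> 0"
    by blast
  define h where "h \<mu> = dot (map real_of_int \<mu>) v" for \<mu>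
  have inj: "h \<mu> \<noteq> h \<nu>" if "\<mu> \<in> A" "\<nu> \<in> A" "\<mu> \<noteq> \<nu>" for \<mu> \<nu>
  proof -
    have "dot (map real_of_int (map2 (-) \<mu> \<nu>)) v = h \<mu> - h \<nu>"
      using A(3)[OF that(1)] A(3)[OF that(2)]
      by (simp add: h_def dot_def algebra_simps flip: sum_subtractf)
    then show ?thesis using v(2)[OF D[OF that]] by auto
  qed
  have "Max (h ` A) \<in> h ` A" using A(1,2) by (intro Max_in) simp_all
  then obtain m where m: "m \<in> A" "h m = Max (h ` A)" by (metis imageE)
  have hm: "h \<mu> \<le> h m" if "\<mu> \<in> A" for \<mu>
    unfolding m(2) using A(1) that by (intro Max_ge) simp_all
  define Z where "Z t = map (\<lambda>a. complex_of_real (t * a)) v" for t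
  have expoZ: "expo \<mu> (Z t) = of_real (exp (t * h \<mu>))" if "length \<mu> = n" for \<mu> t
  proof -
    have "dot (map of_int \<mu>) (Z t) = complex_of_real (t * h \<mu>)"
      using that v(1) by (simp add: dot_def Z_def h_def sum_distrib_left algebra_simps)
    then show ?thesis by (simp add: expo_def flip: exp_of_real)
  qed
  have reg: "Z t \<in> regular_points n" if "0 < t" for t
  proof -
    have "expo (map uminus \<alpha>) (Z t) \<noteq> 1" if a: "\<alpha> \<in> BC_pos n" for \<alpha>
    proof -
      have "expo \<alpha> (Z t) \<noteq> 1"
        using expoZ[OF length_BC_pos[OF a], of t] v(3)[OF a] \<open>0 < t\<close> by (simp add: h_def)
      then show ?thesis by (simp add: expo_uminus)
    qed
    then show ?thesis using v(1) by (simp add: regular_points_def Z_def)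
  qed
  have "((\<lambda>t. \<Sum>\<mu>\<in>A. c \<mu> * of_real (exp (t * (h \<mu> - h m)))) \<longlongrightarrow>
      (\<Sum>\<mu>\<in>A. if \<mu> = m then c \<mu> else 0)) at_top"
  proof (rule tendsto_sum)
    fix \<mu> assume \<mu>: "\<mu> \<in> A"
    show "((\<lambda>t. c \<mu> * of_real (exp (t * (h \<mu> - h m)))) \<longlongrightarrow> (if \<mu> = m then c \<mu> else 0)) at_top"
    proof (cases "\<mu> = m")
      case False
      then have neg: "h \<mu> - h m < 0" using inj[OF \<mu> m(1)] hm[OF \<mu>] by simp
      have "filterlim (\<lambda>t. t * (h \<mu> - h m)) at_bot at_top"
        using filterlim_tendsto_neg_mult_at_bot[OF tendsto_const neg filterlim_ident]
        by (simp add: mult.commute)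
      then have "((\<lambda>t. exp (t * (h \<mu> - h m))) \<longlongrightarrow> 0) at_top"
        by (rule filterlim_compose[OF exp_at_bot])
      then have "((\<lambda>t. c \<mu> * of_real (exp (t * (h \<mu> - h m)))) \<longlongrightarrow> c \<mu> * of_real 0) at_top"
        by (intro tendsto_intros)
      then show ?thesis using False by simp
    qed simp
  qed
  moreover have "eventually (\<lambda>t. (\<Sum>\<mu>\<in>A. c \<mu> * of_real (exp (t * (h \<mu> - h m)))) = 0) at_top"
    using eventually_gt_at_top[of 0]
  proof eventually_elim
    case (elim t)
    have "(\<Sum>\<mu>\<in>A. c \<mu> * of_real (exp (t * (h \<mu> - h m)))) = of_real (exp (- (t * h m))) * expsum c (Z t)"
      unfolding expsum_def A_def[symmetric] sum_distrib_left
    proof (rule sum.cong[OF refl])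
      fix \<mu> assume "\<mu> \<in> A"
      have e: "exp (t * (h \<mu> - h m)) = exp (- (t * h m)) * exp (t * h \<mu>)"
        by (simp add: algebra_simps flip: exp_add)
      show "c \<mu> * of_real (exp (t * (h \<mu> - h m))) = of_real (exp (- (t * h m))) * (c \<mu> * expo \<mu> (Z t))"
        unfolding e expoZ[OF A(3)[OF \<open>\<mu> \<in> A\<close>]] by simp
    qed
    then show ?case using zero[OF reg[OF elim]] by simp
  qed
  ultimately have "((\<lambda>_. 0) \<longlongrightarrow> (\<Sum>\<mu>\<in>A. if \<mu> = m then c \<mu> else 0)) (at_top :: real filter)"
    by (rule Lim_transform_eventually)
  then have "(\<Sum>\<mu>\<in>A. if \<mu> = m then c \<mu> else 0) = 0"
    by (simp add: tendsto_const_iff)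
  then have "c m = 0" using A(1) m(1) by simp
  then show False using m(1) by (simp add: A_def)
qed

section \<open>Existence and uniqueness of the non-symmetric polynomials\<close>

text \<open>
  The coefficients of the polynomial with index \<open>\<nu>\<close>, supported on the lower set of the Bruhat order.
  Eventually these are the coefficients of \<open>E_BC \<kappa> \<nu>\<close>.
\<close>

definition bc_expansion :: "real \<times> real \<times> real \<Rightarrow> int list \<Rightarrow> (int list \<Rightarrow> complex) \<Rightarrow> bool" where
  "bc_expansion \<kappa> \<nu> c \<longleftrightarrow> fin_coeffs (length \<nu>) c \<and> c \<nu> = 1 \<and>
     (\<forall>\<mu>. c \<mu> \<noteq> 0 \<longrightarrow> bruhat_step\<^sup>*\<^sup>* \<mu> \<nu>) \<and> spectral_eigenfunction \<kappa> \<nu> (expsum c)"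

text \<open>
  The support condition is the lifting property. The coefficient at \<open>s\<^sub>i \<nu>\<close> remains \<open>1\<close>, since \<open>s\<^sub>i \<nu>\<close>
  is not below \<open>\<nu>\<close>.
\<close>

lemma bc_expansion_raise:
  assumes c: "bc_expansion (k1, k2, k3) \<nu> c" and i: "raises i \<nu>" "i \<le> length \<nu>" "0 < length \<nu>"
    and \<kappa>: "0 \<le> k1" "0 \<le> k2" "0 \<le> k3"
  shows "bc_expansion (k1, k2, k3) (aff_refl i \<nu>)
    (\<lambda>\<mu>. c (aff_refl i \<mu>) + of_real (raise_coeff (k1, k2, k3) i \<nu>) * c \<mu>)"
proof -
  let ?d = "\<lambda>\<mu>. c (aff_refl i \<mu>) + of_real (raise_coeff (k1, k2, k3) i \<nu>) * c \<mu>"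
  have fc: "fin_coeffs (length \<nu>) c" and c1: "c \<nu> = 1"
    and low: "\<And>\<mu>. c \<mu> \<noteq> 0 \<Longrightarrow> bruhat_step\<^sup>*\<^sup>* \<mu> \<nu>" and eig: "spectral_eigenfunction (k1, k2, k3) \<nu> (expsum c)"
    using c by (auto simp: bc_expansion_def)
  have inv: "aff_refl i (aff_refl i \<nu>) = \<nu>" using i(2) by (rule aff_refl_aff_refl)
  have st: "bruhat_step \<nu> (aff_refl i \<nu>)" using i by (rule raises_bruhat_step)
  have c0: "c (aff_refl i \<nu>) = 0"
  proof (rule ccontr)
    assume "c (aff_refl i \<nu>) \<noteq> 0"
    then have "bruhat_step\<^sup>+\<^sup>+ \<nu> \<nu>" using low st by (metis rtranclp_into_tranclp2)
    then show False using bruhat_trancl_irrefl by blast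
  qed
  have "fin_coeffs (length (aff_refl i \<nu>)) ?d"
    using expsum_linear(2)[OF expsum_aff_refl(2)[OF fc i(2,3)] fc] by simp
  moreover have "?d (aff_refl i \<nu>) = 1" using inv c0 c1 by simp
  moreover have "bruhat_step\<^sup>*\<^sup>* \<mu> (aff_refl i \<nu>)" if d: "?d \<mu> \<noteq> 0" for \<mu>
  proof (cases "c \<mu> = 0")
    case True
    then have nz: "c (aff_refl i \<mu>) \<noteq> 0" using d by auto
    then have "length \<mu> = length \<nu>" using fc by (auto simp: fin_coeffs_def)
    then have "aff_refl i (aff_refl i \<mu>) = \<mu>" using i(2) by (simp add: aff_refl_aff_refl)
    then show ?thesis using bruhat_lifting[OF low[OF nz] i] by simp
  next
    case False
    then show ?thesis using low st by (metis rtranclp.rtrancl_into_rtrancl)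
  qed
  moreover have "spectral_eigenfunction (k1, k2, k3) (aff_refl i \<nu>) (expsum ?d)"
    by (rule spectral_eigenfunction_raise[OF eig fc i refl \<kappa>])
  ultimately show ?thesis unfolding bc_expansion_def by blast
qed

lemma expo_zero: "expo (replicate n 0) z = 1"
  by (simp add: expo_def dot_def)

lemma expsum_single: "expsum (\<lambda>\<mu>. if \<mu> = \<rho> then 1 else 0) z = expo \<rho> z"
  by (simp add: expsum_def)

lemma bc_expansion_zero:
  "bc_expansion \<kappa> (replicate n 0) (\<lambda>\<mu>. if \<mu> = replicate n 0 then 1 else 0)"
proof -
  let ?c = "\<lambda>\<mu> :: int list. if \<mu> = replicate n 0 then 1 else 0 :: complex"
  have e: "expsum ?c = (\<lambda>z. 1)"
    by (intro ext) (simp only: expsum_single expo_zero)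
  have "cherednik \<kappa> \<xi> (\<lambda>z. 1) z = of_real (dot (spectral \<kappa> (replicate n 0)) \<xi>)"
    if \<xi>: "length \<xi> = n" for \<xi> z
  proof -
    have d: "dot \<alpha> (replicate n 0) = (0 :: int)" if "\<alpha> \<in> BC_pos n" for \<alpha>
      using length_BC_pos[OF that] by (simp add: dot_def)
    have d0: "dot (map of_int (replicate n 0)) \<xi> = (0 :: real)" by (simp add: dot_def)
    have l: "length (replicate n (0 :: int)) = n" by simp
    have s: "(\<Sum>\<alpha>\<in>BC_pos n. BC_mult \<kappa> \<alpha> * sgn_strict (dot \<alpha> (replicate n 0)) * dot (map of_int \<alpha>) \<xi>)
      = (\<Sum>\<alpha>\<in>BC_pos n. - (BC_mult \<kappa> \<alpha> * dot (map of_int \<alpha>) \<xi>))"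
      by (intro sum.cong refl) (simp add: d sgn_strict_def)
    show ?thesis
      unfolding cherednik_eq[OF \<xi>] dot_spectral[OF \<xi> l] d0 s
      by (simp add: root_term_def sum_divide_distrib sum_negf)
  qed
  then have "spectral_eigenfunction \<kappa> (replicate n 0) (expsum ?c)"
    unfolding spectral_eigenfunction_def e by simp
  moreover have "fin_coeffs n ?c"
    by (simp add: fin_coeffs_def)
  ultimately show ?thesis by (simp add: bc_expansion_def)
qed

lemma bc_expansion_exists:
  assumes "length \<nu> = n" "0 < n" and \<kappa>: "0 \<le> k1" "0 \<le> k2" "0 \<le> k3"
  shows "\<exists>c. bc_expansion (k1, k2, k3) \<nu> c"
  using assms(1,2)
proof (induction rule: raising_induct)
  case zero
  show ?case using bc_expansion_zero by blast
next
  case (raise i \<mu>)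
  then obtain c where "bc_expansion (k1, k2, k3) \<mu> c" by blast
  from bc_expansion_raise[OF this raise(3) _ _ \<kappa>] raise(1,2) \<open>0 < n\<close> show ?case by blast
qed

subsection \<open>The expansions as a basis\<close>

definition in_span :: "nat \<Rightarrow> (int list \<Rightarrow> int list \<Rightarrow> complex) \<Rightarrow> (int list \<Rightarrow> complex) \<Rightarrow> bool" where
  "in_span n G c \<longleftrightarrow> (\<exists>S b. finite S \<and> (\<forall>\<nu>\<in>S. length \<nu> = n) \<and> c = (\<lambda>\<mu>. \<Sum>\<nu>\<in>S. b \<nu> * G \<nu> \<mu>))"

lemma in_span_add:
  assumes "in_span n G c" "in_span n G d"
  shows "in_span n G (\<lambda>\<mu>. c \<mu> + a * d \<mu>)"
proof -
  obtain S b where S: "finite S" "\<forall>\<nu>\<in>S. length \<nu> = n" "c = (\<lambda>\<mu>. \<Sum>\<nu>\<in>S. b \<nu> * G \<nu> \<mu>)"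
    using assms(1) unfolding in_span_def by blast
  obtain T e where T: "finite T" "\<forall>\<nu>\<in>T. length \<nu> = n" "d = (\<lambda>\<mu>. \<Sum>\<nu>\<in>T. e \<nu> * G \<nu> \<mu>)"
    using assms(2) unfolding in_span_def by blast
  let ?g = "\<lambda>\<nu>. (if \<nu> \<in> S then b \<nu> else 0) + a * (if \<nu> \<in> T then e \<nu> else 0)"
  have "c \<mu> + a * d \<mu> = (\<Sum>\<nu>\<in>S \<union> T. ?g \<nu> * G \<nu> \<mu>)" for \<mu>
  proof -
    have "c \<mu> = (\<Sum>\<nu>\<in>S \<union> T. (if \<nu> \<in> S then b \<nu> else 0) * G \<nu> \<mu>)"
      unfolding S(3) using S(1) T(1) by (intro sum.mono_neutral_cong_left) auto
    moreover have "d \<mu> = (\<Sum>\<nu>\<in>S \<union> T. (if \<nu> \<in> T then e \<nu> else 0) * G \<nu> \<mu>)"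
      unfolding T(3) using S(1) T(1) by (intro sum.mono_neutral_cong_left) auto
    ultimately show ?thesis
      by (simp only: distrib_right sum.distrib sum_distrib_left mult.assoc)
  qed
  then show ?thesis unfolding in_span_def using S(1,2) T(1,2)
    by (intro exI[of _ "S \<union> T"] exI[of _ ?g]) auto
qed

lemma in_span_zero: "in_span n G (\<lambda>_. 0)"
  unfolding in_span_def by (intro exI[of _ "{}"]) simp

lemma in_span_sum:
  assumes "finite A" "\<And>\<rho>. \<rho> \<in> A \<Longrightarrow> in_span n G (f \<rho>)"
  shows "in_span n G (\<lambda>\<mu>. \<Sum>\<rho>\<in>A. a \<rho> * f \<rho> \<mu>)"
  using assms
proof (induction A rule: finite_induct)
  case (insert \<rho> A)
  have "in_span n G (\<lambda>\<mu>. (\<Sum>\<rho>\<in>A. a \<rho> * f \<rho> \<mu>) + a \<rho> * f \<rho> \<mu>)"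
    using insert by (intro in_span_add) auto
  then show ?case using insert.hyps by (simp add: add.commute)
qed (simp add: in_span_zero)

definition single_coeff :: "int list \<Rightarrow> int list \<Rightarrow> complex" where
  "single_coeff \<rho> \<mu> = (if \<mu> = \<rho> then 1 else 0)"

lemma fin_coeffs_eq_sum:
  assumes "finite A" "\<And>\<mu>. c \<mu> \<noteq> 0 \<Longrightarrow> \<mu> \<in> A"
  shows "c = (\<lambda>\<mu>. \<Sum>\<rho>\<in>A. c \<rho> * single_coeff \<rho> \<mu>)"
proof
  fix \<mu>
  have "(\<Sum>\<rho>\<in>A. c \<rho> * single_coeff \<rho> \<mu>) = (\<Sum>\<rho>\<in>A. if \<rho> = \<mu> then c \<rho> else 0)"
    by (intro sum.cong) (auto simp: single_coeff_def)
  then show "c \<mu> = (\<Sum>\<rho>\<in>A. c \<rho> * single_coeff \<rho> \<mu>)" using assms by auto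
qed

context
  fixes n :: nat and \<kappa> :: "real \<times> real \<times> real" and G :: "int list \<Rightarrow> int list \<Rightarrow> complex"
  assumes G: "\<And>\<nu>. length \<nu> = n \<Longrightarrow> bc_expansion \<kappa> \<nu> (G \<nu>)"
begin

text \<open>
  The expansions are unitriangular with finite supports in the well-founded Bruhat order, so they
  can be inverted.
\<close>

lemma single_coeff_in_span:
  assumes "length \<nu> = n"
  shows "in_span n G (single_coeff \<nu>)"
  using assms
proof (induction \<nu> rule: bruhat_induct)
  case (less \<nu>)
  have g: "fin_coeffs n (G \<nu>)" "G \<nu> \<nu> = 1" "\<And>\<mu>. G \<nu> \<mu> \<noteq> 0 \<Longrightarrow> bruhat_step\<^sup>*\<^sup>* \<mu> \<nu>"
    using G[OF less.prems] less.prems by (auto simp: bc_expansion_def)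
  let ?A = "{\<mu>. G \<nu> \<mu> \<noteq> 0} - {\<nu>}"
  have fin: "finite ?A" using g(1) by (simp add: fin_coeffs_def)
  have "in_span n G (single_coeff \<rho>)" if \<rho>: "\<rho> \<in> ?A" for \<rho>
  proof (rule less.IH)
    show "bruhat_step\<^sup>+\<^sup>+ \<rho> \<nu>" using g(3)[of \<rho>] \<rho> by (auto dest: rtranclpD)
    show "length \<rho> = n" using g(1) \<rho> by (auto simp: fin_coeffs_def)
  qed
  then have "in_span n G (\<lambda>\<mu>. \<Sum>\<rho>\<in>?A. G \<nu> \<rho> * single_coeff \<rho> \<mu>)"
    using fin by (intro in_span_sum) auto
  moreover have "in_span n G (G \<nu>)"
    unfolding in_span_def using less.prems by (intro exI[of _ "{\<nu>}"] exI[of _ "\<lambda>_. 1"]) simp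
  ultimately have "in_span n G (\<lambda>\<mu>. G \<nu> \<mu> + (-1) * (\<Sum>\<rho>\<in>?A. G \<nu> \<rho> * single_coeff \<rho> \<mu>))"
    by (intro in_span_add)
  moreover have "G \<nu> \<mu> + (-1) * (\<Sum>\<rho>\<in>?A. G \<nu> \<rho> * single_coeff \<rho> \<mu>) = single_coeff \<nu> \<mu>" for \<mu>
  proof -
    define X where "X = (\<Sum>\<rho>\<in>?A. G \<nu> \<rho> * single_coeff \<rho> \<mu>)"
    have "G \<nu> \<mu> = (\<Sum>\<rho>\<in>insert \<nu> ?A. G \<nu> \<rho> * single_coeff \<rho> \<mu>)"
      by (rule fun_cong[OF fin_coeffs_eq_sum]) (use fin in auto)
    also have "\<dots> = G \<nu> \<nu> * single_coeff \<nu> \<mu> + X"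
      unfolding X_def using fin by (rule sum.insert) simp
    finally have "G \<nu> \<mu> + (-1) * X = single_coeff \<nu> \<mu>" using g(2) by simp
    then show ?thesis unfolding X_def .
  qed
  ultimately show ?case by (simp only:)
qed

text \<open>
  At a Bruhat-maximal index \<open>m\<close> with a nonzero coefficient only the expansion of \<open>m\<close> contributes.
\<close>

lemma expansions_independent:
  assumes "finite S" "\<And>\<nu>. \<nu> \<in> S \<Longrightarrow> length \<nu> = n" and zero: "\<And>\<mu>. (\<Sum>\<nu>\<in>S. a \<nu> * G \<nu> \<mu>) = 0"
    and "\<nu> \<in> S"
  shows "a \<nu> = 0"
proof (rule ccontr)
  assume "a \<nu> \<noteq> 0"
  let ?T = "{\<nu>\<in>S. a \<nu> \<noteq> 0}"
  have "\<exists>m\<in>?T. \<forall>x\<in>?T. x \<noteq> m \<longrightarrow> \<not> bruhat_step\<^sup>+\<^sup>+ m x"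
  proof (rule Finite_Set.bex_max_element)
    show "finite ?T" "?T \<noteq> {}" using assms \<open>a \<nu> \<noteq> 0\<close> by auto
    show "asymp_on ?T bruhat_step\<^sup>+\<^sup>+"
      using bruhat_trancl_irrefl by (intro asymp_onI) (metis tranclp_trans)
    show "transp_on ?T bruhat_step\<^sup>+\<^sup>+"
      by (intro transp_onI) (rule tranclp_trans)
  qed
  then obtain m where m: "m \<in> S" "a m \<noteq> 0"
    and max: "\<And>x. x \<in> S \<Longrightarrow> a x \<noteq> 0 \<Longrightarrow> x \<noteq> m \<Longrightarrow> \<not> bruhat_step\<^sup>+\<^sup>+ m x"
    by blast
  have "a x * G x m = 0" if x: "x \<in> S - {m}" for x
  proof (cases "a x = 0")
    case False
    have "\<not> bruhat_step\<^sup>*\<^sup>* m x" using max[of x] x False by (auto dest: rtranclpD)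
    then show ?thesis using G[of x] x assms(2)[of x] unfolding bc_expansion_def by auto
  qed simp
  then have "(\<Sum>x\<in>S - {m}. a x * G x m) = 0" by (rule sum.neutral[OF ballI])
  moreover have "(\<Sum>x\<in>S. a x * G x m) = a m * G m m + (\<Sum>x\<in>S - {m}. a x * G x m)"
    using assms(1) m(1) by (rule sum.remove)
  moreover have "G m m = 1" using G[of m] assms(2)[OF m(1)] unfolding bc_expansion_def by simp
  ultimately show False using zero[of m] m(2) by simp
qed

end

text \<open>
  Expand \<open>f\<close> in the basis of eigenfunctions. As these have pairwise distinct spectral vectors, a joint
  eigenfunction is a multiple of a single one, say with index \<open>\<rho>\<close>. Then \<open>\<nu>\<close> lies below \<open>\<rho>\<close> and \<open>\<rho>\<close> below \<open>\<nu>\<close>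
  in the triangularity order, so \<open>\<rho> = \<nu>\<close>. This avoids any computation of the operators on single exponentials.
\<close>

lemma joint_eigenfunction_unique:
  assumes l: "length \<nu> = n" "0 < n" and \<kappa>: "0 \<le> k1" "0 \<le> k2" "0 \<le> k3"
    and c: "bc_expansion (k1, k2, k3) \<nu> c"
    and A: "finite A" "A \<subseteq> tri_lower \<nu>" and f: "f = (\<lambda>z. expo \<nu> z + (\<Sum>\<mu>\<in>A. d \<mu> * expo \<mu> z))"
    and eig: "joint_eigenfunction n (k1, k2, k3) f"
  shows "f = expsum c"
proof -
  let ?\<kappa> = "(k1, k2, k3)"
  define G where "G \<mu> = (if \<mu> = \<nu> then c else SOME c. bc_expansion ?\<kappa> \<mu> c)" for \<mu>
  have G: "bc_expansion ?\<kappa> \<mu> (G \<mu>)" if "length \<mu> = n" for \<mu>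
    using c someI_ex[OF bc_expansion_exists[OF that l(2) \<kappa>]] by (simp add: G_def)
  have Gfin: "fin_coeffs n (G \<mu>)" if "length \<mu> = n" for \<mu>
    using G[OF that] that by (simp add: bc_expansion_def)
  have \<nu>A: "\<nu> \<notin> A" using A(2) by (auto simp: tri_lower_def)
  define e where "e \<mu> = (if \<mu> = \<nu> then 1 else if \<mu> \<in> A then d \<mu> else 0)" for \<mu>
  have fe: "f = expsum e"
  proof
    fix z
    have "expsum e z = (\<Sum>\<mu>\<in>insert \<nu> A. e \<mu> * expo \<mu> z)"
      using A(1) by (intro expsum_superset) (auto simp: e_def split: if_splits)
    also have "\<dots> = expo \<nu> z + (\<Sum>\<mu>\<in>A. e \<mu> * expo \<mu> z)"
      using A(1) \<nu>A by (simp add: e_def)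
    also have "(\<Sum>\<mu>\<in>A. e \<mu> * expo \<mu> z) = (\<Sum>\<mu>\<in>A. d \<mu> * expo \<mu> z)"
      using \<nu>A by (intro sum.cong) (auto simp: e_def)
    finally show "f z = expsum e z" by (simp add: f)
  qed
  have Alen: "length \<mu> = n" if "\<mu> \<in> insert \<nu> A" for \<mu>
    using that A(2) l by (auto simp: tri_lower_def)
  have "in_span n G (\<lambda>\<mu>. \<Sum>\<rho>\<in>insert \<nu> A. e \<rho> * single_coeff \<rho> \<mu>)"
    using A(1) Alen by (intro in_span_sum single_coeff_in_span[OF G]) auto
  moreover have "e = (\<lambda>\<mu>. \<Sum>\<rho>\<in>insert \<nu> A. e \<rho> * single_coeff \<rho> \<mu>)"
    using A(1) by (intro fin_coeffs_eq_sum) (auto simp: e_def split: if_splits)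
  ultimately have "in_span n G e" by simp
  then obtain S0 b where S0: "finite S0" "\<forall>\<mu>\<in>S0. length \<mu> = n" "e = (\<lambda>\<mu>. \<Sum>\<rho>\<in>S0. b \<rho> * G \<rho> \<mu>)"
    unfolding in_span_def by blast
  \<comment> \<open>Only the indices that occur with a nonzero coefficient are of interest.\<close>
  define S where "S = {\<rho>\<in>S0. b \<rho> \<noteq> 0}"
  have S: "finite S" "\<And>\<mu>. \<mu> \<in> S \<Longrightarrow> length \<mu> = n" "\<And>\<mu>. \<mu> \<in> S \<Longrightarrow> b \<mu> \<noteq> 0"
    using S0(1,2) by (auto simp: S_def)
  have e: "e = (\<lambda>\<mu>. \<Sum>\<rho>\<in>S. b \<rho> * G \<rho> \<mu>)"
    unfolding S0(3) S_def using S0(1) by (intro ext sum.mono_neutral_right) auto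
  have same: "\<exists>v. \<forall>\<rho>\<in>S. complex_of_real (dot (spectral ?\<kappa> \<rho>) \<xi>) = v" if \<xi>: "length \<xi> = n" for \<xi>
  proof -
    obtain v where v: "\<And>z. z \<in> regular_points n \<Longrightarrow> cherednik ?\<kappa> \<xi> f z = v * f z"
      using eig \<xi> unfolding joint_eigenfunction_def by blast
    let ?a = "\<lambda>\<rho>. b \<rho> * (of_real (dot (spectral ?\<kappa> \<rho>) \<xi>) - v)"
    let ?C = "\<lambda>\<mu>. \<Sum>\<rho>\<in>S. ?a \<rho> * G \<rho> \<mu>"
    have Gf: "fin_coeffs n (G \<rho>)" if "\<rho> \<in> S" for \<rho> using Gfin[OF S(2)[OF that]] .
    have es: "expsum (\<lambda>\<mu>. \<Sum>\<rho>\<in>S. g \<rho> * G \<rho> \<mu>) z = (\<Sum>\<rho>\<in>S. g \<rho> * expsum (G \<rho>) z)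
        \<and> fin_coeffs n (\<lambda>\<mu>. \<Sum>\<rho>\<in>S. g \<rho> * G \<rho> \<mu>)" for g z
      by (rule expsum_sum[OF S(1)]) (rule Gf)
    have C: "fin_coeffs n ?C" by (rule conjunct2[OF es])
    have "expsum ?C z = 0" if z: "z \<in> regular_points n" for z
    proof -
      have lz: "length z = n" using z by (rule regular_points_length)
      have "cherednik ?\<kappa> \<xi> (expsum (G \<rho>)) z = of_real (dot (spectral ?\<kappa> \<rho>) \<xi>) * expsum (G \<rho>) z"
        if "\<rho> \<in> S" for \<rho>
        using G[OF S(2)[OF that]] spectral_eigenfunctionD[OF _ S(2)[OF that] \<xi> z]
        unfolding bc_expansion_def by blast
      then have "(\<Sum>\<rho>\<in>S. b \<rho> * cherednik ?\<kappa> \<xi> (expsum (G \<rho>)) z)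
          = (\<Sum>\<rho>\<in>S. b \<rho> * (of_real (dot (spectral ?\<kappa> \<rho>) \<xi>) * expsum (G \<rho>) z))"
        by (intro sum.cong refl) simp
      moreover have "cherednik ?\<kappa> \<xi> (expsum e) z
          = (\<Sum>\<rho>\<in>S. b \<rho> * cherednik ?\<kappa> \<xi> (expsum (G \<rho>)) z)"
        unfolding e by (rule cherednik_expsum_sum[OF S(1) _ lz \<xi>]) (rule Gf)
      moreover have "v * expsum e z = (\<Sum>\<rho>\<in>S. b \<rho> * (v * expsum (G \<rho>) z))"
        unfolding e conjunct1[OF es] sum_distrib_left by (intro sum.cong refl) (rule mult.left_commute)
      ultimately have "(\<Sum>\<rho>\<in>S. b \<rho> * (of_real (dot (spectral ?\<kappa> \<rho>) \<xi>) * expsum (G \<rho>) z))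
          = (\<Sum>\<rho>\<in>S. b \<rho> * (v * expsum (G \<rho>) z))"
        using v[OF z] unfolding fe by (simp only:)
      then have "(\<Sum>\<rho>\<in>S. ?a \<rho> * expsum (G \<rho>) z) = 0"
        by (simp add: algebra_simps sum_subtractf)
      then show ?thesis by (simp only: conjunct1[OF es])
    qed
    then have "?C \<mu> = 0" for \<mu> using expsum_eq_zero[OF C] by blast
    then have "?a \<rho> = 0" if "\<rho> \<in> S" for \<rho>
      using expansions_independent[OF G S(1,2), of ?a \<rho>] that by blast
    then have "complex_of_real (dot (spectral ?\<kappa> \<rho>) \<xi>) = v" if "\<rho> \<in> S" for \<rho>
      using S(3)[OF that] that by fastforce
    then show ?thesis by blast
  qed
  have single: "\<rho> = \<sigma>" if "\<rho> \<in> S" "\<sigma> \<in> S" for \<rho> \<sigma>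
  proof (rule spectral_inj[OF S(2)[OF that(1)] S(2)[OF that(2)] \<kappa>])
    fix \<xi> :: "real list" assume "length \<xi> = n"
    then obtain v where "\<forall>\<rho>\<in>S. complex_of_real (dot (spectral ?\<kappa> \<rho>) \<xi>) = v"
      using same by blast
    then have "complex_of_real (dot (spectral ?\<kappa> \<rho>) \<xi>) = complex_of_real (dot (spectral ?\<kappa> \<sigma>) \<xi>)"
      using that by simp
    then show "dot (spectral ?\<kappa> \<rho>) \<xi> = dot (spectral ?\<kappa> \<sigma>) \<xi>" by (simp only: of_real_eq_iff)
  qed
  have e1: "e \<nu> = 1" by (simp add: e_def)
  have "S \<noteq> {}"
  proof
    assume "S = {}"
    then show False using e1 unfolding e by simp
  qed
  then obtain \<rho> where \<rho>: "\<rho> \<in> S" by blast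
  then have "S = {\<rho>}" using single by blast
  then have e\<rho>: "e \<mu> = b \<rho> * G \<rho> \<mu>" for \<mu> unfolding e by simp
  have l\<rho>: "length \<rho> = n" using S(2)[OF \<rho>] .
  have G\<rho>: "G \<rho> \<rho> = 1" "\<And>\<mu>. G \<rho> \<mu> \<noteq> 0 \<Longrightarrow> bruhat_step\<^sup>*\<^sup>* \<mu> \<rho>"
    using G[OF l\<rho>] by (auto simp: bc_expansion_def)
  have "\<rho> = \<nu>"
  proof (rule ccontr)
    assume ne: "\<rho> \<noteq> \<nu>"
    have "e \<rho> \<noteq> 0" using e\<rho>[of \<rho>] G\<rho>(1) S(3)[OF \<rho>] by simp
    then have "\<rho> \<in> A" using ne by (auto simp: e_def split: if_splits)
    then have "\<rho> \<in> tri_lower \<nu>" using A(2) by blast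
    moreover have "G \<rho> \<nu> \<noteq> 0" using e1 e\<rho>[of \<nu>] by auto
    then have "bruhat_step\<^sup>+\<^sup>+ \<nu> \<rho>" using G\<rho>(2) ne by (auto dest: rtranclpD)
    then have "\<nu> \<in> tri_lower \<rho>" by (rule bruhat_lower_tri_lower)
    ultimately show False using ne tri_le_antisym[of \<rho> \<nu>] by (simp add: tri_lower_def)
  qed
  then have "b \<rho> = 1" "G \<rho> = c" using e1 e\<rho>[of \<nu>] G\<rho>(1) by (simp_all add: G_def)
  then have "e = c" using e\<rho> by (simp add: fun_eq_iff)
  then show ?thesis by (simp add: fe)
qed

lemma E_BC_eq_expsum:
  assumes l: "0 < length \<nu>" and \<kappa>: "0 \<le> k1" "0 \<le> k2" "0 \<le> k3"
    and c: "bc_expansion (k1, k2, k3) \<nu> c"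
  shows "E_BC (k1, k2, k3) \<nu> = expsum c"
proof -
  let ?n = "length \<nu>" and ?A = "{\<mu>. c \<mu> \<noteq> 0} - {\<nu>}"
  have c': "fin_coeffs ?n c" "c \<nu> = 1" "\<And>\<mu>. c \<mu> \<noteq> 0 \<Longrightarrow> bruhat_step\<^sup>*\<^sup>* \<mu> \<nu>"
     "spectral_eigenfunction (k1, k2, k3) \<nu> (expsum c)"
    using c by (auto simp: bc_expansion_def)
  have fin: "finite {\<mu>. c \<mu> \<noteq> 0}" using c'(1) by (simp add: fin_coeffs_def)
  have low: "?A \<subseteq> tri_lower \<nu>"
  proof
    fix \<mu> assume "\<mu> \<in> ?A"
    then have "bruhat_step\<^sup>+\<^sup>+ \<mu> \<nu>" using c'(3)[of \<mu>] by (auto dest: rtranclpD)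
    then show "\<mu> \<in> tri_lower \<nu>" by (rule bruhat_lower_tri_lower)
  qed
  have form: "expsum c = (\<lambda>z. expo \<nu> z + (\<Sum>\<mu>\<in>?A. c \<mu> * expo \<mu> z))"
  proof
    fix z
    have "expsum c z = c \<nu> * expo \<nu> z + (\<Sum>\<mu>\<in>?A. c \<mu> * expo \<mu> z)"
      unfolding expsum_def using fin c'(2) by (intro sum.remove) auto
    then show "expsum c z = expo \<nu> z + (\<Sum>\<mu>\<in>?A. c \<mu> * expo \<mu> z)" using c'(2) by simp
  qed
  have eig: "joint_eigenfunction ?n (k1, k2, k3) (expsum c)"
    unfolding joint_eigenfunction_def using spectral_eigenfunctionD[OF c'(4) refl] by blast
  have A: "finite ?A" using fin by simp
  show ?thesis
    unfolding E_BC_def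
  proof (rule the_equality)
    show "(\<exists>A d. finite A \<and> A \<subseteq> tri_lower \<nu> \<and> expsum c = (\<lambda>z. expo \<nu> z + (\<Sum>\<mu>\<in>A. d \<mu> * expo \<mu> z)))
        \<and> joint_eigenfunction ?n (k1, k2, k3) (expsum c)"
      using A low form eig by blast
  next
    fix f
    assume "(\<exists>A d. finite A \<and> A \<subseteq> tri_lower \<nu> \<and> f = (\<lambda>z. expo \<nu> z + (\<Sum>\<mu>\<in>A. d \<mu> * expo \<mu> z)))
        \<and> joint_eigenfunction ?n (k1, k2, k3) f"
    then show "f = expsum c"
      using joint_eigenfunction_unique[OF refl l \<kappa> c] by blast
  qed
qed

lemma E_BC_zero:
  assumes "0 < n" "0 \<le> k1" "0 \<le> k2" "0 \<le> k3"
  shows "E_BC (k1, k2, k3) (replicate n 0) z = 1"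
proof -
  have "E_BC (k1, k2, k3) (replicate n 0) = expsum (\<lambda>\<mu>. if \<mu> = replicate n 0 then 1 else 0)"
    using assms by (intro E_BC_eq_expsum bc_expansion_zero) simp_all
  then show ?thesis by (simp only: expsum_single expo_zero)
qed

text \<open>
  The recursion that determines all polynomials from \<open>E\<^sub>0 = 1\<close>.
\<close>

lemma E_BC_aff_refl:
  assumes i: "raises i \<nu>" "i \<le> length \<nu>" "0 < length \<nu>" and \<kappa>: "0 \<le> k1" "0 \<le> k2" "0 \<le> k3"
    and z: "length z = length \<nu>"
  shows "E_BC (k1, k2, k3) (aff_refl i \<nu>) z = simple_act i (E_BC (k1, k2, k3) \<nu>) z
    + of_real (raise_coeff (k1, k2, k3) i \<nu>) * E_BC (k1, k2, k3) \<nu> z"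
proof -
  obtain c where c: "bc_expansion (k1, k2, k3) \<nu> c"
    using bc_expansion_exists[OF refl i(3) \<kappa>] by blast
  have fc: "fin_coeffs (length \<nu>) c" using c by (simp add: bc_expansion_def)
  have l: "0 < length (aff_refl i \<nu>)" using i by simp
  show ?thesis
    unfolding E_BC_eq_expsum[OF i(3) \<kappa> c] E_BC_eq_expsum[OF l \<kappa> bc_expansion_raise[OF c i \<kappa>]]
      expsum_linear(1)[OF expsum_aff_refl(2)[OF fc i(2,3)] fc]
      expsum_aff_refl(1)[OF fc i(2,3) z] ..
qed

section \<open>The limit of large multiplicities\<close>

text \<open>
  The coefficient of \<open>k\<^sub>3\<close> in the \<open>j\<close>-th coordinate of the spectral vector.
\<close>

definition middle_shift :: "int list \<Rightarrow> nat \<Rightarrow> real" where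
  "middle_shift \<nu> j =
     (\<Sum>\<alpha>\<in>middle_roots (length \<nu>). sgn_strict (dot \<alpha> \<nu>) * of_int (\<alpha> ! j)) / 2"

lemma sum_BC_pos:
  fixes g :: "int list \<Rightarrow> real"
  shows "(\<Sum>\<alpha>\<in>BC_pos n. g \<alpha>) = (\<Sum>i<n. g (two_term n 1 i 0 i)) + (\<Sum>i<n. g (two_term n 2 i 0 i))
     + (\<Sum>\<alpha>\<in>middle_roots n. g \<alpha>)"
proof -
  have s: "dot \<alpha> \<alpha> = 1" if "\<alpha> \<in> short_roots n" for \<alpha>
    using that by (auto simp: short_roots_eq dot_root_self)
  have l: "dot \<alpha> \<alpha> = 4" if "\<alpha> \<in> long_roots n" for \<alpha>
    using that by (auto simp: long_roots_eq dot_root_self)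
  have m: "dot \<alpha> \<alpha> = 2" if "\<alpha> \<in> middle_roots n" for \<alpha>
    using that by (rule middle_rootsE) (simp add: dot_root_self(3))
  have disj: "short_roots n \<inter> long_roots n = {}" "(short_roots n \<union> long_roots n) \<inter> middle_roots n = {}"
    using s l m by fastforce+
  have fin: "finite (short_roots n)" "finite (long_roots n)"
    by (simp_all add: short_roots_eq long_roots_eq)
  have inj: "inj_on (\<lambda>i. two_term n a i 0 i) {..<n}" if "a \<noteq> 0" for a
  proof (rule inj_onI)
    fix i k assume "i \<in> {..<n}" "k \<in> {..<n}" "two_term n a i 0 i = two_term n a k 0 k"
    then have "two_term n a i 0 i ! i = two_term n a k 0 k ! i" by simp
    then show "i = k" using \<open>i \<in> {..<n}\<close> that by (auto simp: nth_two_term split: if_splits)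
  qed
  show ?thesis
    unfolding BC_pos_def
    using disj fin finite_middle_roots[of n] inj[of 1] inj[of 2]
    by (simp add: sum.union_disjoint) (simp add: short_roots_eq long_roots_eq sum.reindex)
qed

lemma nth_spectral:
  assumes "j < length \<nu>"
  shows "spectral (k1, k2, k3) \<nu> ! j
    = of_int (\<nu> ! j) + (k1 + 2 * k2) / 2 * sgn_strict (\<nu> ! j) + k3 * middle_shift \<nu> j"
proof -
  let ?n = "length \<nu>" and ?\<kappa> = "(k1, k2, k3)"
  let ?g = "\<lambda>\<alpha>. BC_mult ?\<kappa> \<alpha> * sgn_strict (dot \<alpha> \<nu>) * of_int (\<alpha> ! j)"
  have "(\<Sum>i<?n. ?g (two_term ?n 1 i 0 i)) = (\<Sum>i<?n. if i = j then k1 * sgn_strict (\<nu> ! j) else 0)"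
    using assms by (intro sum.cong) (auto simp: BC_mult_two_term dot_two_term_int nth_two_term)
  then have 1: "(\<Sum>i<?n. ?g (two_term ?n 1 i 0 i)) = k1 * sgn_strict (\<nu> ! j)"
    using assms by simp
  have dbl: "sgn_strict (2 * m) = sgn_strict m" for m by (simp add: sgn_strict_def)
  have "(\<Sum>i<?n. ?g (two_term ?n 2 i 0 i)) = (\<Sum>i<?n. if i = j then 2 * k2 * sgn_strict (\<nu> ! j) else 0)"
    using assms by (intro sum.cong) (auto simp: BC_mult_two_term dot_two_term_int nth_two_term dbl)
  then have 2: "(\<Sum>i<?n. ?g (two_term ?n 2 i 0 i)) = 2 * k2 * sgn_strict (\<nu> ! j)"
    using assms by simp
  have m: "BC_mult ?\<kappa> \<alpha> = k3" if "\<alpha> \<in> middle_roots ?n" for \<alpha>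
    using that by (rule middle_rootsE) (simp add: BC_mult_two_term(3))
  have "(\<Sum>\<alpha>\<in>middle_roots ?n. ?g \<alpha>)
      = (\<Sum>\<alpha>\<in>middle_roots ?n. k3 * (sgn_strict (dot \<alpha> \<nu>) * of_int (\<alpha> ! j)))"
    by (intro sum.cong refl) (simp only: m mult.assoc)
  then have 3: "(\<Sum>\<alpha>\<in>middle_roots ?n. ?g \<alpha>) = k3 * (2 * middle_shift \<nu> j)"
    by (simp add: middle_shift_def flip: sum_distrib_left)
  show ?thesis
    using assms unfolding spectral_def sum_BC_pos by (simp add: 1 2 3) (simp add: field_simps)
qed

subsection \<open>Convergence of the coefficients\<close>

definition BC_region :: "real \<Rightarrow> (real \<times> real) set" where
  "BC_region M = {(k1, k2). 0 \<le> k1 \<and> 0 \<le> k2 \<and> M \<le> k1 + k2 \<and> (k2 = 0 \<or> M \<le> k1 / k2)}"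

lemma BC_filter_eq: "BC_filter = (INF M. principal (BC_region M))"
  by (simp add: BC_filter_def BC_region_def)

lemma eventually_BC_region: "eventually (\<lambda>\<kappa>. \<kappa> \<in> BC_region M) BC_filter"
  unfolding BC_filter_eq by (rule eventually_INF1[of M]) (simp_all add: eventually_principal)

lemma BC_filter_neq_bot: "BC_filter \<noteq> bot"
proof -
  have "\<exists>M\<in>UNIV. principal (BC_region M) \<le> inf (principal (BC_region M1)) (principal (BC_region M2))" for M1 M2
    by (intro bexI[of _ "max M1 M2"]) (auto simp: BC_region_def)
  moreover have "(max 0 M, 0) \<in> BC_region M" for M by (simp add: BC_region_def)
  then have "principal (BC_region M) \<noteq> bot" for M by (auto simp: principal_eq_bot_iff)
  ultimately show ?thesis
    unfolding BC_filter_eq by (subst INF_filter_bot_base) auto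
qed

lemma filterlim_total_mult: "filterlim (\<lambda>(k1, k2). k1 + 2 * k2) at_top BC_filter"
  unfolding filterlim_at_top
proof
  fix M
  show "eventually (\<lambda>\<kappa>. M \<le> (case \<kappa> of (k1, k2) \<Rightarrow> k1 + 2 * k2)) BC_filter"
    using eventually_BC_region[of M] by eventually_elim (auto simp: BC_region_def)
qed

lemma tendsto_total_shift: "((\<lambda>(k1, k2). (k1 + 2 * k2) / (k1 + 2 * k2 + a)) \<longlongrightarrow> 1) BC_filter"
proof -
  have "((\<lambda>K :: real. K / (K + a)) \<longlongrightarrow> 1) at_top"
    by real_asymp
  from filterlim_compose[OF this filterlim_total_mult] show ?thesis
    by (simp add: case_prod_unfold)
qed

text \<open>
  Only here the condition \<open>k\<^sub>1 / k\<^sub>2 \<rightarrow> \<infinity>\<close> enters: it makes \<open>k\<^sub>1\<close> dominate \<open>k\<^sub>1 + 2 k\<^sub>2\<close>.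
\<close>

lemma tendsto_short_ratio: "((\<lambda>(k1, k2). k1 / (k1 + 2 * k2)) \<longlongrightarrow> 1) BC_filter"
proof (rule tendstoI)
  fix e :: real assume e: "0 < e"
  show "eventually (\<lambda>\<kappa>. dist (case \<kappa> of (k1, k2) \<Rightarrow> k1 / (k1 + 2 * k2)) 1 < e) BC_filter"
    using eventually_BC_region[of "max 1 (3 / e)"]
  proof eventually_elim
    case (elim \<kappa>)
    obtain k1 k2 where \<kappa>: "\<kappa> = (k1, k2)" by (cases \<kappa>)
    have k: "0 \<le> k1" "0 \<le> k2" "1 \<le> k1 + k2" "k2 = 0 \<or> 3 / e \<le> k1 / k2"
      using elim by (auto simp: BC_region_def \<kappa>)
    have pos: "0 < k1 + 2 * k2" using k by linarith
    have "k1 / (k1 + 2 * k2) - 1 = - (2 * k2 / (k1 + 2 * k2))" using pos by (simp add: field_simps)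
    moreover have "2 * k2 < e * (k1 + 2 * k2)"
    proof (cases "k2 = 0")
      case True
      then show ?thesis using e k by simp
    next
      case False
      then have "3 * k2 \<le> e * k1" using k e by (auto simp: field_simps)
      moreover have "0 < e * k2" "0 < k2" using e False k by simp_all
      ultimately show ?thesis by (simp add: distrib_left)
    qed
    then have "2 * k2 / (k1 + 2 * k2) < e" using pos by (simp add: field_simps)
    moreover have "0 \<le> 2 * k2 / (k1 + 2 * k2)" using k pos by simp
    ultimately show ?case unfolding \<kappa> dist_real_def prod.case by linarith
  qed
qed

definition limit_coeff :: "real \<Rightarrow> nat \<Rightarrow> int list \<Rightarrow> real" where
  "limit_coeff k3 i \<nu> =
     (if i = 0 \<or> i = length \<nu> then 1
      else if 0 < \<nu> ! (i - 1) \<and> \<nu> ! i \<le> 0 then 0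
      else k3 / (of_int (\<nu> ! (i - 1) - \<nu> ! i) + k3 * (middle_shift \<nu> (i - 1) - middle_shift \<nu> i)))"

text \<open>
  The coordinates of the spectral vector are \<open>\<plusminus>(k\<^sub>1 + 2 k\<^sub>2) / 2\<close> up to a constant, with the strict sign
  of the index. In a difference of two coordinates this term cancels if the signs agree, and tends
  to infinity otherwise. For \<open>s\<^sub>0\<close> and \<open>s\<^sub>n\<close> numerator and denominator grow alike.
\<close>

lemma raise_coeff_tendsto:
  assumes "raises i \<nu>" "i \<le> length \<nu>" "0 < length \<nu>"
  shows "((\<lambda>(k1, k2). raise_coeff (k1, k2, k3) i \<nu>) \<longlongrightarrow> limit_coeff k3 i \<nu>) BC_filter"
proof -
  let ?n = "length \<nu>"
  consider (zero) "i = 0" | (last) "i = ?n" "0 < i"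
    | (mixed) "0 < i" "i < ?n" "0 < \<nu> ! (i - 1)" "\<nu> ! i \<le> 0"
    | (same) "0 < i" "i < ?n" "\<not> (0 < \<nu> ! (i - 1) \<and> \<nu> ! i \<le> 0)"
    using assms(2) by linarith
  then show ?thesis
  proof cases
    case zero
    have neg: "sgn_strict (\<nu> ! 0) = -1" using assms(1) zero by (simp add: raises_def sgn_strict_def)
    define a where "a = 1 - 2 * of_int (\<nu> ! 0) - 2 * k3 * middle_shift \<nu> 0"
    have "((\<lambda>(k1, k2). k1 / (k1 + 2 * k2) * ((k1 + 2 * k2) / (k1 + 2 * k2 + a))) \<longlongrightarrow> 1 * 1) BC_filter"
      using tendsto_mult[OF tendsto_short_ratio tendsto_total_shift[of a]]
      by (simp add: case_prod_unfold)
    moreover have "eventually (\<lambda>(k1, k2). k1 / (k1 + 2 * k2) * ((k1 + 2 * k2) / (k1 + 2 * k2 + a))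
        = raise_coeff (k1, k2, k3) i \<nu>) BC_filter"
      using eventually_BC_region[of 1]
    proof eventually_elim
      case (elim \<kappa>)
      obtain k1 k2 where \<kappa>: "\<kappa> = (k1, k2)" by (cases \<kappa>)
      have "k1 + 2 * k2 \<noteq> 0" using elim by (auto simp: BC_region_def \<kappa>)
      moreover have "1 - 2 * spectral (k1, k2, k3) \<nu> ! 0 = k1 + 2 * k2 + a"
        using assms(3) by (simp add: nth_spectral neg a_def)
      ultimately show ?case by (simp add: \<kappa> raise_coeff_def zero Let_def)
    qed
    ultimately show ?thesis
      by (simp add: limit_coeff_def zero case_prod_unfold tendsto_cong)
  next
    case last
    have pos: "sgn_strict (\<nu> ! (?n - 1)) = 1" using assms(1) last by (simp add: raises_def sgn_strict_def)
    define a where "a = 2 * of_int (\<nu> ! (?n - 1)) + 2 * k3 * middle_shift \<nu> (?n - 1)"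
    have "2 * spectral (k1, k2, k3) \<nu> ! (?n - 1) = k1 + 2 * k2 + a" for k1 k2
      using assms(3) pos by (simp add: nth_spectral a_def)
    then have "raise_coeff (k1, k2, k3) i \<nu> = (k1 + 2 * k2) / (k1 + 2 * k2 + a)" for k1 k2
      using last by (simp add: raise_coeff_def Let_def)
    then show ?thesis using tendsto_total_shift[of a] last by (simp add: limit_coeff_def)
  next
    case mixed
    have s: "sgn_strict (\<nu> ! (i - 1)) = 1" "sgn_strict (\<nu> ! i) = -1"
      using mixed by (simp_all add: sgn_strict_def)
    define a where "a = of_int (\<nu> ! (i - 1) - \<nu> ! i) + k3 * (middle_shift \<nu> (i - 1) - middle_shift \<nu> i)"
    have "spectral (k1, k2, k3) \<nu> ! (i - 1) - spectral (k1, k2, k3) \<nu> ! i = k1 + 2 * k2 + a" for k1 k2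
    proof -
      have "i - 1 < ?n" using mixed by simp
      then show ?thesis
        unfolding nth_spectral[OF \<open>i < ?n\<close>] nth_spectral[OF \<open>i - 1 < ?n\<close>] s a_def
        by (simp add: field_simps)
    qed
    then have r: "raise_coeff (k1, k2, k3) i \<nu> = k3 / (k1 + 2 * k2 + a)" for k1 k2
      using mixed by (simp add: raise_coeff_def Let_def)
    have "((\<lambda>K :: real. k3 / (K + a)) \<longlongrightarrow> 0) at_top"
      by real_asymp
    from filterlim_compose[OF this filterlim_total_mult] show ?thesis
      using mixed by (simp add: r limit_coeff_def case_prod_unfold)
  next
    case same
    have "\<nu> ! i < \<nu> ! (i - 1)" using assms(1) same by (simp add: raises_def)
    then have s: "sgn_strict (\<nu> ! (i - 1)) = sgn_strict (\<nu> ! i)"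
      using same(3) by (auto simp: sgn_strict_def)
    have "raise_coeff (k1, k2, k3) i \<nu> = limit_coeff k3 i \<nu>" for k1 k2
      using same(1,2) s same(3)
      by (auto simp: raise_coeff_def Let_def nth_spectral limit_coeff_def algebra_simps)
    then show ?thesis by (simp add: case_prod_unfold)
  qed
qed

subsection \<open>Locally uniform convergence\<close>

definition polydisc :: "nat \<Rightarrow> real \<Rightarrow> complex list set" where
  "polydisc n R = {z. length z = n \<and> (\<forall>w\<in>set z. cmod w \<le> R)}"

lemma lin_refl_polydisc:
  assumes "z \<in> polydisc n R"
  shows "lin_refl i z \<in> polydisc n R"
proof -
  have l: "length z = n" and b: "\<And>j. j < n \<Longrightarrow> cmod (z ! j) \<le> R"
    using assms by (auto simp: polydisc_def)
  have "cmod (lin_refl i z ! j) \<le> R" if "j < n" for j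
    using that b[of "refl_idx n i j"] l refl_idx_less[OF that, of i]
    by (simp add: nth_lin_refl norm_mult refl_sign_def)
  then show ?thesis using l by (auto simp: polydisc_def in_set_conv_nth)
qed

lemma cmod_exp_polydisc:
  assumes "z \<in> polydisc n R" "0 < n"
  shows "cmod (if i = 0 then exp (z ! 0) else 1) \<le> exp \<bar>R\<bar>"
proof -
  have "cmod (z ! 0) \<le> R" using assms by (auto simp: polydisc_def)
  then have "Re (z ! 0) \<le> \<bar>R\<bar>" using complex_Re_le_cmod[of "z ! 0"] by linarith
  then show ?thesis by simp
qed

text \<open>
  Boundedness on polydiscs is carried along, because products of uniform limits require it.
\<close>

definition limit_function :: "real \<Rightarrow> int list \<Rightarrow> (complex list \<Rightarrow> complex) \<Rightarrow> bool" where
  "limit_function k3 \<nu> L \<longleftrightarrow> (\<forall>R. bounded (L ` polydisc (length \<nu>) R) \<and>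
     uniform_limit (polydisc (length \<nu>) R) (\<lambda>(k1, k2). E_BC (k1, k2, k3) \<nu>) L BC_filter)"

lemma limit_function_raise:
  assumes L: "limit_function k3 \<nu> L" and i: "raises i \<nu>" "i \<le> length \<nu>" "0 < length \<nu>" and k3: "0 \<le> k3"
  shows "limit_function k3 (aff_refl i \<nu>) (\<lambda>z. simple_act i L z + of_real (limit_coeff k3 i \<nu>) * L z)"
  unfolding limit_function_def
proof (intro allI conjI)
  fix R
  let ?P = "polydisc (length \<nu>) R"
  let ?e = "\<lambda>z. if i = 0 then exp (z ! 0 :: complex) else 1"
  have P: "polydisc (length (aff_refl i \<nu>)) R = ?P" by simp
  have bL: "bounded (L ` ?P)"
    and uL: "uniform_limit ?P (\<lambda>(k1, k2). E_BC (k1, k2, k3) \<nu>) L BC_filter"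
    using L unfolding limit_function_def by blast+
  obtain B where B: "\<And>z. z \<in> ?P \<Longrightarrow> cmod (L z) \<le> B"
    using bL unfolding bounded_iff by blast
  have "cmod (simple_act i L z + of_real (limit_coeff k3 i \<nu>) * L z)
      \<le> exp \<bar>R\<bar> * B + \<bar>limit_coeff k3 i \<nu>\<bar> * B" if z: "z \<in> ?P" for z
  proof -
    have "cmod (simple_act i L z) \<le> exp \<bar>R\<bar> * B"
      unfolding simple_act_def norm_mult
      using cmod_exp_polydisc[OF z i(3), of i] B[OF lin_refl_polydisc[OF z, of i]]
      by (intro mult_mono) auto
    moreover have "cmod (of_real (limit_coeff k3 i \<nu>) * L z) \<le> \<bar>limit_coeff k3 i \<nu>\<bar> * B"
      unfolding norm_mult using B[OF z] by (simp add: mult_left_mono)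
    ultimately show ?thesis by (intro norm_triangle_le add_mono)
  qed
  then show "bounded ((\<lambda>z. simple_act i L z + of_real (limit_coeff k3 i \<nu>) * L z) ` polydisc (length (aff_refl i \<nu>)) R)"
    unfolding P bounded_iff by blast
  have u1: "uniform_limit ?P (\<lambda>\<kappa>. simple_act i (E_BC (fst \<kappa>, snd \<kappa>, k3) \<nu>)) (simple_act i L) BC_filter"
    unfolding uniform_limit_iff
  proof (intro allI impI)
    fix e :: real assume "0 < e"
    then have "0 < e / exp \<bar>R\<bar>" by simp
    then have "eventually (\<lambda>\<kappa>. \<forall>z\<in>?P. dist (E_BC (fst \<kappa>, snd \<kappa>, k3) \<nu> z) (L z) < e / exp \<bar>R\<bar>) BC_filter"
      using uL unfolding uniform_limit_iff case_prod_unfold by blast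
    then show "eventually (\<lambda>\<kappa>. \<forall>z\<in>?P. dist (simple_act i (E_BC (fst \<kappa>, snd \<kappa>, k3) \<nu>) z) (simple_act i L z) < e) BC_filter"
    proof eventually_elim
      case (elim \<kappa>)
      show ?case
      proof
        fix z assume z: "z \<in> ?P"
        let ?w = "lin_refl i z"
        have "dist (simple_act i (E_BC (fst \<kappa>, snd \<kappa>, k3) \<nu>) z) (simple_act i L z)
            = cmod (?e z) * dist (E_BC (fst \<kappa>, snd \<kappa>, k3) \<nu> ?w) (L ?w)"
          unfolding simple_act_def dist_norm norm_mult[symmetric] by (simp add: right_diff_distrib)
        also have "\<dots> \<le> exp \<bar>R\<bar> * dist (E_BC (fst \<kappa>, snd \<kappa>, k3) \<nu> ?w) (L ?w)"
          using cmod_exp_polydisc[OF z i(3), of i] by (intro mult_right_mono) auto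
        also have "\<dots> < exp \<bar>R\<bar> * (e / exp \<bar>R\<bar>)"
          using elim lin_refl_polydisc[OF z, of i] by (intro mult_strict_left_mono) auto
        finally show "dist (simple_act i (E_BC (fst \<kappa>, snd \<kappa>, k3) \<nu>) z) (simple_act i L z) < e" by simp
      qed
    qed
  qed
  have "((\<lambda>\<kappa>. complex_of_real (raise_coeff (fst \<kappa>, snd \<kappa>, k3) i \<nu>)) \<longlongrightarrow> of_real (limit_coeff k3 i \<nu>)) BC_filter"
    using raise_coeff_tendsto[OF i, of k3] by (intro tendsto_of_real) (simp add: case_prod_unfold)
  then have u2: "uniform_limit ?P (\<lambda>\<kappa> z. complex_of_real (raise_coeff (fst \<kappa>, snd \<kappa>, k3) i \<nu>))
      (\<lambda>z. of_real (limit_coeff k3 i \<nu>)) BC_filter"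
    unfolding uniform_limit_iff tendsto_iff by (auto elim: eventually_mono)
  have u3: "uniform_limit ?P (\<lambda>\<kappa>. E_BC (fst \<kappa>, snd \<kappa>, k3) \<nu>) L BC_filter"
    using uL by (simp add: case_prod_unfold)
  have bc: "bounded ((\<lambda>z. complex_of_real (limit_coeff k3 i \<nu>)) ` ?P)"
    unfolding bounded_iff by auto
  have u: "uniform_limit ?P (\<lambda>\<kappa> z. simple_act i (E_BC (fst \<kappa>, snd \<kappa>, k3) \<nu>) z
        + of_real (raise_coeff (fst \<kappa>, snd \<kappa>, k3) i \<nu>) * E_BC (fst \<kappa>, snd \<kappa>, k3) \<nu> z)
      (\<lambda>z. simple_act i L z + of_real (limit_coeff k3 i \<nu>) * L z) BC_filter"
    by (rule uniform_limit_add[OF u1 uniform_lim_mult[OF u2 u3 bc bL]])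
  have ev: "eventually (\<lambda>\<kappa>. \<forall>z\<in>?P. simple_act i (E_BC (fst \<kappa>, snd \<kappa>, k3) \<nu>) z
        + of_real (raise_coeff (fst \<kappa>, snd \<kappa>, k3) i \<nu>) * E_BC (fst \<kappa>, snd \<kappa>, k3) \<nu> z
      = E_BC (fst \<kappa>, snd \<kappa>, k3) (aff_refl i \<nu>) z) BC_filter"
    using eventually_BC_region[of 0]
  proof eventually_elim
    case (elim \<kappa>)
    then have "0 \<le> fst \<kappa>" "0 \<le> snd \<kappa>" by (auto simp: BC_region_def)
    from E_BC_aff_refl[OF i this k3] show ?case by (simp add: polydisc_def)
  qed
  show "uniform_limit (polydisc (length (aff_refl i \<nu>)) R) (\<lambda>(k1, k2). E_BC (k1, k2, k3) (aff_refl i \<nu>))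
     (\<lambda>z. simple_act i L z + of_real (limit_coeff k3 i \<nu>) * L z) BC_filter"
    unfolding P case_prod_unfold
    by (rule uniform_limit_cong[THEN iffD1, OF ev _ u]) simp
qed

lemma limit_function_zero:
  assumes "0 < n" "0 \<le> k3"
  shows "limit_function k3 (replicate n 0) (\<lambda>z. 1)"
  unfolding limit_function_def
proof (intro allI conjI)
  fix R
  show "bounded ((\<lambda>z. 1 :: complex) ` polydisc (length (replicate n (0 :: int))) R)"
    unfolding bounded_iff by auto
  have ev: "eventually (\<lambda>\<kappa>. \<forall>z\<in>polydisc (length (replicate n (0 :: int))) R.
      1 = E_BC (fst \<kappa>, snd \<kappa>, k3) (replicate n 0) z) BC_filter"
    using eventually_BC_region[of 0]
  proof eventually_elim
    case (elim \<kappa>)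
    then have "0 \<le> fst \<kappa>" "0 \<le> snd \<kappa>" by (auto simp: BC_region_def)
    from E_BC_zero[OF assms(1) this assms(2)] show ?case by simp
  qed
  show "uniform_limit (polydisc (length (replicate n (0 :: int))) R)
     (\<lambda>(k1, k2). E_BC (k1, k2, k3) (replicate n 0)) (\<lambda>z. 1) BC_filter"
    unfolding case_prod_unfold
    by (rule uniform_limit_cong[THEN iffD1, OF ev _ uniform_limit_const]) simp
qed

lemma limit_function_exists:
  assumes "length \<nu> = n" "0 < n" "0 \<le> k3"
  shows "\<exists>L. limit_function k3 \<nu> L"
  using assms(1,2)
proof (induction rule: raising_induct)
  case zero
  show ?case using limit_function_zero[OF assms(2,3)] by blast
next
  case (raise i \<mu>)
  then obtain L where "limit_function k3 \<mu> L" by blast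
  from limit_function_raise[OF this raise(3) _ _ assms(3)] raise(1,2) assms(2) show ?case by blast
qed

lemma E_BC_tendsto:
  assumes "length \<nu> = n" "length z = n" "0 < n" "0 \<le> k3"
  shows "((\<lambda>(k1, k2). E_BC (k1, k2, k3) \<nu> z) \<longlongrightarrow> E_BC_inf k3 \<nu> z) BC_filter"
proof -
  obtain L where L: "limit_function k3 \<nu> L"
    using limit_function_exists[OF assms(1,3,4)] by blast
  define R where "R = (\<Sum>w\<leftarrow>z. cmod w)"
  have "z \<in> polydisc (length \<nu>) R"
    using assms(1,2) by (auto simp: polydisc_def R_def intro!: member_le_sum_list)
  moreover have "uniform_limit (polydisc (length \<nu>) R) (\<lambda>(k1, k2). E_BC (k1, k2, k3) \<nu>) L BC_filter"
    using L unfolding limit_function_def by blast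
  ultimately have "((\<lambda>\<kappa>. (case \<kappa> of (k1, k2) \<Rightarrow> E_BC (k1, k2, k3) \<nu>) z) \<longlongrightarrow> L z) BC_filter"
    by (rule tendsto_uniform_limitI[rotated])
  then have t: "((\<lambda>(k1, k2). E_BC (k1, k2, k3) \<nu> z) \<longlongrightarrow> L z) BC_filter"
    by (simp add: case_prod_unfold)
  then have "E_BC_inf k3 \<nu> z = L z"
    unfolding E_BC_inf_def by (rule tendsto_Lim[OF BC_filter_neq_bot])
  with t show ?thesis by simp
qed

lemma E_BC_uniform_limit:
  assumes "length \<nu> = n" "0 < n" "0 \<le> k3"
  shows "uniform_limit (polydisc n R) (\<lambda>(k1, k2). E_BC (k1, k2, k3) \<nu>) (E_BC_inf k3 \<nu>) BC_filter"
proof -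
  obtain L where "limit_function k3 \<nu> L" using limit_function_exists[OF assms] by blast
  then have u: "uniform_limit (polydisc n R) (\<lambda>(k1, k2). E_BC (k1, k2, k3) \<nu>) L BC_filter"
    using assms(1) unfolding limit_function_def by blast
  have "L z = E_BC_inf k3 \<nu> z" if z: "z \<in> polydisc n R" for z
  proof -
    have "((\<lambda>\<kappa>. (case \<kappa> of (k1, k2) \<Rightarrow> E_BC (k1, k2, k3) \<nu>) z) \<longlongrightarrow> L z) BC_filter"
      using u z by (rule tendsto_uniform_limitI)
    moreover have "((\<lambda>\<kappa>. (case \<kappa> of (k1, k2) \<Rightarrow> E_BC (k1, k2, k3) \<nu>) z) \<longlongrightarrow> E_BC_inf k3 \<nu> z) BC_filter"
      using E_BC_tendsto[OF assms(1) _ assms(2,3)] z by (simp add: polydisc_def case_prod_unfold)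
    ultimately show ?thesis by (rule tendsto_unique[OF BC_filter_neq_bot])
  qed
  then show ?thesis
    by (intro uniform_limit_cong[THEN iffD1, OF _ _ u]) simp_all
qed

lemma E_BC_inf_zero:
  assumes "0 < n" "0 \<le> k3" "length z = n"
  shows "E_BC_inf k3 (replicate n 0) z = 1"
proof -
  have "eventually (\<lambda>\<kappa>. (case \<kappa> of (k1, k2) \<Rightarrow> E_BC (k1, k2, k3) (replicate n 0) z) = 1) BC_filter"
    using eventually_BC_region[of 0]
  proof eventually_elim
    case (elim \<kappa>)
    then show ?case using assms by (cases \<kappa>) (simp add: BC_region_def E_BC_zero)
  qed
  then have "((\<lambda>(k1, k2). E_BC (k1, k2, k3) (replicate n 0) z) \<longlongrightarrow> 1) BC_filter"
    by (rule tendsto_eventually)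
  then show ?thesis
    using E_BC_tendsto[of "replicate n 0" n z] assms tendsto_unique[OF BC_filter_neq_bot] by auto
qed

text \<open>
  The limiting recursion; all later statements about the limit functions follow from it and
  from the value at \<open>0\<close>.
\<close>

lemma E_BC_inf_aff_refl:
  assumes i: "raises i \<nu>" "i \<le> n" and n: "0 < n" "0 \<le> k3" "length \<nu> = n" "length z = n"
  shows "E_BC_inf k3 (aff_refl i \<nu>) z
    = simple_act i (E_BC_inf k3 \<nu>) z + of_real (limit_coeff k3 i \<nu>) * E_BC_inf k3 \<nu> z"
proof -
  have i': "i \<le> length \<nu>" "0 < length \<nu>" "length z = length \<nu>" using i n by simp_all
  have t: "((\<lambda>\<kappa>. E_BC (fst \<kappa>, snd \<kappa>, k3) \<nu> w) \<longlongrightarrow> E_BC_inf k3 \<nu> w) BC_filter" if "length w = n" for w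
    using E_BC_tendsto[OF n(3) that n(1,2)] by (simp add: case_prod_unfold)
  have c: "((\<lambda>\<kappa>. raise_coeff (fst \<kappa>, snd \<kappa>, k3) i \<nu>) \<longlongrightarrow> limit_coeff k3 i \<nu>) BC_filter"
    using raise_coeff_tendsto[OF i(1) i'(1,2), of k3] by (simp add: case_prod_unfold)
  have lz: "length (lin_refl i z) = n" using n by simp
  have "((\<lambda>\<kappa>. simple_act i (E_BC (fst \<kappa>, snd \<kappa>, k3) \<nu>) z
      + of_real (raise_coeff (fst \<kappa>, snd \<kappa>, k3) i \<nu>) * E_BC (fst \<kappa>, snd \<kappa>, k3) \<nu> z)
    \<longlongrightarrow> simple_act i (E_BC_inf k3 \<nu>) z + of_real (limit_coeff k3 i \<nu>) * E_BC_inf k3 \<nu> z) BC_filter"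
    unfolding simple_act_def by (intro tendsto_intros t c lz n)
  moreover have "eventually (\<lambda>\<kappa>. simple_act i (E_BC (fst \<kappa>, snd \<kappa>, k3) \<nu>) z
      + of_real (raise_coeff (fst \<kappa>, snd \<kappa>, k3) i \<nu>) * E_BC (fst \<kappa>, snd \<kappa>, k3) \<nu> z
      = E_BC (fst \<kappa>, snd \<kappa>, k3) (aff_refl i \<nu>) z) BC_filter"
    using eventually_BC_region[of 0]
  proof eventually_elim
    case (elim \<kappa>)
    then have "0 \<le> fst \<kappa>" "0 \<le> snd \<kappa>" by (auto simp: BC_region_def)
    from E_BC_aff_refl[OF i(1) i'(1,2) this n(2) i'(3)] show ?case by simp
  qed
  ultimately have "((\<lambda>\<kappa>. E_BC (fst \<kappa>, snd \<kappa>, k3) (aff_refl i \<nu>) z)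
    \<longlongrightarrow> simple_act i (E_BC_inf k3 \<nu>) z + of_real (limit_coeff k3 i \<nu>) * E_BC_inf k3 \<nu> z) BC_filter"
    by (rule Lim_transform_eventually)
  moreover have "((\<lambda>\<kappa>. E_BC (fst \<kappa>, snd \<kappa>, k3) (aff_refl i \<nu>) z) \<longlongrightarrow> E_BC_inf k3 (aff_refl i \<nu>) z) BC_filter"
    using E_BC_tendsto[of "aff_refl i \<nu>" n z k3] n by (simp add: case_prod_unfold)
  ultimately show ?thesis by (rule tendsto_unique[OF BC_filter_neq_bot, rotated])
qed

section \<open>The limit functions in list form\<close>

definition neg_list :: "nat list \<Rightarrow> int list" where
  "neg_list \<eta> = map (\<lambda>m. - int m) \<eta>"

lemma length_neg_list [simp]: "length (neg_list \<eta>) = length \<eta>"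
  by (simp add: neg_list_def)

lemma length_swap_adj [simp]: "length (swap_adj i x) = length x"
  by (simp add: swap_adj_def)

lemma map_swap_adj: "i < length x \<Longrightarrow> map f (swap_adj i x) = swap_adj i (map f x)"
  by (simp add: swap_adj_def map_update)

lemma swap_adj_append: "swap_adj (Suc (length xs)) (xs @ a # b # ys) = xs @ b # a # ys"
  by (induction xs) (simp_all add: swap_adj_def nth_append)

lemma E_BC_inf_swap:
  assumes "0 < i" "i < n" "\<nu> ! i < \<nu> ! (i - 1)" "length \<nu> = n" "length z = n" "0 \<le> k3"
  shows "E_BC_inf k3 (swap_adj i \<nu>) z
    = E_BC_inf k3 \<nu> (swap_adj i z) + of_real (limit_coeff k3 i \<nu>) * E_BC_inf k3 \<nu> z"
proof -
  have r: "raises i \<nu>" using assms by (simp add: raises_def)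
  have a: "aff_refl i \<nu> = swap_adj i \<nu>" "lin_refl i z = swap_adj i z"
    using assms aff_refl_eq_lin_refl[of i z] by (simp_all add: aff_refl_def)
  show ?thesis
    using E_BC_inf_aff_refl[OF r _ _ assms(6,4,5)] assms(1,2)
    by (simp add: a simple_act_def)
qed

lemma E_BC_inf_first:
  assumes "a \<le> 0" "length zs = length ys" "0 \<le> k3"
  shows "E_BC_inf k3 ((1 - a) # ys) (w # zs)
    = exp w * E_BC_inf k3 (a # ys) (- w # zs) + E_BC_inf k3 (a # ys) (w # zs)"
proof -
  have r: "raises 0 (a # ys)" using assms by (simp add: raises_def)
  have "E_BC_inf k3 (aff_refl 0 (a # ys)) (w # zs)
      = simple_act 0 (E_BC_inf k3 (a # ys)) (w # zs) + of_real (limit_coeff k3 0 (a # ys)) * E_BC_inf k3 (a # ys) (w # zs)"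
    using r assms by (intro E_BC_inf_aff_refl[where n = "Suc (length ys)"]) simp_all
  then show ?thesis
    by (simp add: aff_refl_def simple_act_def lin_refl_0_Cons limit_coeff_def)
qed

lemma E_BC_inf_last:
  assumes "0 < a" "length zs = length ys" "0 \<le> k3"
  shows "E_BC_inf k3 (ys @ [- a]) (zs @ [w])
    = E_BC_inf k3 (ys @ [a]) (zs @ [- w]) + E_BC_inf k3 (ys @ [a]) (zs @ [w])"
proof -
  let ?i = "Suc (length ys)" and ?\<nu> = "ys @ [a]"
  have r: "raises ?i ?\<nu>" using assms by (simp add: raises_def)
  have l: "lin_refl ?i (zs @ [w]) = zs @ [- w]"
    using lin_refl_last[of "zs @ [w]"] assms(2)
    by (simp add: list_update_append nth_append)
  have "E_BC_inf k3 (aff_refl ?i ?\<nu>) (zs @ [w])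
      = simple_act ?i (E_BC_inf k3 ?\<nu>) (zs @ [w]) + of_real (limit_coeff k3 ?i ?\<nu>) * E_BC_inf k3 ?\<nu> (zs @ [w])"
    using r assms by (intro E_BC_inf_aff_refl[where n = ?i]) simp_all
  then show ?thesis
    by (simp add: aff_refl_def simple_act_def l limit_coeff_def list_update_append)
qed

text \<open>
  The coefficient of the second term tends to \<open>0\<close>, so only the exchange of the variables remains.
\<close>

lemma E_BC_inf_mixed_swap:
  assumes "0 < a" "b \<le> 0" "length zx = length xs" "length zy = length ys" "0 \<le> k3"
  shows "E_BC_inf k3 (xs @ b # a # ys) (zx @ v # w # zy) = E_BC_inf k3 (xs @ a # b # ys) (zx @ w # v # zy)"
proof -
  let ?i = "Suc (length xs)" and ?\<nu> = "xs @ a # b # ys" and ?z = "zx @ v # w # zy"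
  have "E_BC_inf k3 (swap_adj ?i ?\<nu>) ?z
    = E_BC_inf k3 ?\<nu> (swap_adj ?i ?z) + of_real (limit_coeff k3 ?i ?\<nu>) * E_BC_inf k3 ?\<nu> ?z"
    using assms by (intro E_BC_inf_swap[where n = "length ?\<nu>"]) (simp_all add: nth_append)
  moreover have "limit_coeff k3 ?i ?\<nu> = 0"
    using assms(1,2) by (simp add: limit_coeff_def nth_append)
  ultimately show ?thesis
    using swap_adj_append[of zx v w zy] assms(3) by (simp add: swap_adj_append)
qed

lemma E_BC_inf_move_front:
  assumes "0 < a" "\<forall>b\<in>set xs. b \<le> 0" "length zx = length xs" "length zy = length ys" "0 \<le> k3"
  shows "E_BC_inf k3 (xs @ a # ys) (zx @ w # zy) = E_BC_inf k3 (a # xs @ ys) (w # zx @ zy)"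
  using assms
proof (induction xs arbitrary: ys zx zy rule: rev_induct)
  case (snoc b xs)
  obtain zx' v where zx: "zx = zx' @ [v]" "length zx' = length xs"
    using snoc.prems(3) by (cases zx rule: rev_cases) auto
  have "E_BC_inf k3 ((xs @ [b]) @ a # ys) (zx @ w # zy) = E_BC_inf k3 (xs @ a # b # ys) (zx' @ w # v # zy)"
    using snoc.prems zx by (simp add: E_BC_inf_mixed_swap)
  also have "\<dots> = E_BC_inf k3 (a # xs @ b # ys) (w # zx' @ v # zy)"
    using snoc.prems zx by (intro snoc.IH) simp_all
  finally show ?case using zx by simp
qed simp

text \<open>
  The word \<open>s\<^sub>n s\<^bsub>n-1\<^esub> \<cdots> s\<^sub>1 s\<^sub>0\<close> takes \<open>-\<eta>\<close> to \<open>-\<Phi>\<eta>\<close>. By evenness \<open>s\<^sub>0\<close> contributes the factor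
  \<open>exp w + 1\<close>, the exchanges move the positive entry to the end, and \<open>s\<^sub>n\<close> adds the value at \<open>-w\<close>.
  The result is the factor \<open>2 + exp w + exp (-w)\<close>.
\<close>

lemma E_BC_inf_Phi:
  assumes even: "\<And>w zs. length zs = length ms \<Longrightarrow>
      E_BC_inf k3 (neg_list (m # ms)) (- w # zs) = E_BC_inf k3 (neg_list (m # ms)) (w # zs)"
    and l: "length zs = length ms" and k3: "0 \<le> k3"
  shows "E_BC_inf k3 (neg_list (ms @ [Suc m])) (zs @ [w])
    = (2 + 2 * cosh w) * E_BC_inf k3 (neg_list (m # ms)) (w # zs)"
proof -
  let ?a = "1 + int m"
  have step: "E_BC_inf k3 (neg_list ms @ [?a]) (zs @ [u]) = (exp u + 1) * E_BC_inf k3 (neg_list (m # ms)) (u # zs)" for u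
  proof -
    have "E_BC_inf k3 (neg_list ms @ [?a]) (zs @ [u]) = E_BC_inf k3 ((1 - (- int m)) # neg_list ms) (u # zs)"
      using E_BC_inf_move_front[of ?a "neg_list ms" zs "[]" "[]" k3 u] l k3 by (simp add: neg_list_def)
    also have "\<dots> = exp u * E_BC_inf k3 (- int m # neg_list ms) (- u # zs) + E_BC_inf k3 (- int m # neg_list ms) (u # zs)"
      using l k3 by (intro E_BC_inf_first) simp_all
    finally show ?thesis using even[OF l, of u] by (simp add: neg_list_def algebra_simps)
  qed
  have e: "neg_list (ms @ [Suc m]) = neg_list ms @ [- ?a]" by (simp add: neg_list_def)
  have "E_BC_inf k3 (neg_list (ms @ [Suc m])) (zs @ [w])
      = E_BC_inf k3 (neg_list ms @ [?a]) (zs @ [- w]) + E_BC_inf k3 (neg_list ms @ [?a]) (zs @ [w])"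
    unfolding e using l k3 by (intro E_BC_inf_last) simp_all
  also have "\<dots> = (2 + (exp w + exp (- w))) * E_BC_inf k3 (neg_list (m # ms)) (w # zs)"
    unfolding step even[OF l] by (simp add: algebra_simps)
  also have "exp w + exp (- w) = 2 * cosh w"
    by (simp add: cosh_def scaleR_conv_of_real)
  finally show ?thesis .
qed

section \<open>Induction on compositions\<close>

text \<open>
  The sum \<open>n x\<^sub>1 + (n - 1) x\<^sub>2 + \<dots> + x\<^sub>n\<close>, which decreases when a larger entry moves to the right.
\<close>

fun head_weight :: "nat list \<Rightarrow> nat" where
  "head_weight [] = 0"
| "head_weight (a # xs) = Suc (length xs) * a + head_weight xs"

lemma head_weight_swap: "a < b \<Longrightarrow> head_weight (xs @ a # b # ys) < head_weight (xs @ b # a # ys)"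
  by (induction xs) (simp_all add: algebra_simps)

lemma not_sorted_descent:
  fixes xs :: "'a::linorder list"
  assumes "\<not> sorted xs"
  obtains as a b bs where "xs = as @ b # a # bs" "a < b"
proof -
  obtain i where i: "Suc i < length xs" "xs ! Suc i < xs ! i"
    using assms by (auto simp: sorted_iff_nth_Suc not_le)
  have "xs = take i xs @ xs ! i # xs ! Suc i # drop (Suc (Suc i)) xs"
    using i(1) by (metis Cons_nth_drop_Suc Suc_lessD append_take_drop_id)
  with i(2) that show thesis by blast
qed

text \<open>
  A composition with a positive last entry is a \<open>\<Phi>\<eta>\<close>. Otherwise it is zero or has a descent, and is
  obtained by an exchange.
\<close>

lemma composition_induct [consumes 2, case_names zero Phi swap]:
  assumes "length \<eta> = n" "0 < n"
    and zero: "P (replicate n 0)"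
    and Phi: "\<And>m ms. Suc (length ms) = n \<Longrightarrow> P (m # ms) \<Longrightarrow> P (ms @ [Suc m])"
    and swap: "\<And>xs a b ys. Suc (Suc (length xs + length ys)) = n \<Longrightarrow> a < b \<Longrightarrow>
      P (xs @ a # b # ys) \<Longrightarrow> P (xs @ b # a # ys)"
  shows "P \<eta>"
  using assms(1)
proof (induction \<eta> rule: wf_induct_rule[OF wf_measures[of "[sum_list, head_weight]"]])
  case (1 \<eta>)
  obtain ms l where \<eta>: "\<eta> = ms @ [l]" using 1(2) \<open>0 < n\<close> by (cases \<eta> rule: rev_cases) auto
  show ?case
  proof (cases l)
    case (Suc m)
    have "P (m # ms)" using 1(2) by (intro 1(1)) (simp_all add: \<eta> Suc)
    then show ?thesis using Phi[of ms m] 1(2) by (simp add: \<eta> Suc)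
  next
    case 0
    show ?thesis
    proof (cases "sorted \<eta>")
      case True
      then have "\<forall>x\<in>set \<eta>. x = 0" by (simp add: \<eta> 0 sorted_append)
      then have "\<eta> = replicate n 0" using 1(2) by (simp add: list_eq_iff_nth_eq)
      then show ?thesis using zero by simp
    next
      case False
      then obtain xs a b ys where e: "\<eta> = xs @ b # a # ys" "a < b" by (rule not_sorted_descent)
      have "P (xs @ a # b # ys)"
        using 1(2) head_weight_swap[OF e(2), of xs ys] by (intro 1(1)) (simp_all add: e(1))
      then show ?thesis using swap[of xs ys a b] 1(2) e(2) by (simp add: e(1))
    qed
  qed
qed

lemma E_BC_inf_swap_neg:
  assumes "a < b" "length z = Suc (Suc (length xs + length ys))" "0 \<le> k3"
  shows "E_BC_inf k3 (neg_list (xs @ b # a # ys)) z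
    = E_BC_inf k3 (neg_list (xs @ a # b # ys)) (swap_adj (Suc (length xs)) z)
      + of_real (limit_coeff k3 (Suc (length xs)) (neg_list (xs @ a # b # ys)))
        * E_BC_inf k3 (neg_list (xs @ a # b # ys)) z"
proof -
  let ?\<nu> = "neg_list (xs @ a # b # ys)" and ?i = "Suc (length xs)"
  have s: "neg_list (xs @ b # a # ys) = swap_adj ?i ?\<nu>"
    using swap_adj_append[of "neg_list xs" "- int a" "- int b" "neg_list ys"] by (simp add: neg_list_def)
  show ?thesis
    unfolding s using assms
    by (intro E_BC_inf_swap[where n = "length ?\<nu>"]) (simp_all add: neg_list_def nth_append)
qed

text \<open>
  By induction along the two recursions; the evenness that the step \<open>\<Phi>\<close> needs is part of the induction
  hypothesis. In particular these limits are even and \<open>2 \<pi> \<i>\<close>-periodic in each variable.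
\<close>

lemma E_BC_inf_neg_cosh:
  assumes "length \<eta> = n" "0 < n" "0 \<le> k3"
  shows "length z = n \<Longrightarrow> length z' = n \<Longrightarrow> map cosh z = map cosh z' \<Longrightarrow>
    E_BC_inf k3 (neg_list \<eta>) z = E_BC_inf k3 (neg_list \<eta>) z'"
  using assms(1,2)
proof (induction arbitrary: z z' rule: composition_induct)
  case zero
  have "neg_list (replicate n 0) = replicate n 0" by (simp add: neg_list_def)
  then show ?case using zero assms(2,3) by (simp add: E_BC_inf_zero)
next
  case (Phi m ms)
  have even: "E_BC_inf k3 (neg_list (m # ms)) (- w # zs) = E_BC_inf k3 (neg_list (m # ms)) (w # zs)"
    if "length zs = length ms" for w zs
    using that Phi(1) by (intro Phi.IH) simp_all
  obtain zs w where z: "z = zs @ [w]" using Phi.prems(1) assms(2) by (cases z rule: rev_cases) auto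
  obtain zs' w' where z': "z' = zs' @ [w']" using Phi.prems(2) assms(2) by (cases z' rule: rev_cases) auto
  have l: "length zs = length ms" "length zs' = length ms" using Phi z z' by simp_all
  have c: "map cosh zs = map cosh zs'" "cosh w = cosh w'" using Phi.prems(3) z z' by simp_all
  have "E_BC_inf k3 (neg_list (m # ms)) (w # zs) = E_BC_inf k3 (neg_list (m # ms)) (w' # zs')"
    using l c Phi(1) by (intro Phi.IH) simp_all
  moreover have "E_BC_inf k3 (neg_list (ms @ [Suc m])) (zs @ [w])
      = (2 + 2 * cosh w) * E_BC_inf k3 (neg_list (m # ms)) (w # zs)"
    using even l(1) assms(3) by (rule E_BC_inf_Phi)
  moreover have "E_BC_inf k3 (neg_list (ms @ [Suc m])) (zs' @ [w'])
      = (2 + 2 * cosh w') * E_BC_inf k3 (neg_list (m # ms)) (w' # zs')"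
    using even l(2) assms(3) by (rule E_BC_inf_Phi)
  ultimately show ?case unfolding z z' c(2) by simp
next
  case (swap xs a b ys)
  have i: "Suc (length xs) < length z" "Suc (length xs) < length z'" using swap by simp_all
  have l: "length z = Suc (Suc (length xs + length ys))" "length z' = Suc (Suc (length xs + length ys))"
    using swap by simp_all
  have "E_BC_inf k3 (neg_list (xs @ a # b # ys)) (swap_adj (Suc (length xs)) z)
      = E_BC_inf k3 (neg_list (xs @ a # b # ys)) (swap_adj (Suc (length xs)) z')"
    using swap.prems i by (intro swap.IH) (simp_all add: map_swap_adj)
  moreover have "E_BC_inf k3 (neg_list (xs @ a # b # ys)) z = E_BC_inf k3 (neg_list (xs @ a # b # ys)) z'"
    using swap.prems by (intro swap.IH)
  ultimately show ?case
    unfolding E_BC_inf_swap_neg[OF swap(2) l(1) assms(3)] E_BC_inf_swap_neg[OF swap(2) l(2) assms(3)] by simp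
qed

section \<open>The limit coefficients of compositions\<close>

lemma two_term_middle_inj:
  assumes "p < q" "q < n" "p' < q'" "q' < n" "e \<noteq> 0" "e' \<noteq> 0"
    and eq: "two_term n 1 p e q = two_term n 1 p' e' q'"
  shows "p = p' \<and> e = e' \<and> q = q'"
proof -
  have nz: "k = p \<or> k = q \<longleftrightarrow> k = p' \<or> k = q'" if "k < n" for k
  proof -
    have "two_term n 1 p e q ! k \<noteq> 0 \<longleftrightarrow> k = p \<or> k = q"
      using assms(1,2,5) that by (auto simp: nth_two_term)
    moreover have "two_term n 1 p' e' q' ! k \<noteq> 0 \<longleftrightarrow> k = p' \<or> k = q'"
      using assms(3,4,6) that by (auto simp: nth_two_term)
    ultimately show ?thesis unfolding eq by blast
  qed
  have pq: "p = p'" "q = q'" using nz[of p] nz[of q] nz[of p'] nz[of q'] assms(1-4) by auto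
  have "two_term n 1 p e q ! q = two_term n 1 p' e' q' ! q" using eq by simp
  then show ?thesis using pq assms by (simp add: nth_two_term)
qed

lemma sum_middle_roots:
  fixes g :: "int list \<Rightarrow> real"
  shows "(\<Sum>\<alpha>\<in>middle_roots n. g \<alpha>)
    = (\<Sum>p<n. \<Sum>q<n. if p < q then g (two_term n 1 p 1 q) + g (two_term n 1 p (-1) q) else 0)"
proof -
  let ?D = "Sigma {..<n} (\<lambda>p. {p<..<n})"
  have mr: "middle_roots n = (\<lambda>(p, q). two_term n 1 p 1 q) ` ?D \<union> (\<lambda>(p, q). two_term n 1 p (-1) q) ` ?D"
    (is "_ = ?A \<union> ?B")
  proof (intro equalityI subsetI)
    fix \<alpha> assume "\<alpha> \<in> middle_roots n"
    then obtain i e j where m: "i < j" "j < n" "e = 1 \<or> e = -1" "\<alpha> = two_term n 1 i e j"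
      by (rule middle_rootsE)
    then have "(i, j) \<in> ?D" by simp
    then have "two_term n 1 i 1 j \<in> ?A" "two_term n 1 i (-1) j \<in> ?B"
      by (rule rev_image_eqI, simp)+
    with m(3,4) show "\<alpha> \<in> ?A \<union> ?B" by blast
  next
    have mem: "two_term n 1 p e q \<in> middle_roots n" if "p < q" "q < n" "e = 1 \<or> e = -1" for p e q
      using that unfolding middle_roots_eq by blast
    fix \<alpha> assume "\<alpha> \<in> ?A \<union> ?B"
    then show "\<alpha> \<in> middle_roots n"
      by (elim UnE imageE SigmaE) (simp_all add: mem)
  qed
  have inj: "inj_on (\<lambda>(p, q). two_term n 1 p e q) ?D" if e: "e \<noteq> 0" for e
  proof (rule inj_onI)
    fix u v assume uv: "u \<in> ?D" "v \<in> ?D"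
      "(case u of (p, q) \<Rightarrow> two_term n 1 p e q) = (case v of (p, q) \<Rightarrow> two_term n 1 p e q)"
    obtain p q p' q' where u: "u = (p, q)" and v: "v = (p', q')" by (metis surj_pair)
    have "p < q" "q < n" "p' < q'" "q' < n" using uv(1,2) by (simp_all add: u v)
    from two_term_middle_inj[OF this e e] uv(3) show "u = v" by (simp add: u v)
  qed
  have disj: "?A \<inter> ?B = {}"
  proof (rule ccontr)
    assume "?A \<inter> ?B \<noteq> {}"
    then obtain \<alpha> where "\<alpha> \<in> ?A" "\<alpha> \<in> ?B" by blast
    then obtain u v where uv: "u \<in> ?D" "v \<in> ?D" "\<alpha> = (case u of (p, q) \<Rightarrow> two_term n 1 p 1 q)"
      "\<alpha> = (case v of (p, q) \<Rightarrow> two_term n 1 p (-1) q)"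
      by blast
    obtain p q p' q' where u: "u = (p, q)" and v: "v = (p', q')" by (metis surj_pair)
    have "p < q" "q < n" "p' < q'" "q' < n" using uv(1,2) by (simp_all add: u v)
    moreover have "two_term n 1 p 1 q = two_term n 1 p' (-1) q'" using uv(3,4) by (simp add: u v)
    ultimately show False using two_term_middle_inj[of p q n p' q' 1 "-1"] by simp
  qed
  have "(\<Sum>\<alpha>\<in>middle_roots n. g \<alpha>) = (\<Sum>\<alpha>\<in>?A. g \<alpha>) + (\<Sum>\<alpha>\<in>?B. g \<alpha>)"
    unfolding mr using disj by (intro sum.union_disjoint) auto
  also have "\<dots> = (\<Sum>(p, q)\<in>?D. g (two_term n 1 p 1 q)) + (\<Sum>(p, q)\<in>?D. g (two_term n 1 p (-1) q))"
    using inj[of 1] inj[of "-1"] by (simp add: sum.reindex case_prod_unfold)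
  also have "\<dots> = (\<Sum>p<n. \<Sum>q\<in>{p<..<n}. g (two_term n 1 p 1 q) + g (two_term n 1 p (-1) q))"
    by (simp add: sum.distrib flip: sum.Sigma)
  also have "\<dots> = (\<Sum>p<n. \<Sum>q<n. if p < q then g (two_term n 1 p 1 q) + g (two_term n 1 p (-1) q) else 0)"
    by (intro sum.cong refl sum.mono_neutral_cong_left) auto
  finally show ?thesis .
qed

lemma middle_shift_neg:
  assumes "j < length \<eta>"
  shows "middle_shift (neg_list \<eta>) j
    = - real (card {p. p < j \<and> \<eta> ! p < \<eta> ! j}) - real (card {q. j < q \<and> q < length \<eta> \<and> \<eta> ! q \<le> \<eta> ! j})"
proof -
  let ?n = "length \<eta>"
  define g where "g \<alpha> = sgn_strict (dot \<alpha> (neg_list \<eta>)) * of_int (\<alpha> ! j)" for \<alpha>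
  have d: "dot (two_term ?n 1 p e q) (neg_list \<eta>) = - int (\<eta> ! p) - e * int (\<eta> ! q)" if "p < ?n" "q < ?n" for p q e
    using that by (simp add: dot_two_term_int neg_list_def)
  have pair: "(if p < q then g (two_term ?n 1 p 1 q) + g (two_term ?n 1 p (-1) q) else 0)
    = (if p = j then (if j < q \<and> \<eta> ! q \<le> \<eta> ! j then -2 else 0) else 0)
      + (if q = j then (if p < j \<and> \<eta> ! p < \<eta> ! j then -2 else 0) else 0)"
    if "p < ?n" "q < ?n" for p q
    using that assms by (auto simp: g_def d nth_two_term sgn_strict_def)
  have "(\<Sum>\<alpha>\<in>middle_roots ?n. g \<alpha>) = (\<Sum>p<?n. \<Sum>q<?n.
      (if p = j then (if j < q \<and> \<eta> ! q \<le> \<eta> ! j then -2 else 0) else 0)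
      + (if q = j then (if p < j \<and> \<eta> ! p < \<eta> ! j then -2 else 0) else 0))"
    unfolding sum_middle_roots by (intro sum.cong refl) (use pair in simp)
  also have "\<dots> = (\<Sum>p<?n. if p = j then (\<Sum>q<?n. if j < q \<and> \<eta> ! q \<le> \<eta> ! j then -2 else 0) else 0)
      + (\<Sum>p<?n. if p < j \<and> \<eta> ! p < \<eta> ! j then -2 else 0)"
    unfolding sum.distrib
  proof (intro arg_cong2[of _ _ _ _ plus] sum.cong refl)
    fix p assume "p \<in> {..<?n}"
    show "(\<Sum>q<?n. if p = j then (if j < q \<and> \<eta> ! q \<le> \<eta> ! j then -2 else 0 :: real) else 0)
      = (if p = j then (\<Sum>q<?n. if j < q \<and> \<eta> ! q \<le> \<eta> ! j then -2 else 0) else 0)"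
      by simp
    show "(\<Sum>q<?n. if q = j then (if p < j \<and> \<eta> ! p < \<eta> ! j then -2 else 0 :: real) else 0)
      = (if p < j \<and> \<eta> ! p < \<eta> ! j then -2 else 0)"
      using assms by simp
  qed
  also have "(\<Sum>p<?n. if p = j then (\<Sum>q<?n. if j < q \<and> \<eta> ! q \<le> \<eta> ! j then -2 else 0 :: real) else 0)
      = - 2 * real (card {q. j < q \<and> q < ?n \<and> \<eta> ! q \<le> \<eta> ! j})"
  proof -
    have "{..<?n} \<inter> {q. j < q \<and> \<eta> ! q \<le> \<eta> ! j} = {q. j < q \<and> q < ?n \<and> \<eta> ! q \<le> \<eta> ! j}" by auto
    then show ?thesis using assms by (simp add: sum.If_cases)
  qed
  also have "(\<Sum>p<?n. if p < j \<and> \<eta> ! p < \<eta> ! j then -2 else 0 :: real)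
      = - 2 * real (card {p. p < j \<and> \<eta> ! p < \<eta> ! j})"
  proof -
    have "{..<?n} \<inter> {p. p < j \<and> \<eta> ! p < \<eta> ! j} = {p. p < j \<and> \<eta> ! p < \<eta> ! j}" using assms by auto
    then show ?thesis by (simp add: sum.If_cases)
  qed
  finally show ?thesis by (simp add: middle_shift_def g_def[abs_def])
qed

lemma nth_eta_bar:
  assumes "j < length \<eta>"
  shows "eta_bar k \<eta> ! j = real (\<eta> ! j) - k * real (length \<eta> - 1) - k * middle_shift (neg_list \<eta>) j"
proof -
  let ?n = "length \<eta>"
  let ?C = "{p. p < j \<and> \<eta> ! j \<le> \<eta> ! p}" and ?D = "{p. p < j \<and> \<eta> ! p < \<eta> ! j}"
  have "card {..<j} = card (?C \<union> ?D)" by (rule arg_cong[of _ _ card]) auto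
  also have "\<dots> = card ?C + card ?D"
    by (intro card_Un_disjoint) auto
  finally have 1: "real j = real (card ?C) + real (card ?D)" by simp
  let ?A = "{q. j < q \<and> q < ?n \<and> \<eta> ! j < \<eta> ! q}" and ?B = "{q. j < q \<and> q < ?n \<and> \<eta> ! q \<le> \<eta> ! j}"
  have "card {j<..<?n} = card (?A \<union> ?B)" by (rule arg_cong[of _ _ card]) auto
  also have "\<dots> = card ?A + card ?B"
    by (intro card_Un_disjoint) auto
  finally have 2: "real (?n - Suc j) = real (card ?A) + real (card ?B)" by simp
  have 3: "real (?n - 1) = real j + real (?n - Suc j)" using assms by simp
  have "eta_bar k \<eta> ! j = real (\<eta> ! j) - k * real (card ?C) - k * real (card ?A)"
    using assms by (simp add: eta_bar_def)
  then show ?thesis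
    unfolding middle_shift_neg[OF assms] 3 1 2 by (simp add: algebra_simps)
qed

text \<open>
  At \<open>-\<eta>\<close> the spectral coordinates are the negatives of the numbers \<open>eta_bar\<close> up to a common constant, so the
  limiting coefficient is the constant in the Jack recursion.
\<close>

lemma limit_coeff_neg:
  assumes "0 < i" "i < length \<eta>"
  shows "limit_coeff k i (neg_list \<eta>) = k / (eta_bar k \<eta> ! i - eta_bar k \<eta> ! (i - 1))"
proof -
  have l: "i - 1 < length \<eta>" using assms by simp
  have "neg_list \<eta> ! j = - int (\<eta> ! j)" if "j < length \<eta>" for j
    using that by (simp add: neg_list_def)
  then show ?thesis
    using assms l by (simp add: limit_coeff_def nth_eta_bar algebra_simps)
qed

section \<open>Non-symmetric Jack polynomials from the limit\<close>

text \<open>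
  A solution \<open>u\<close> of \<open>cosh\<^sup>2 (u / 2) = w\<close>. Which one is chosen does not matter for functions that depend
  on \<open>cosh u\<close> only.
\<close>

definition arcosh_pre :: "complex \<Rightarrow> complex" where
  "arcosh_pre w = \<i> * Arccos (2 * w - 1)"

lemma cosh_arcosh_pre: "cosh (arcosh_pre w) = 2 * w - 1"
  unfolding arcosh_pre_def cosh_conv_cos complex_i_mult_minus cos_minus cos_Arccos ..

text \<open>
  The limit function of \<open>-\<eta>\<close>, normalised and read in the variables \<open>y\<^sub>j = cosh\<^sup>2 (z\<^sub>j / 2)\<close>.
\<close>

definition jack_limit :: "real \<Rightarrow> nat list \<Rightarrow> complex list \<Rightarrow> complex" where
  "jack_limit k \<eta> y = E_BC_inf k (neg_list \<eta>) (map arcosh_pre y) / 4 ^ sum_list \<eta>"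

lemma E_BC_inf_eq_jack_limit:
  assumes "length \<eta> = n" "0 < n" "0 \<le> k3" "length z = n"
  shows "E_BC_inf k3 (neg_list \<eta>) z = 4 ^ sum_list \<eta> * jack_limit k3 \<eta> (map (\<lambda>w. (1 + cosh w) / 2) z)"
proof -
  have "E_BC_inf k3 (neg_list \<eta>) z = E_BC_inf k3 (neg_list \<eta>) (map arcosh_pre (map (\<lambda>w. (1 + cosh w) / 2) z))"
    using assms by (intro E_BC_inf_neg_cosh) (simp_all add: cosh_arcosh_pre field_simps)
  then show ?thesis by (simp add: jack_limit_def)
qed

lemma swap_adj_decompose:
  assumes "1 \<le> i" "i < length \<eta>"
  obtains xs ys where "\<eta> = xs @ \<eta> ! (i - 1) # \<eta> ! i # ys" "length xs = i - 1"
    "swap_adj i \<eta> = xs @ \<eta> ! i # \<eta> ! (i - 1) # ys"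
proof -
  let ?xs = "take (i - 1) \<eta>" and ?ys = "drop (Suc i) \<eta>"
  have "drop (i - 1) \<eta> = \<eta> ! (i - 1) # drop i \<eta>"
    using assms by (metis Cons_nth_drop_Suc Suc_diff_1 less_imp_diff_less less_le_trans zero_less_one)
  moreover have "drop i \<eta> = \<eta> ! i # ?ys" using assms by (simp add: Cons_nth_drop_Suc)
  ultimately have e: "\<eta> = ?xs @ \<eta> ! (i - 1) # \<eta> ! i # ?ys" by (metis append_take_drop_id)
  have l: "length ?xs = i - 1" using assms by simp
  have "swap_adj (Suc (length ?xs)) (?xs @ \<eta> ! (i - 1) # \<eta> ! i # ?ys) = ?xs @ \<eta> ! i # \<eta> ! (i - 1) # ?ys"
    by (rule swap_adj_append)
  then have "swap_adj i \<eta> = ?xs @ \<eta> ! i # \<eta> ! (i - 1) # ?ys"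
    using e l assms(1) by simp
  with e l that show thesis by blast
qed

lemma jack_family_unique:
  assumes E: "jack_family n k E" and F: "jack_family n k F" and n: "0 < n"
  shows "E = F"
proof (intro ext)
  fix \<eta> y
  show "E \<eta> y = F \<eta> y"
  proof (cases "length \<eta> = n \<and> length y = n")
    case False
    then show ?thesis using E F unfolding jack_family_def by metis
  next
    case True
    then have l: "length \<eta> = n" and ly: "length y = n" by simp_all
    from l n ly show ?thesis
    proof (induction arbitrary: y rule: composition_induct)
      case zero
      then show ?case using E F unfolding jack_family_def by simp
    next
      case (Phi m ms)
      have *: "G (ms @ [Suc m]) y = last y * G (m # ms) (last y # butlast y)" if "jack_family n k G" for G
      proof -
        have "\<forall>\<eta> y. length \<eta> = n \<and> length y = n \<longrightarrow> G (jack_Phi \<eta>) y = last y * G \<eta> (last y # butlast y)"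
          using that unfolding jack_family_def by blast
        then have "G (jack_Phi (m # ms)) y = last y * G (m # ms) (last y # butlast y)"
          using Phi(1) Phi.prems by simp
        then show ?thesis by (simp add: jack_Phi_def)
      qed
      have "length (last y # butlast y) = n" using Phi.prems n by simp
      then show ?case unfolding *[OF E] *[OF F] using Phi.IH by simp
    next
      case (swap xs a b ys)
      let ?i = "Suc (length xs)" and ?\<eta> = "xs @ a # b # ys"
      have *: "G (xs @ b # a # ys) y = G ?\<eta> (swap_adj ?i y)
          + of_real (k / (eta_bar k ?\<eta> ! ?i - eta_bar k ?\<eta> ! (?i - 1))) * G ?\<eta> y"
        if "jack_family n k G" for G
      proof -
        have "\<forall>\<eta> y i. length \<eta> = n \<and> length y = n \<and> 1 \<le> i \<and> i < n \<and> \<eta> ! (i - 1) < \<eta> ! i \<longrightarrow>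
          G (swap_adj i \<eta>) y = G \<eta> (swap_adj i y)
            + of_real (k / (eta_bar k \<eta> ! i - eta_bar k \<eta> ! (i - 1))) * G \<eta> y"
          using that unfolding jack_family_def by blast
        moreover have "length ?\<eta> = n \<and> length y = n \<and> 1 \<le> ?i \<and> ?i < n \<and> ?\<eta> ! (?i - 1) < ?\<eta> ! ?i"
          using swap by (simp add: nth_append)
        ultimately have "G (swap_adj ?i ?\<eta>) y = G ?\<eta> (swap_adj ?i y)
            + of_real (k / (eta_bar k ?\<eta> ! ?i - eta_bar k ?\<eta> ! (?i - 1))) * G ?\<eta> y"
          by blast
        then show ?thesis unfolding swap_adj_append .
      qed
      show ?case unfolding *[OF E] *[OF F] using swap.IH[of y] swap.IH[of "swap_adj ?i y"] swap.prems by simp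
    qed
  qed
qed

lemma jack_limit_Phi:
  assumes "length ys = length ms" "0 \<le> k3"
  shows "jack_limit k3 (ms @ [Suc m]) (ys @ [v]) = v * jack_limit k3 (m # ms) (v # ys)"
proof -
  have "E_BC_inf k3 (neg_list (m # ms)) (- w # zs) = E_BC_inf k3 (neg_list (m # ms)) (w # zs)"
    if "length zs = length ms" for w zs
    using that assms(2) by (intro E_BC_inf_neg_cosh) simp_all
  then have "E_BC_inf k3 (neg_list (ms @ [Suc m])) (map arcosh_pre ys @ [arcosh_pre v])
    = (2 + 2 * cosh (arcosh_pre v)) * E_BC_inf k3 (neg_list (m # ms)) (arcosh_pre v # map arcosh_pre ys)"
    using assms by (intro E_BC_inf_Phi) simp_all
  then show ?thesis by (simp add: jack_limit_def cosh_arcosh_pre add.commute)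
qed

text \<open>
  The limit functions satisfy the defining recursions, and this proves that a Jack family exists.
\<close>

lemma jack_family_limit:
  assumes n: "0 < n" and k3: "0 \<le> k3"
  shows "jack_family n k3 (\<lambda>\<eta> y. if length \<eta> = n \<and> length y = n then jack_limit k3 \<eta> y else 0)"
    (is "jack_family n k3 ?E")
  unfolding jack_family_def
proof (intro conjI allI impI)
  fix \<eta> :: "nat list" and y :: "complex list" assume "length \<eta> \<noteq> n \<or> length y \<noteq> n"
  then show "?E \<eta> y = 0" by auto
next
  fix y :: "complex list" assume l: "length y = n"
  have "neg_list (replicate n 0) = replicate n 0" by (simp add: neg_list_def)
  then show "?E (replicate n 0) y = 1"
    using l n k3 E_BC_inf_zero[of n k3 "map arcosh_pre y"] by (simp add: jack_limit_def sum_list_replicate)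
next
  fix \<eta> :: "nat list" and y :: "complex list" assume l: "length \<eta> = n \<and> length y = n"
  then obtain m ms where \<eta>: "\<eta> = m # ms" using n by (cases \<eta>) auto
  obtain ys v where y: "y = ys @ [v]" using l n by (cases y rule: rev_cases) auto
  have "length ys = length ms" using l by (simp add: \<eta> y)
  from jack_limit_Phi[OF this k3]
  show "?E (jack_Phi \<eta>) y = last y * ?E \<eta> (last y # butlast y)"
    using l by (simp add: \<eta> y jack_Phi_def)
next
  fix \<eta> :: "nat list" and y :: "complex list" and i
  assume *: "length \<eta> = n \<and> length y = n \<and> 1 \<le> i \<and> i < n \<and> \<eta> ! (i - 1) < \<eta> ! i"
  then have i: "1 \<le> i" "i < length \<eta>" "0 < i" by simp_all
  obtain xs ys where e: "\<eta> = xs @ \<eta> ! (i - 1) # \<eta> ! i # ys" "length xs = i - 1"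
    "swap_adj i \<eta> = xs @ \<eta> ! i # \<eta> ! (i - 1) # ys"
    using swap_adj_decompose[OF i(1,2)] by blast
  have len: "length (map arcosh_pre y) = Suc (Suc (length xs + length ys))"
    using * arg_cong[OF e(1), of length] by simp
  have s: "Suc (length xs) = i" using e(2) i by simp
  have sl: "sum_list (swap_adj i \<eta>) = sum_list \<eta>"
  proof -
    have "sum_list (swap_adj i \<eta>) = sum_list (xs @ \<eta> ! (i - 1) # \<eta> ! i # ys)" by (simp add: e(3))
    also have "\<dots> = sum_list \<eta>" by (rule arg_cong[OF e(1)[symmetric]])
    finally show ?thesis .
  qed
  have "E_BC_inf k3 (neg_list (swap_adj i \<eta>)) (map arcosh_pre y)
    = E_BC_inf k3 (neg_list \<eta>) (swap_adj i (map arcosh_pre y))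
      + of_real (limit_coeff k3 i (neg_list \<eta>)) * E_BC_inf k3 (neg_list \<eta>) (map arcosh_pre y)"
    using E_BC_inf_swap_neg[of "\<eta> ! (i - 1)" "\<eta> ! i" "map arcosh_pre y" xs ys k3] * len k3
    unfolding e(3)[symmetric] e(1)[symmetric] s by simp
  moreover have "swap_adj i (map arcosh_pre y) = map arcosh_pre (swap_adj i y)"
    using * by (simp add: map_swap_adj)
  ultimately show "?E (swap_adj i \<eta>) y = ?E \<eta> (swap_adj i y)
      + of_real (k3 / (eta_bar k3 \<eta> ! i - eta_bar k3 \<eta> ! (i - 1))) * ?E \<eta> y"
    using * unfolding limit_coeff_neg[OF i(3,2)]
    by (simp add: jack_limit_def sl add_divide_distrib del: of_real_divide of_real_diff)
qed

lemma E_Jack_eq: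
  assumes "0 < n" "0 \<le> k3" "length \<eta> = n" "length y = n"
  shows "E_Jack k3 \<eta> y = jack_limit k3 \<eta> y"
proof -
  let ?E = "\<lambda>\<eta> y. if length \<eta> = n \<and> length y = n then jack_limit k3 \<eta> y else 0"
  have "(THE E. jack_family n k3 E) = ?E"
    using jack_family_limit[OF assms(1,2)] jack_family_unique[OF _ _ assms(1)]
    by (intro the_equality) blast+
  then show ?thesis using assms(3,4) by (simp add: E_Jack_def)
qed

lemma E_BC_inf_eq_E_Jack:
  assumes "length \<eta> = n" "0 < n" "0 \<le> k3" "length z = n"
  shows "E_BC_inf k3 (neg_list \<eta>) z = 4 ^ sum_list \<eta> * E_Jack k3 \<eta> (map (\<lambda>w. (1 + cosh w) / 2) z)"
  using E_BC_inf_eq_jack_limit[OF assms] assms by (simp add: E_Jack_eq)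

text \<open>
  Iterating \<open>\<Phi>\<close> moves a block of entries from the front to the end, raises each of them by one and
  splits off the corresponding variables.
\<close>

lemma E_Jack_rotate:
  assumes "length ws = length \<beta>" "length ys = length \<eta>" "0 < length \<beta> + length \<eta>" "0 \<le> k3"
  shows "E_Jack k3 (\<eta> @ map Suc \<beta>) (ys @ ws) = prod_list ws * E_Jack k3 (\<beta> @ \<eta>) (ws @ ys)"
  using assms
proof (induction \<beta> arbitrary: \<eta> ys ws rule: rev_induct)
  case (snoc b \<beta>)
  obtain ws' w where ws: "ws = ws' @ [w]" "length ws' = length \<beta>"
    using snoc.prems(1) by (cases ws rule: rev_cases) auto
  let ?n = "Suc (length \<beta> + length \<eta>)"
  have "E_Jack k3 ((\<eta> @ map Suc \<beta>) @ [Suc b]) ((ys @ ws') @ [w])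
      = w * E_Jack k3 (b # \<eta> @ map Suc \<beta>) (w # ys @ ws')"
    using snoc.prems ws by (simp add: E_Jack_eq[of ?n] jack_limit_Phi del: append_assoc)
  also have "E_Jack k3 (b # \<eta> @ map Suc \<beta>) (w # ys @ ws') = prod_list ws' * E_Jack k3 (\<beta> @ b # \<eta>) (ws' @ w # ys)"
    using snoc.IH[of ws' "w # ys" "b # \<eta>"] snoc.prems ws by simp
  finally show ?case by (simp add: ws mult_ac)
qed simp

section \<open>Positive entries\<close>

text \<open>
  The entries of \<open>x\<close> at the positions of the positive entries of \<open>\<nu>\<close>. Unlike \<open>select\<close> with a list of positions,
  the description by \<open>zip\<close> and \<open>filter\<close> is compatible with splitting lists.
\<close>

definition pos_part :: "int list \<Rightarrow> 'a list \<Rightarrow> 'a list" where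
  "pos_part \<nu> x = map snd (filter (\<lambda>p. 0 < fst p) (zip \<nu> x))"

definition nonpos_part :: "int list \<Rightarrow> 'a list \<Rightarrow> 'a list" where
  "nonpos_part \<nu> x = map snd (filter (\<lambda>p. \<not> 0 < fst p) (zip \<nu> x))"

definition front_perm :: "int list \<Rightarrow> 'a list \<Rightarrow> 'a list" where
  "front_perm \<nu> x = rev (pos_part \<nu> x) @ nonpos_part \<nu> x"

lemma zip_eq_map_upt:
  "length x = length \<nu> \<Longrightarrow> zip \<nu> x = map (\<lambda>i. (\<nu> ! (i - 1), x ! (i - 1))) [1..<Suc (length \<nu>)]"
  by (rule nth_equalityI) (simp_all del: upt_Suc)

lemma select_pos_inds: "length x = length \<nu> \<Longrightarrow> select x (pos_inds \<nu>) = pos_part \<nu> x"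
  by (simp add: pos_part_def zip_eq_map_upt select_def pos_inds_def filter_map comp_def del: upt_Suc)

lemma select_nonpos_inds: "length x = length \<nu> \<Longrightarrow> select x (nonpos_inds \<nu>) = nonpos_part \<nu> x"
  by (simp add: nonpos_part_def zip_eq_map_upt select_def nonpos_inds_def filter_map comp_def del: upt_Suc)

lemma length_parts:
  assumes "length x = length \<nu>"
  shows "length (pos_part \<nu> x) = length (pos_inds \<nu>)"
    and "length (nonpos_part \<nu> x) = length (nonpos_inds \<nu>)"
  using arg_cong[OF select_pos_inds[OF assms], of length]
    arg_cong[OF select_nonpos_inds[OF assms], of length] by (simp_all add: select_def)

lemma select_rev: "select x (rev I) = rev (select x I)"
  by (simp add: select_def rev_map)

lemma select_front: "length x = length \<nu> \<Longrightarrow>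
    select x (rev (pos_inds \<nu>)) @ select x (nonpos_inds \<nu>) = front_perm \<nu> x"
  by (simp add: select_rev select_pos_inds select_nonpos_inds front_perm_def)

lemma pos_part_map: "pos_part \<nu> (map f x) = map f (pos_part \<nu> x)"
  and nonpos_part_map: "nonpos_part \<nu> (map f x) = map f (nonpos_part \<nu> x)"
  by (simp_all add: pos_part_def nonpos_part_def zip_map2 filter_map comp_def case_prod_unfold)

lemma front_perm_map: "front_perm \<nu> (map f x) = map f (front_perm \<nu> x)"
  by (simp add: front_perm_def pos_part_map nonpos_part_map rev_map)

lemma length_front_perm: "length x = length \<nu> \<Longrightarrow> length (front_perm \<nu> x) = length \<nu>"
proof (induction \<nu> arbitrary: x)
  case (Cons a \<nu>)
  then show ?case by (cases x) (auto simp: front_perm_def pos_part_def nonpos_part_def)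
qed (simp add: front_perm_def pos_part_def nonpos_part_def)

lemma parts_nonpos:
  assumes "\<forall>a\<in>set \<nu>. a \<le> 0" "length x = length \<nu>"
  shows "pos_part \<nu> x = []" "nonpos_part \<nu> x = x" "front_perm \<nu> x = x"
proof -
  have "\<forall>p\<in>set (zip \<nu> x). \<not> 0 < fst p" using assms(1) by (auto dest!: set_zip_leftD simp: not_less)
  then show "pos_part \<nu> x = []" "nonpos_part \<nu> x = x"
    using assms(2) by (simp_all add: pos_part_def nonpos_part_def filter_empty_conv filter_True)
  then show "front_perm \<nu> x = x" by (simp add: front_perm_def)
qed

lemma parts_append:
  assumes "\<forall>b\<in>set xs. b \<le> 0" "0 < a" "length zx = length xs"
  shows "pos_part (xs @ a # ys) (zx @ w # zy) = w # pos_part ys zy"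
    and "nonpos_part (xs @ a # ys) (zx @ w # zy) = zx @ nonpos_part ys zy"
    and "pos_part ((1 - a) # xs @ ys) (w' # zx @ zy) = pos_part ys zy"
    and "nonpos_part ((1 - a) # xs @ ys) (w' # zx @ zy) = w' # zx @ nonpos_part ys zy"
  using parts_nonpos(1,2)[OF assms(1,3)] assms(2,3) by (simp_all add: pos_part_def nonpos_part_def)

lemma front_perm_append:
  assumes "\<forall>b\<in>set xs. b \<le> 0" "0 < a" "length zx = length xs"
  shows "front_perm (xs @ a # ys) (zx @ w # zy) = front_perm ((1 - a) # xs @ ys) (w # zx @ zy)"
  using parts_append[OF assms] by (simp add: front_perm_def)

text \<open>
  Moving the first positive entry \<open>a\<close> to the front and reflecting it to \<open>1 - a\<close> removes one positive entry;
  this is the inverse of the word \<open>s\<^bsub>i-1\<^esub> \<cdots> s\<^sub>1 s\<^sub>0\<close>.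
\<close>

lemma positive_induct [case_names nonpos pos]:
  assumes nonpos: "\<And>\<nu>. \<forall>a\<in>set \<nu>. a \<le> 0 \<Longrightarrow> P \<nu>"
    and pos: "\<And>xs a ys. \<forall>b\<in>set xs. b \<le> 0 \<Longrightarrow> 0 < a \<Longrightarrow> P ((1 - a) # xs @ ys) \<Longrightarrow> P (xs @ a # ys)"
  shows "P (\<nu> :: int list)"
proof (induction "length (filter (\<lambda>a. 0 < a) \<nu>)" arbitrary: \<nu>)
  case 0
  then show ?case by (intro nonpos) (auto simp: filter_empty_conv not_less)
next
  case (Suc m)
  then have "\<exists>a\<in>set \<nu>. 0 < a" by (metis filter_False length_0_conv nat.distinct(1))
  then obtain xs a ys where e: "\<nu> = xs @ a # ys" "0 < a" "\<forall>b\<in>set xs. \<not> 0 < b"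
    using split_list_first_prop[of \<nu> "\<lambda>a. 0 < a"] by blast
  have "filter (\<lambda>a. 0 < a) xs = []" using e(3) by (simp add: filter_empty_conv)
  then have "P ((1 - a) # xs @ ys)" using Suc(2) e(2) by (intro Suc(1)) (simp add: e(1))
  then show ?case unfolding e(1) using e(2,3) by (intro pos) (simp_all add: not_less)
qed

text \<open>
  An explicit form of \<open>lam_star\<close>.
\<close>

definition star :: "int list \<Rightarrow> int list" where
  "star \<nu> = map (\<lambda>a. 1 - a) (rev (pos_part \<nu> \<nu>)) @ nonpos_part \<nu> \<nu>"

lemma star_append:
  assumes "\<forall>b\<in>set xs. b \<le> 0" "0 < a"
  shows "star (xs @ a # ys) = star ((1 - a) # xs @ ys)"
  unfolding star_def using parts_append[OF assms refl] by simp

lemma star_nonpos: "\<forall>a\<in>set \<nu>. a \<le> 0 \<Longrightarrow> star \<nu> = \<nu>"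
  using parts_nonpos[of \<nu> \<nu>] by (simp add: star_def)

lemma set_star: "\<forall>a\<in>set (star \<nu>). a \<le> 0"
  by (induction \<nu> rule: positive_induct) (simp_all only: star_nonpos star_append)

lemma length_star [simp]: "length (star \<nu>) = length \<nu>"
  using length_front_perm[of \<nu> \<nu>] by (simp add: star_def front_perm_def)

lemma list_split_at:
  assumes "length z = length (xs @ a # ys)"
  obtains zx w zy where "z = zx @ w # zy" "length zx = length xs" "length zy = length ys"
proof -
  have "length xs < length z" using assms by simp
  then have "z = take (length xs) z @ z ! length xs # drop (Suc (length xs)) z"
    by (rule id_take_nth_drop)
  with assms that[of "take (length xs) z" "z ! length xs" "drop (Suc (length xs)) z"] show thesis by simp
qed

subsection \<open>Words in the simple reflections\<close>

lemma refl_word_1: "refl_word 1 (Suc (length xs)) (xs @ a # ys) = a # xs @ ys"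
proof (induction xs arbitrary: ys rule: rev_induct)
  case (snoc b xs)
  have "refl_word 1 (Suc (length (xs @ [b]))) ((xs @ [b]) @ a # ys)
      = refl_word 1 (Suc (length xs)) (aff_refl (Suc (length xs)) (xs @ b # a # ys))"
    by (simp add: refl_word_def)
  also have "aff_refl (Suc (length xs)) (xs @ b # a # ys) = xs @ a # b # ys"
    by (simp add: aff_refl_def swap_adj_append)
  finally show ?case using snoc.IH[of "b # ys"] by simp
qed (simp add: refl_word_def)

lemma refl_word_0: "refl_word 0 (Suc m) x = aff_refl 0 (refl_word 1 (Suc m) x)"
  by (simp add: refl_word_def upt_conv_Cons del: upt_Suc)

lemma refl_word_0_append: "refl_word 0 (Suc (length xs)) (xs @ a # ys) = (1 - a) # xs @ ys"
  by (simp only: refl_word_0 refl_word_1) (simp add: aff_refl_def)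

text \<open>
  So the words in \<open>lam_star\<close> and \<open>sigma_perm\<close> can be followed one positive entry at a time.
\<close>

lemma pos_inds_append:
  assumes "\<forall>b\<in>set xs. b \<le> 0" "0 < a"
  shows "pos_inds (xs @ a # ys) = Suc (length xs) # pos_inds ((1 - a) # xs @ ys)"
proof -
  let ?m = "length xs" and ?n = "length xs + length ys"
  let ?\<nu> = "xs @ a # ys" and ?\<mu> = "(1 - a) # xs @ ys"
  have upt: "[1..<Suc (Suc ?n)] = [1..<Suc ?m] @ Suc ?m # [Suc (Suc ?m)..<Suc (Suc ?n)]"
  proof -
    have "[1..<Suc (Suc ?n)] = [1..<Suc ?m] @ [Suc ?m..<Suc (Suc ?n)]"
      using upt_add_eq_append[of 1 "Suc ?m" "Suc (length ys)"] by (simp del: upt_Suc)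
    also have "[Suc ?m..<Suc (Suc ?n)] = Suc ?m # [Suc (Suc ?m)..<Suc (Suc ?n)]"
      by (rule upt_conv_Cons) simp
    finally show ?thesis .
  qed
  have 1: "filter (\<lambda>i. 0 < ?\<nu> ! (i - 1)) [1..<Suc ?m] = []"
    using assms(1) by (auto simp: filter_empty_conv nth_append not_less simp del: upt_Suc)
  have 2: "filter (\<lambda>i. 0 < ?\<mu> ! (i - 1)) [1..<Suc ?m] = []"
  proof -
    have "\<not> 0 < ?\<mu> ! (i - 1)" if "1 \<le> i" "i < Suc ?m" for i
    proof (cases "i - 1")
      case (Suc k)
      then show ?thesis using that assms(1) by (simp add: nth_append not_less)
    qed (use assms(2) in simp)
    then show ?thesis by (auto simp: filter_empty_conv simp del: upt_Suc)
  qed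
  have 3: "\<not> 0 < ?\<mu> ! ?m"
    using assms by (cases xs rule: rev_cases) (auto simp: nth_append not_less)
  have 4: "?\<nu> ! k = ?\<mu> ! k" if "?m < k" for k
    using that by (cases k) (simp_all add: nth_append nth_Cons')
  have 5: "filter (\<lambda>i. 0 < ?\<nu> ! (i - 1)) [Suc (Suc ?m)..<Suc (Suc ?n)]
      = filter (\<lambda>i. 0 < ?\<mu> ! (i - 1)) [Suc (Suc ?m)..<Suc (Suc ?n)]"
    by (intro filter_cong refl) (simp only: set_upt atLeastLessThan_iff, subst 4, linarith, rule refl)
  have l: "length ?\<nu> = Suc ?n" "length ?\<mu> = Suc ?n" by simp_all
  show ?thesis
    unfolding pos_inds_def l upt filter_append filter.simps 1 2 5 using 3 assms(2) by simp
qed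

lemma pos_inds_nonpos: "\<forall>a\<in>set \<nu>. a \<le> 0 \<Longrightarrow> pos_inds \<nu> = []"
  by (auto simp: pos_inds_def filter_empty_conv not_less simp del: upt_Suc)

lemma lam_star_eq_star: "lam_star \<nu> = star \<nu>"
proof (induction \<nu> rule: positive_induct)
  case (nonpos \<nu>)
  then show ?case by (simp add: lam_star_def pos_inds_nonpos star_nonpos)
next
  case (pos xs a ys)
  then show ?case
    by (simp only: lam_star_def pos_inds_append fold.simps comp_apply refl_word_0_append star_append)
qed

lemma sigma_perm_eq: "length x = length \<nu> \<Longrightarrow> sigma_perm \<nu> x = front_perm \<nu> x"
proof (induction \<nu> arbitrary: x rule: positive_induct)
  case (nonpos \<nu>)
  then show ?case by (simp add: sigma_perm_def pos_inds_nonpos parts_nonpos)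
next
  case (pos xs a ys)
  obtain zx w zy where x: "x = zx @ w # zy" "length zx = length xs" "length zy = length ys"
    using pos.prems by (rule list_split_at)
  have "sigma_perm (xs @ a # ys) x = sigma_perm ((1 - a) # xs @ ys) (w # zx @ zy)"
    using refl_word_1[of zx w zy] pos(1,2) by (simp add: sigma_perm_def pos_inds_append x)
  also have "\<dots> = front_perm ((1 - a) # xs @ ys) (w # zx @ zy)"
    using x by (intro pos.IH) simp
  finally show ?case using front_perm_append[OF pos(1,2) x(2)] x(1) by simp
qed

lemma int_sum_neg_index_star:
  "int (sum_list (neg_index (star \<nu>))) = norm1 \<nu> - int (length (pos_inds \<nu>))"
proof (induction \<nu> rule: positive_induct)
  case (nonpos \<nu>)
  have "int (sum_list (neg_index \<nu>)) = norm1 \<nu>"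
    using nonpos by (induction \<nu>) (simp_all add: neg_index_def norm1_def)
  then show ?case using nonpos by (simp add: pos_inds_nonpos star_nonpos)
next
  case (pos xs a ys)
  then show ?case
    by (simp add: star_append pos_inds_append) (simp add: norm1_def)
qed

lemma neg_list_neg_index: "\<forall>a\<in>set \<nu>. a \<le> 0 \<Longrightarrow> neg_list (neg_index \<nu>) = \<nu>"
  by (simp add: neg_list_def neg_index_def map_idI)

lemma length_neg_index [simp]: "length (neg_index \<nu>) = length \<nu>"
  by (simp add: neg_index_def)

section \<open>The limit for indices with positive entries\<close>

text \<open>
  Undo the raising word: the first positive entry moves to the front at no cost, and there \<open>s\<^sub>0\<close>
  gives \<open>exp w + 1\<close>, since the function with index \<open>(1 - a, \<dots>)\<close> is even in its first variable. Evenness in the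
  variables of nonpositive entries has to be proved in the same induction.
\<close>

lemma E_BC_inf_positive:
  assumes "length \<nu> = n" "0 < n" "0 \<le> k3"
  shows "length z = n \<Longrightarrow> E_BC_inf k3 \<nu> z
      = prod_list (map (\<lambda>w. exp w + 1) (pos_part \<nu> z)) * E_BC_inf k3 (star \<nu>) (front_perm \<nu> z)"
    and "length z = n \<Longrightarrow> j < n \<Longrightarrow> \<nu> ! j \<le> 0 \<Longrightarrow> E_BC_inf k3 \<nu> (z[j := - z ! j]) = E_BC_inf k3 \<nu> z"
proof -
  have "\<forall>z. length z = n \<longrightarrow> E_BC_inf k3 \<nu> z
      = prod_list (map (\<lambda>w. exp w + 1) (pos_part \<nu> z)) * E_BC_inf k3 (star \<nu>) (front_perm \<nu> z)
      \<and> (\<forall>j<n. \<nu> ! j \<le> 0 \<longrightarrow> E_BC_inf k3 \<nu> (z[j := - z ! j]) = E_BC_inf k3 \<nu> z)"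
    using assms(1)
  proof (induction \<nu> rule: positive_induct)
    case (nonpos \<nu>)
    have "E_BC_inf k3 \<nu> (z[j := - z ! j]) = E_BC_inf k3 \<nu> z" if "length z = n" "j < n" for z j
    proof -
      have "E_BC_inf k3 (neg_list (neg_index \<nu>)) (z[j := - z ! j]) = E_BC_inf k3 (neg_list (neg_index \<nu>)) z"
        using that assms(2,3) nonpos(2)
        by (intro E_BC_inf_neg_cosh) (simp_all add: map_update list_update_same_conv)
      then show ?thesis by (simp only: neg_list_neg_index[OF nonpos(1)])
    qed
    then show ?case using nonpos by (simp add: parts_nonpos star_nonpos)
  next
    case (pos xs a ys)
    let ?\<mu> = "(1 - a) # xs @ ys"
    have "length ?\<mu> = n" using pos.prems by simp
    note ih = pos.IH[OF this]
    have IH: "E_BC_inf k3 ?\<mu> z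
      = prod_list (map (\<lambda>w. exp w + 1) (pos_part ?\<mu> z)) * E_BC_inf k3 (star ?\<mu>) (front_perm ?\<mu> z)"
      "j < n \<Longrightarrow> ?\<mu> ! j \<le> 0 \<Longrightarrow> E_BC_inf k3 ?\<mu> (z[j := - z ! j]) = E_BC_inf k3 ?\<mu> z"
      if "length z = n" for z j
      using ih that by blast+
    have step: "E_BC_inf k3 (xs @ a # ys) (zx @ w # zy) = (exp w + 1) * E_BC_inf k3 ?\<mu> (w # zx @ zy)"
      if l: "length zx = length xs" "length zy = length ys" for zx w zy
    proof -
      have "E_BC_inf k3 (xs @ a # ys) (zx @ w # zy) = E_BC_inf k3 (a # xs @ ys) (w # zx @ zy)"
        using pos(1,2) l assms(3) by (intro E_BC_inf_move_front)
      also have "\<dots> = exp w * E_BC_inf k3 ?\<mu> (- w # zx @ zy) + E_BC_inf k3 ?\<mu> (w # zx @ zy)"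
        using E_BC_inf_first[of "1 - a" "zx @ zy" "xs @ ys" k3 w] pos(2) l assms(3) by simp
      also have "E_BC_inf k3 ?\<mu> (- w # zx @ zy) = E_BC_inf k3 ?\<mu> (w # zx @ zy)"
        using IH(2)[of "w # zx @ zy" 0] l pos.prems pos(2) by auto
      finally show ?thesis by (simp add: algebra_simps)
    qed
    show ?case
    proof (intro allI impI conjI)
      fix z :: "complex list" assume z: "length z = n"
      then have "length z = length (xs @ a # ys)" using pos.prems by simp
      then obtain zx w zy where zz: "z = zx @ w # zy" "length zx = length xs" "length zy = length ys"
        by (rule list_split_at)
      have lw: "length (w # zx @ zy) = n" using zz z by simp
      show "E_BC_inf k3 (xs @ a # ys) z
        = prod_list (map (\<lambda>w. exp w + 1) (pos_part (xs @ a # ys) z))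
          * E_BC_inf k3 (star (xs @ a # ys)) (front_perm (xs @ a # ys) z)"
        unfolding zz(1) step[OF zz(2,3)] IH(1)[OF lw] star_append[OF pos(1,2)]
          front_perm_append[OF pos(1,2) zz(2)] parts_append(1,3)[OF pos(1,2) zz(2)]
        by simp
      fix j assume j: "j < n" "(xs @ a # ys) ! j \<le> 0"
      consider "j < length xs" | "j = length xs" | "length xs < j" by linarith
      then show "E_BC_inf k3 (xs @ a # ys) (z[j := - z ! j]) = E_BC_inf k3 (xs @ a # ys) z"
      proof cases
        case 1
        have e: "z[j := - z ! j] = zx[j := - zx ! j] @ w # zy"
          using 1 zz by (simp add: list_update_append nth_append)
        have "E_BC_inf k3 ?\<mu> ((w # zx @ zy)[Suc j := - (w # zx @ zy) ! Suc j]) = E_BC_inf k3 ?\<mu> (w # zx @ zy)"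
          using 1 j zz z pos.prems by (intro IH(2)[OF lw]) (simp_all add: nth_append)
        then have "E_BC_inf k3 ?\<mu> (w # zx[j := - zx ! j] @ zy) = E_BC_inf k3 ?\<mu> (w # zx @ zy)"
          using 1 zz by (simp add: list_update_append nth_append)
        then show ?thesis using step[of "zx[j := - zx ! j]" zy w] step[OF zz(2,3), of w] zz e by simp
      next
        case 2
        then show ?thesis using j pos(2) by simp
      next
        case 3
        then obtain k where k: "j = Suc (length xs + k)" using less_imp_Suc_add by blast
        have e: "z[j := - z ! j] = zx @ w # zy[k := - zy ! k]"
          using k zz by (simp add: list_update_append nth_append)
        have "E_BC_inf k3 ?\<mu> ((w # zx @ zy)[j := - (w # zx @ zy) ! j]) = E_BC_inf k3 ?\<mu> (w # zx @ zy)"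
          using j k by (intro IH(2)[OF lw]) (simp_all add: nth_append)
        then have "E_BC_inf k3 ?\<mu> (w # zx @ zy[k := - zy ! k]) = E_BC_inf k3 ?\<mu> (w # zx @ zy)"
          using k zz by (simp add: list_update_append nth_append)
        then show ?thesis using step[of zx "zy[k := - zy ! k]" w] step[OF zz(2,3), of w] zz e by simp
      qed
    qed
  qed
  then show "length z = n \<Longrightarrow> E_BC_inf k3 \<nu> z
      = prod_list (map (\<lambda>w. exp w + 1) (pos_part \<nu> z)) * E_BC_inf k3 (star \<nu>) (front_perm \<nu> z)"
    and "length z = n \<Longrightarrow> j < n \<Longrightarrow> \<nu> ! j \<le> 0 \<Longrightarrow> E_BC_inf k3 \<nu> (z[j := - z ! j]) = E_BC_inf k3 \<nu> z"
    by blast+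
qed

lemma cosh_square_half: "(cosh (t / 2))\<^sup>2 = (1 + cosh t) / (2 :: real)"
  using cosh_double_cosh[of "t / 2"] by simp

lemma cosh_of_real: "cosh (complex_of_real t) = of_real (cosh t)"
  by (simp add: cosh_def scaleR_conv_of_real exp_of_real flip: of_real_minus)

lemma cosh2_half_eq: "cosh2_half x = map (\<lambda>w. (1 + cosh w) / 2) (cvec x)"
  by (simp add: cosh2_half_def cvec_def cosh_square_half cosh_of_real)

lemma E_BC_inf_star_eq_E_Jack:
  assumes "length \<nu> = n" "0 < n" "0 \<le> k3" "length x = n"
  shows "E_BC_inf k3 (star \<nu>) (cvec x)
    = 4 powi (norm1 \<nu> - int (length (pos_inds \<nu>))) * E_Jack k3 (neg_index (star \<nu>)) (cosh2_half x)"
proof -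
  have "E_BC_inf k3 (neg_list (neg_index (star \<nu>))) (cvec x)
    = 4 ^ sum_list (neg_index (star \<nu>)) * E_Jack k3 (neg_index (star \<nu>)) (cosh2_half x)"
    unfolding cosh2_half_eq using assms by (intro E_BC_inf_eq_E_Jack) (simp_all add: cvec_def)
  then show ?thesis
    by (simp add: neg_list_neg_index[OF set_star] flip: int_sum_neg_index_star)
qed

lemma prod_pos_inds:
  fixes g :: "'a \<Rightarrow> 'b::comm_monoid_mult"
  assumes "length x = length \<nu>"
  shows "(\<Prod>i\<in>set (pos_inds \<nu>). g (x ! (i - 1))) = prod_list (map g (pos_part \<nu> x))"
proof -
  have "distinct (pos_inds \<nu>)" by (simp add: pos_inds_def del: upt_Suc)
  then have "(\<Prod>i\<in>set (pos_inds \<nu>). g (x ! (i - 1))) = prod_list (map (\<lambda>i. g (x ! (i - 1))) (pos_inds \<nu>))"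
    by (rule prod.distinct_set_conv_list)
  also have "map (\<lambda>i. g (x ! (i - 1))) (pos_inds \<nu>) = map g (select x (pos_inds \<nu>))"
    by (simp add: select_def)
  finally show ?thesis using assms by (simp add: select_pos_inds)
qed

lemma of_real_prod_list: "of_real (prod_list xs) = prod_list (map of_real xs)"
  by (induction xs) simp_all

lemma prod_pos_inds_exp:
  assumes "length x = length \<nu>"
  shows "prod_list (map (\<lambda>w. exp w + 1) (pos_part \<nu> (cvec x)))
    = complex_of_real (\<Prod>i\<in>set (pos_inds \<nu>). (exp (x ! (i - 1)) + 1))"
  unfolding prod_pos_inds[OF assms, of "\<lambda>t. exp t + 1"]
  by (simp add: cvec_def pos_part_map of_real_prod_list comp_def exp_of_real)

lemma E_BC_inf_cvec_positive:
  assumes "length \<nu> = n" "0 < n" "0 \<le> k3" "length x = n"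
  shows "E_BC_inf k3 \<nu> (cvec x) = of_real (\<Prod>i\<in>set (pos_inds \<nu>). (exp (x ! (i - 1)) + 1))
      * E_BC_inf k3 (star \<nu>) (cvec (front_perm \<nu> x))" (is ?A)
    and "E_BC_inf k3 \<nu> (cvec x) = 4 powi (norm1 \<nu> - int (length (pos_inds \<nu>)))
      * of_real (\<Prod>i\<in>set (pos_inds \<nu>). (exp (x ! (i - 1)) + 1))
      * E_Jack k3 (neg_index (star \<nu>)) (cosh2_half (front_perm \<nu> x))"
proof -
  have lx: "length x = length \<nu>" and lc: "length (cvec x) = n" and lp: "length (front_perm \<nu> x) = n"
    using assms(1,4) by (simp_all add: cvec_def length_front_perm)
  have fp: "front_perm \<nu> (cvec x) = cvec (front_perm \<nu> x)" by (simp add: cvec_def front_perm_map)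
  show A: ?A
    unfolding E_BC_inf_positive(1)[OF assms(1-3) lc] fp prod_pos_inds_exp[OF lx] ..
  show "E_BC_inf k3 \<nu> (cvec x) = 4 powi (norm1 \<nu> - int (length (pos_inds \<nu>)))
      * of_real (\<Prod>i\<in>set (pos_inds \<nu>). (exp (x ! (i - 1)) + 1))
      * E_Jack k3 (neg_index (star \<nu>)) (cosh2_half (front_perm \<nu> x))"
    unfolding A E_BC_inf_star_eq_E_Jack[OF assms(1-3) lp] by (simp only: mult_ac)
qed

section \<open>Averaging over sign changes\<close>

lemma sign_vectors_0: "sign_vectors 0 = {[]}"
  by (auto simp: sign_vectors_def)

lemma sign_vectors_Suc: "sign_vectors (Suc n) = (#) 1 ` sign_vectors n \<union> (#) (-1) ` sign_vectors n"
  (is "?L = ?R")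
proof (intro equalityI subsetI)
  fix \<tau> assume "\<tau> \<in> ?L"
  then show "\<tau> \<in> ?R" by (cases \<tau>) (auto simp: sign_vectors_def)
qed (auto simp: sign_vectors_def)

lemma finite_sign_vectors: "finite (sign_vectors n)"
  by (induction n) (simp_all add: sign_vectors_0 sign_vectors_Suc)

lemma sum_sign_vectors_Suc:
  fixes f :: "real list \<Rightarrow> 'a::comm_monoid_add"
  shows "(\<Sum>\<tau>\<in>sign_vectors (Suc n). f \<tau>) = (\<Sum>\<tau>\<in>sign_vectors n. f (1 # \<tau>)) + (\<Sum>\<tau>\<in>sign_vectors n. f (-1 # \<tau>))"
proof -
  have "(\<Sum>\<tau>\<in>sign_vectors (Suc n). f \<tau>) = sum f ((#) 1 ` sign_vectors n) + sum f ((#) (-1) ` sign_vectors n)"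
    unfolding sign_vectors_Suc by (rule sum.union_disjoint) (auto simp: finite_sign_vectors)
  then show ?thesis by (simp add: sum.reindex)
qed

text \<open>
  The sum factors over the coordinates, and \<open>(exp w + 1) + (exp (-w) + 1) = 2 (cosh w + 1)\<close>.
\<close>

lemma sum_sign_vectors_exp:
  assumes "length x = length \<nu>"
  shows "(\<Sum>\<tau>\<in>sign_vectors (length \<nu>). prod_list (map (\<lambda>w. exp w + 1) (pos_part \<nu> (sign_act \<tau> x))))
    = 2 ^ length \<nu> * prod_list (map (\<lambda>w. cosh w + 1) (pos_part \<nu> x :: real list))"
  using assms
proof (induction x \<nu> rule: list_induct2)
  case Nil
  then show ?case by (simp add: sign_vectors_0 pos_part_def)
next
  case (Cons w x a \<nu>)
  let ?S = "\<Sum>\<tau>\<in>sign_vectors (length \<nu>). prod_list (map (\<lambda>w. exp w + 1) (pos_part \<nu> (sign_act \<tau> x)))"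
  let ?g = "\<lambda>w. if 0 < a then exp w + 1 else 1 :: real"
  have c: "prod_list (map (\<lambda>w. exp w + 1) (pos_part (a # \<nu>) (sign_act (s # \<tau>) (w # x))))
    = ?g (s * w) * prod_list (map (\<lambda>w. exp w + 1) (pos_part \<nu> (sign_act \<tau> x)))" for s \<tau>
    by (simp add: sign_act_def pos_part_def)
  have "(\<Sum>\<tau>\<in>sign_vectors (length (a # \<nu>)). prod_list (map (\<lambda>w. exp w + 1) (pos_part (a # \<nu>) (sign_act \<tau> (w # x)))))
    = (?g w + ?g (- w)) * ?S"
    unfolding list.size(4) add_Suc_right add_0_right sum_sign_vectors_Suc c sum_distrib_left[symmetric]
    by (simp only: mult_1_left mult_minus1 distrib_right)
  also have "?g w + ?g (- w) = 2 * (if 0 < a then cosh w + 1 else 1)"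
    by (simp add: cosh_def)
  finally show ?case unfolding Cons.IH by (simp add: pos_part_def)
qed

lemma sign_act_cosh: "\<tau> \<in> sign_vectors (length x) \<Longrightarrow> cosh2_half (sign_act \<tau> x) = cosh2_half x"
proof (rule nth_equalityI)
  assume \<tau>: "\<tau> \<in> sign_vectors (length x)"
  then have l: "length \<tau> = length x" by (simp add: sign_vectors_def)
  then show "length (cosh2_half (sign_act \<tau> x)) = length (cosh2_half x)"
    by (simp add: cosh2_half_def sign_act_def)
  fix i assume "i < length (cosh2_half (sign_act \<tau> x))"
  then have i: "i < length x" using l by (simp add: cosh2_half_def sign_act_def)
  then have "\<tau> ! i \<in> set \<tau>" using l by simp
  then have "\<tau> ! i = 1 \<or> \<tau> ! i = -1" using \<tau> unfolding sign_vectors_def by blast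
  then have e: "cosh (sign_act \<tau> x ! i / 2) = cosh (x ! i / 2)"
    using i l by (elim disjE) (simp_all add: sign_act_def)
  have "cosh2_half (sign_act \<tau> x) ! i = of_real ((cosh (sign_act \<tau> x ! i / 2))\<^sup>2)"
    using i l by (simp add: cosh2_half_def sign_act_def)
  also have "\<dots> = cosh2_half x ! i" unfolding e using i by (simp add: cosh2_half_def)
  finally show "cosh2_half (sign_act \<tau> x) ! i = cosh2_half x ! i" .
qed

lemma cosh2_half_front_perm: "cosh2_half (front_perm \<nu> x) = front_perm \<nu> (cosh2_half x)"
  by (simp add: cosh2_half_def front_perm_map)

lemma sign_average_E_BC_inf:
  assumes "length \<nu> = n" "0 < n" "0 \<le> k3" "length x = n"
  shows "sign_average n (E_BC_inf k3 \<nu>) x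
    = of_real (4 powr (of_int (norm1 \<nu>) - real (length (pos_inds \<nu>)) / 2))
      * of_real (\<Prod>i\<in>set (pos_inds \<nu>). (cosh (x ! (i - 1) / 2))\<^sup>2)
      * E_Jack k3 (neg_index (star \<nu>)) (cosh2_half (front_perm \<nu> x))"
proof -
  let ?l = "length (pos_inds \<nu>)" and ?s = "sum_list (neg_index (star \<nu>))"
  let ?J = "E_Jack k3 (neg_index (star \<nu>)) (cosh2_half (front_perm \<nu> x))"
  have val: "E_BC_inf k3 \<nu> (cvec (sign_act \<tau> x))
      = of_real (prod_list (map (\<lambda>w. exp w + 1) (pos_part \<nu> (sign_act \<tau> x)))) * (4 ^ ?s * ?J)"
    if \<tau>: "\<tau> \<in> sign_vectors n" for \<tau>
  proof -
    have l: "length (sign_act \<tau> x) = n" using \<tau> assms by (simp add: sign_vectors_def sign_act_def)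
    have lp: "length (front_perm \<nu> (sign_act \<tau> x)) = n" using l assms(1) by (simp add: length_front_perm)
    have lc: "length (cvec (sign_act \<tau> x)) = n" using l by (simp add: cvec_def)
    have fp: "front_perm \<nu> (cvec (sign_act \<tau> x)) = cvec (front_perm \<nu> (sign_act \<tau> x))"
      by (simp add: cvec_def front_perm_map)
    have c: "cosh2_half (front_perm \<nu> (sign_act \<tau> x)) = cosh2_half (front_perm \<nu> x)"
      using \<tau> assms(4) by (simp add: cosh2_half_front_perm sign_act_cosh)
    have "E_BC_inf k3 (star \<nu>) (cvec (front_perm \<nu> (sign_act \<tau> x))) = 4 ^ ?s * ?J"
      unfolding E_BC_inf_star_eq_E_Jack[OF assms(1-3) lp] c int_sum_neg_index_star[symmetric] by simp
    moreover have "prod_list (map (\<lambda>w. exp w + 1) (pos_part \<nu> (cvec (sign_act \<tau> x))))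
        = complex_of_real (prod_list (map (\<lambda>w. exp w + 1) (pos_part \<nu> (sign_act \<tau> x))))"
      by (simp add: cvec_def pos_part_map of_real_prod_list comp_def exp_of_real)
    ultimately show ?thesis
      unfolding E_BC_inf_positive(1)[OF assms(1-3) lc] fp by simp
  qed
  have "(\<Sum>\<tau>\<in>sign_vectors n. E_BC_inf k3 \<nu> (cvec (sign_act \<tau> x)))
    = of_real (\<Sum>\<tau>\<in>sign_vectors n. prod_list (map (\<lambda>w. exp w + 1) (pos_part \<nu> (sign_act \<tau> x)))) * (4 ^ ?s * ?J)"
    by (simp add: val sum_distrib_right)
  also have "(\<Sum>\<tau>\<in>sign_vectors n. prod_list (map (\<lambda>w. exp w + 1) (pos_part \<nu> (sign_act \<tau> x))))
    = 2 ^ n * prod_list (map (\<lambda>w. cosh w + 1) (pos_part \<nu> x))"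
    using sum_sign_vectors_exp[of x \<nu>] assms by simp
  finally have avg: "sign_average n (E_BC_inf k3 \<nu>) x
    = of_real (prod_list (map (\<lambda>w. cosh w + 1) (pos_part \<nu> x))) * (4 ^ ?s * ?J)"
    by (simp add: sign_average_def)
  have "prod_list (map (\<lambda>w. cosh w + 1) ws) = 2 ^ length ws * prod_list (map (\<lambda>w. (cosh (w / 2))\<^sup>2) ws)"
    for ws :: "real list"
    by (induction ws) (simp_all add: cosh_square_half field_simps)
  moreover have "length (pos_part \<nu> x) = ?l"
    using assms by (simp add: length_parts)
  moreover have "prod_list (map (\<lambda>w. (cosh (w / 2))\<^sup>2) (pos_part \<nu> x))
      = (\<Prod>i\<in>set (pos_inds \<nu>). (cosh (x ! (i - 1) / 2))\<^sup>2)"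
    using assms by (intro prod_pos_inds[symmetric]) simp
  ultimately have P: "prod_list (map (\<lambda>w. cosh w + 1) (pos_part \<nu> x))
      = 2 ^ ?l * (\<Prod>i\<in>set (pos_inds \<nu>). (cosh (x ! (i - 1) / 2))\<^sup>2)"
    by simp
  have "of_int (norm1 \<nu>) - real ?l / 2 = real ?s + real ?l / 2"
    using arg_cong[OF int_sum_neg_index_star[of \<nu>], of real_of_int] by simp
  \<comment> \<open>Each positive entry contributes \<open>2\<close> from \<open>cosh w + 1 = 2 cosh\<^sup>2 (w / 2)\<close>, which is \<open>4\<^bsup>1/2\<^esup>\<close>.\<close>
  then have "4 powr (of_int (norm1 \<nu>) - real ?l / 2) = 4 powr real ?s * 4 powr (real ?l / 2)"
    by (simp add: powr_add)
  also have "4 powr (real ?l / 2) = (2 :: real) ^ ?l"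
  proof -
    have "(4 :: real) powr (real ?l / 2) = (2 powr 2) powr (real ?l / 2)" by simp
    also have "\<dots> = 2 powr real ?l" unfolding powr_powr by simp
    finally show ?thesis by (simp add: powr_realpow)
  qed
  finally have "4 powr (of_int (norm1 \<nu>) - real ?l / 2) = 4 ^ ?s * (2 :: real) ^ ?l"
    by (simp add: powr_realpow)
  then show ?thesis unfolding avg P by simp
qed

text \<open>
  The factors \<open>y\<^sub>i\<close> at the positive entries are absorbed by moving the block of these entries to the
  end, where \<open>a - 1\<close> becomes \<open>a\<close>.
\<close>

lemma E_Jack_star2:
  fixes y :: "complex list"
  assumes "length \<nu> = n" "0 < n" "0 \<le> k3" "length y = n"
  shows "E_Jack k3 (neg_index (lam_star2 \<nu>)) (sigma_star \<nu> y)
    = prod_list (pos_part \<nu> y) * E_Jack k3 (neg_index (star \<nu>)) (front_perm \<nu> y)"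
proof -
  let ?\<beta> = "map (\<lambda>a. nat (a - 1)) (rev (pos_part \<nu> \<nu>))" and ?\<eta> = "neg_index (nonpos_part \<nu> \<nu>)"
  let ?ws = "rev (pos_part \<nu> y)" and ?ys = "nonpos_part \<nu> y"
  have pos: "0 < a" if "a \<in> set (pos_part \<nu> \<nu>)" for a
    using that by (auto simp: pos_part_def zip_same_conv_map)
  have "neg_index (lam_star2 \<nu>) = ?\<eta> @ map nat (rev (pos_part \<nu> \<nu>))"
    by (simp add: neg_index_def lam_star2_def select_rev select_pos_inds select_nonpos_inds comp_def)
  also have "map nat (rev (pos_part \<nu> \<nu>)) = map Suc ?\<beta>"
    unfolding map_map
  proof (rule map_cong[OF refl])
    fix a assume "a \<in> set (rev (pos_part \<nu> \<nu>))"
    then have "0 < a" using pos by simp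
    then show "nat a = (Suc \<circ> (\<lambda>a. nat (a - 1))) a" unfolding comp_def by arith
  qed
  finally have 1: "neg_index (lam_star2 \<nu>) = ?\<eta> @ map Suc ?\<beta>" .
  have 2: "sigma_star \<nu> y = ?ys @ ?ws"
    using assms by (simp add: sigma_star_def select_rev select_pos_inds select_nonpos_inds)
  have 3: "neg_index (star \<nu>) = ?\<beta> @ ?\<eta>"
    by (simp add: neg_index_def star_def comp_def)
  have l: "length (pos_part \<nu> y) = length (pos_part \<nu> \<nu>)" "length (nonpos_part \<nu> y) = length (nonpos_part \<nu> \<nu>)"
    using assms by (simp_all add: length_parts)
  have ln: "length ?\<beta> + length ?\<eta> = n"
    using length_star[of \<nu>] assms(1) by (simp add: star_def neg_index_def)
  have "E_Jack k3 (?\<eta> @ map Suc ?\<beta>) (?ys @ ?ws) = prod_list ?ws * E_Jack k3 (?\<beta> @ ?\<eta>) (?ws @ ?ys)"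
    using l ln assms(2,3) by (intro E_Jack_rotate) simp_all
  moreover have "prod_list (rev v) = prod_list v" for v :: "complex list"
    by (induction v) (simp_all add: mult.commute)
  ultimately show ?thesis unfolding 1 2 3 front_perm_def by simp
qed

theorem theorem5p9:
  fixes n :: nat and k3 :: real
  assumes "1 \<le> n" and "0 \<le> k3"
  shows
    "(\<forall>lam. length lam = n \<longrightarrow>
        (\<forall>R. uniform_limit {z. length z = n \<and> (\<forall>w\<in>set z. cmod w \<le> R)}
               (\<lambda>(k1, k2). E_BC (k1, k2, k3) lam) (E_BC_inf k3 lam) BC_filter))
     \<and>
     (\<forall>\<eta> x. length \<eta> = n \<and> length x = n \<longrightarrow>
        E_BC_inf k3 (map (\<lambda>m. - int m) \<eta>) (cvec x)
          = 4 ^ sum_list \<eta> * E_Jack k3 \<eta> (cosh2_half x))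
     \<and>
     (\<forall>lam x. length lam = n \<and> length x = n \<and> (\<exists>a\<in>set lam. 0 < a) \<longrightarrow>
        lam_star lam = map (\<lambda>a. 1 - a) (select lam (rev (pos_inds lam))) @ select lam (nonpos_inds lam)
        \<and> (\<forall>a\<in>set (lam_star lam). a \<le> 0)
        \<and> E_BC_inf k3 lam (cvec x)
            = of_real (\<Prod>i\<in>set (pos_inds lam). (exp (x ! (i - 1)) + 1))
              * E_BC_inf k3 (lam_star lam)
                  (cvec (select x (rev (pos_inds lam)) @ select x (nonpos_inds lam)))
        \<and> E_BC_inf k3 lam (cvec x)
            = 4 powi (norm1 lam - int (length (pos_inds lam)))
              * of_real (\<Prod>i\<in>set (pos_inds lam). (exp (x ! (i - 1)) + 1))
              * E_Jack k3 (neg_index (lam_star lam))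
                  (cosh2_half (select x (rev (pos_inds lam)) @ select x (nonpos_inds lam)))
        \<and> (\<forall>j\<in>{1..n} - set (pos_inds lam).
              E_BC_inf k3 lam (cvec (x[j - 1 := - x ! (j - 1)])) = E_BC_inf k3 lam (cvec x)))
     \<and>
     (\<forall>lam x. length lam = n \<and> length x = n \<longrightarrow>
        sigma_perm lam x = select x (rev (pos_inds lam)) @ select x (nonpos_inds lam)
        \<and> sign_average n (E_BC_inf k3 lam) x
            = of_real (4 powr (of_int (norm1 lam) - real (length (pos_inds lam)) / 2))
              * of_real (\<Prod>i\<in>set (pos_inds lam). (cosh (x ! (i - 1) / 2))\<^sup>2)
              * E_Jack k3 (neg_index (lam_star lam)) (cosh2_half (sigma_perm lam x))
        \<and> ((\<forall>a\<in>set lam. a \<le> 0) \<longrightarrow>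
              length (pos_inds lam) = 0 \<and> lam_star lam = lam \<and> sigma_perm lam x = x))
     \<and>
     (\<forall>lam x. length lam = n \<and> length x = n \<longrightarrow>
        sign_average n (E_BC_inf k3 lam) x
          = of_real (4 powr (of_int (norm1 lam) - real (length (pos_inds lam)) / 2))
            * E_Jack k3 (neg_index (lam_star2 lam)) (sigma_star lam (cosh2_half x)))"
proof -
  have n: "0 < n" using assms(1) by simp
  show ?thesis
  proof (intro conjI allI impI ballI, goal_cases)
    case (1 lam R)
    then show ?case using E_BC_uniform_limit[OF _ n assms(2)] by (simp add: polydisc_def)
  next
    case (2 \<eta> x)
    then show ?case
      using E_BC_inf_eq_E_Jack[OF _ n assms(2), of \<eta> "cvec x"]
      by (simp add: cosh2_half_eq cvec_def flip: neg_list_def)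
  next
    case (3 lam x)
    show ?case
      by (simp add: lam_star_eq_star star_def select_rev select_pos_inds select_nonpos_inds)
  next
    case (4 lam x a)
    then show ?case using set_star by (simp add: lam_star_eq_star)
  next
    case (5 lam x)
    then have l: "length lam = n" "length x = n" by simp_all
    then show ?case
      using E_BC_inf_cvec_positive(1)[OF l(1) n assms(2) l(2)]
      by (simp only: lam_star_eq_star select_front)
  next
    case (6 lam x)
    then have l: "length lam = n" "length x = n" by simp_all
    then show ?case
      using E_BC_inf_cvec_positive(2)[OF l(1) n assms(2) l(2)]
      by (simp only: lam_star_eq_star select_front)
  next
    case (7 lam x j)
    then have l: "length lam = n" "length x = n" and j: "j - 1 < n" "lam ! (j - 1) \<le> 0"
      by (auto simp: pos_inds_def not_less simp del: upt_Suc)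
    then have "cvec (x[j - 1 := - x ! (j - 1)]) = (cvec x)[j - 1 := - cvec x ! (j - 1)]"
      by (simp add: cvec_def map_update)
    then show ?case
      using E_BC_inf_positive(2)[OF l(1) n assms(2) _ j, of "cvec x"] l(2) by (simp add: cvec_def)
  next
    case (8 lam x)
    then show ?case by (simp add: sigma_perm_eq select_front)
  next
    case (9 lam x)
    then show ?case
      using sign_average_E_BC_inf[OF _ n assms(2), of lam x]
      by (simp add: sigma_perm_eq lam_star_eq_star)
  next
    case (10 lam x)
    then show ?case by (simp add: pos_inds_nonpos)
  next
    case (11 lam x)
    then show ?case by (simp add: lam_star_eq_star star_nonpos)
  next
    case (12 lam x)
    then show ?case by (simp add: sigma_perm_eq parts_nonpos)
  next
    case (13 lam x)
    then have l: "length lam = n" "length x = n" by simp_all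
    have lx: "length x = length lam" and lc: "length (cosh2_half x) = n"
      using l by (simp_all add: cosh2_half_def)
    have "prod_list (pos_part lam (cosh2_half x))
        = of_real (\<Prod>i\<in>set (pos_inds lam). (cosh (x ! (i - 1) / 2))\<^sup>2)"
      unfolding prod_pos_inds[OF lx, of "\<lambda>t. (cosh (t / 2))\<^sup>2"]
      by (simp add: cosh2_half_def pos_part_map of_real_prod_list comp_def)
    then show ?case
      unfolding sign_average_E_BC_inf[OF l(1) n assms(2) l(2)] E_Jack_star2[OF l(1) n assms(2) lc]
        cosh2_half_front_perm
      by (simp only: mult.assoc)
  qed
qed

end
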